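(* Let $u=\{u_i\}_{i=1}^N$ and $\bar u=\{\bar u_i\}_{i=1}^N$ be two entropy solutions (in the sense given in the context) of the $N$-lane system $$\partial_t u_i+\partial_x\big(u_i v_i(u_i)\big)=S_{i-1}(u_{i-1},u_i)-S_i(u_i,u_{i+1}),\qquad i=1,\dots,N,\ t>0,\ x\in\mathbb R,$$ with initial data $u_0=\{u_{i,0}\}_{i=1}^N$ and $\bar u_0=\{\bar u_{i,0}\}_{i=1}^N$, respectively. Then for $t>0$ $$\sum_{i=1}^N\int_{\mathbb R}|u_i(t,x)-\bar u_i(t,x)|\,dx\le \sum_{i=1}^N\int_{\mathbb R}|u_{i,0}(x)-\bar u_{i,0}(x)|\,dx .$$
   Context: Notation: $a^+=\max\{a,0\}$, $a^-=-\min\{a,0\}$. The system models unidirectional traffic on a road with $N$ lanes; $u_i=u_i(t,x)$ is the density and $v_i=v_i(u_i)$ the velocity function in lane $i$. The velocity functions $v_i$, $i=1,\dots,N$, are Lipschitz continuous. The lane-change terms (flow from lane $i$ to lane $i+1$) are $$S_i(a,b)=\big(v_{i+1}(b)-v_i(a)\big)^+a-\big(v_{i+1}(b)-v_i(a)\big)^-b,$$ and the system is coupled with the boundary conditions $S_0(u_0,u_1)=S_N(u_N,u_{N+1})=0$. The flux functions are $f_i(u)=u\,v_i(u)$. Initial data satisfy $u_{i,0}\in L^1(\mathbb R)\cap L^\infty(\mathbb R)$ for $i=1,\dots,N$. A weak solution with initial data $\{u_{i,0}\}$ is a family $u_i\in C([0,\infty);L^1(\mathbb R))$ such that for $i=1,\dots,N$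 $$\int_0^\infty\!\!\int_{\mathbb R}\big(u_i\varphi_t+u_iv_i(u_i)\varphi_x+(S_{i-1}(u_{i-1},u_i)-S_i(u_i,u_{i+1}))\varphi\big)\,dx\,dt+\int_{\mathbb R}u_{i,0}\,\varphi|_{t=0}\,dx=0$$ for all compactly supported $\varphi\in C^\infty([0,\infty)\times\mathbb R)$. It is an entropy solution if for $i=1,\dots,N$ $$\int_0^\infty\!\!\int_{\mathbb R}\big(\eta(u_i)\varphi_t+q_i(u_i)\varphi_x\big)\,dx\,dt+\int_{\mathbb R}\eta(u_{i,0})\varphi|_{t=0}\,dx\ \ge\ \int_0^\infty\!\!\int_{\mathbb R}\eta'(u_i)\big(S_i(u_i,u_{i+1})-S_{i-1}(u_{i-1},u_i)\big)\varphi\,dx\,dt$$ for all convex functions $\eta$, with $q_i$ defined by $q_i'(u)=\eta'(u)f_i'(u)$, and all non-negative $\varphi\in C_0^\infty([0,\infty)\times\mathbb R)$.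
   Formalization: Velocities v_i are also assumed nonincreasing on [0,∞) and the initial densities non-negative a.e.; without either the inequality fails (e.g. N=2, v_1(a)=a, v_2=0). Solutions are taken essentially bounded on each time strip, so that all integrals are defined. *)

theory Defs
  imports "HOL-Analysis.Analysis"
begin

(* Densities are functions u i t x (lane i, time t, position x).  Elements of L^1 are
   given by Borel representatives.  Only i in {1..N} and t >= 0 are relevant. *)

definition lane_change ::
    "nat \<Rightarrow> (nat \<Rightarrow> real \<Rightarrow> real) \<Rightarrow> nat \<Rightarrow> real \<Rightarrow> real \<Rightarrow> real" where
  "lane_change N v i a b =
     (if i = 0 \<or> i = N then 0
      else max (v (i + 1) b - v i a) 0 * a - (- min (v (i + 1) b - v i a) 0) * b)"

definition flux :: "(nat \<Rightarrow> real \<Rightarrow> real) \<Rightarrow> nat \<Rightarrow> real \<Rightarrow> real" where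
  "flux v i u = u * v i u"

(* C^infinity on the plane: D j k is the mixed derivative of order j in t and k in x. *)
definition smooth :: "(real \<Rightarrow> real \<Rightarrow> real) \<Rightarrow> bool" where
  "smooth \<phi> \<longleftrightarrow>
     (\<exists>D :: nat \<Rightarrow> nat \<Rightarrow> real \<Rightarrow> real \<Rightarrow> real.
        D 0 0 = \<phi> \<and>
        (\<forall>j k. continuous_on UNIV (\<lambda>(t, x). D j k t x) \<and>
           (\<forall>t x. ((\<lambda>s. D j k s x) has_real_derivative D (Suc j) k t x) (at t) \<and>
                  ((\<lambda>y. D j k t y) has_real_derivative D j (Suc k) t x) (at x))))"

(* Smooth compactly supported functions on [0,infinity) x R are the restrictions of smooth
   compactly supported functions on the plane (Seeley extension). *)
definition test_function :: "(real \<Rightarrow> real \<Rightarrow> real) \<Rightarrow> bool" where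
  "test_function \<phi> \<longleftrightarrow>
     smooth \<phi> \<and> (\<exists>R. \<forall>t x. \<phi> t x \<noteq> 0 \<longrightarrow> \<bar>t\<bar> \<le> R \<and> \<bar>x\<bar> \<le> R)"

abbreviation dt :: "(real \<Rightarrow> real \<Rightarrow> real) \<Rightarrow> real \<Rightarrow> real \<Rightarrow> real" where
  "dt \<phi> t x \<equiv> deriv (\<lambda>s. \<phi> s x) t"

abbreviation dx :: "(real \<Rightarrow> real \<Rightarrow> real) \<Rightarrow> real \<Rightarrow> real \<Rightarrow> real" where
  "dx \<phi> t x \<equiv> deriv (\<lambda>y. \<phi> t y) x"

definition L1_Linf :: "(real \<Rightarrow> real) \<Rightarrow> bool" where
  "L1_Linf g \<longleftrightarrow> integrable lborel g \<and> (\<exists>M. AE x in lborel. \<bar>g x\<bar> \<le> M)"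

definition continuous_into_L1 :: "(real \<Rightarrow> real \<Rightarrow> real) \<Rightarrow> bool" where
  "continuous_into_L1 w \<longleftrightarrow>
     set_borel_measurable lborel ({0..} \<times> UNIV) (\<lambda>(t, x). w t x) \<and>
     (\<forall>t\<ge>0. integrable lborel (w t)) \<and>
     (\<forall>t\<ge>0. ((\<lambda>s. LINT x|lborel. \<bar>w s x - w t x\<bar>) \<longlongrightarrow> 0) (at t within {0..}))"

(* For w in C([0,infinity);L^1) the products w * v(w) and the compositions \<eta>(w) below, with
   \<eta> an arbitrary convex function, need not be integrable; boundedness on every time strip
   gives a meaning to all integrals in the definitions of weak and entropy solutions. *)
definition locally_bounded_in_time :: "(real \<Rightarrow> real \<Rightarrow> real) \<Rightarrow> bool" where
  "locally_bounded_in_time w \<longleftrightarrow>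
     (\<forall>T. \<exists>M. \<forall>t\<in>{0..T}. AE x in lborel. \<bar>w t x\<bar> \<le> M)"

definition weak_solution ::
    "nat \<Rightarrow> (nat \<Rightarrow> real \<Rightarrow> real) \<Rightarrow> (nat \<Rightarrow> real \<Rightarrow> real) \<Rightarrow> (nat \<Rightarrow> real \<Rightarrow> real \<Rightarrow> real) \<Rightarrow> bool"
  where
  "weak_solution N v u0 u \<longleftrightarrow>
     (\<forall>i\<in>{1..N}.
        continuous_into_L1 (u i) \<and> locally_bounded_in_time (u i) \<and>
        (\<forall>\<phi>. test_function \<phi> \<longrightarrow>
           (LINT t:{0..}|lborel. (LINT x|lborel.
               u i t x * dt \<phi> t x + u i t x * v i (u i t x) * dx \<phi> t x
               + (lane_change N v (i - 1) (u (i - 1) t x) (u i t x)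
                  - lane_change N v i (u i t x) (u (i + 1) t x)) * \<phi> t x))
           + (LINT x|lborel. u0 i x * \<phi> 0 x) = 0))"

(* q' = \<eta>' f' for a locally Lipschitz f, which is differentiable only almost everywhere.
   Local Lipschitz continuity makes q the integral of \<eta>' f', up to a constant. *)
definition entropy_flux ::
    "(real \<Rightarrow> real) \<Rightarrow> (real \<Rightarrow> real) \<Rightarrow> (real \<Rightarrow> real) \<Rightarrow> bool" where
  "entropy_flux \<eta> f q \<longleftrightarrow>
     (\<forall>r. \<exists>L. L-lipschitz_on {-r..r} q) \<and>
     (\<forall>s. f differentiable (at s) \<longrightarrow>
        (q has_real_derivative deriv \<eta> s * deriv f s) (at s))"

(* The entropies are the convex functions for which \<eta>' is defined everywhere.  By
   approximation the inequality then holds for every convex \<eta> and every selection of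
   subgradients in place of \<eta>'. *)
definition entropy_solution ::
    "nat \<Rightarrow> (nat \<Rightarrow> real \<Rightarrow> real) \<Rightarrow> (nat \<Rightarrow> real \<Rightarrow> real) \<Rightarrow> (nat \<Rightarrow> real \<Rightarrow> real \<Rightarrow> real) \<Rightarrow> bool"
  where
  "entropy_solution N v u0 u \<longleftrightarrow>
     weak_solution N v u0 u \<and>
     (\<forall>i\<in>{1..N}. \<forall>\<eta> q \<phi>.
        convex_on UNIV \<eta> \<longrightarrow> \<eta> differentiable_on UNIV \<longrightarrow> entropy_flux \<eta> (flux v i) q \<longrightarrow>
        test_function \<phi> \<longrightarrow> (\<forall>t\<ge>0. \<forall>x. \<phi> t x \<ge> 0) \<longrightarrow>
          (LINT t:{0..}|lborel. (LINT x|lborel.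
              \<eta> (u i t x) * dt \<phi> t x + q (u i t x) * dx \<phi> t x))
          + (LINT x|lborel. \<eta> (u0 i x) * \<phi> 0 x)
          \<ge> (LINT t:{0..}|lborel. (LINT x|lborel.
              deriv \<eta> (u i t x)
              * (lane_change N v i (u i t x) (u (i + 1) t x)
                 - lane_change N v (i - 1) (u (i - 1) t x) (u i t x)) * \<phi> t x)))"

(* Two standing conventions of the traffic model are hypotheses of the contraction theorem:
   initial densities are non-negative, and a velocity does not increase with the density.
   Together they make lane_change nondecreasing in a and nonincreasing in b.  Neither can be
   dropped.  Take N = 2 and v 2 = 0.
   - v 1 a = a: the system is u1_t + (u1^2)_x = u1 u2, u2_t = - u1 u2 for u1, u2 >= 0.  For
     h, g >= 0 with overlapping supports, the solution with data (h, g) moves away from the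
     stationary solution (0, g): their L^1 distance has initial derivative 2 * integral of h g.
   - v 1 a = - a: the same happens with data (h, g) and (0, g) for h, g <= 0. *)

end

(* Doubling of variables. Since S_i(a,b) is nondecreasing in a and nonincreasing in b for a, b >= 0,
   the lane changes contribute a term of one sign to the sum over the lanes of the inequalities for
   (u_i(t,x) - ubar_i(s,y))^+, already at distinct points (t,x) and (s,y). Hence the sources can be
   dropped before the two points are merged, which matters because sgn(u - ubar) S is not continuous.
   The test functions kappa(t-r) kappa(s-r) omega(x-y), with even mollifiers and no cutoff in space,
   make the flux terms cancel exactly, so what remains is that the mollified L^1 excess is
   nonincreasing in r. The one-sided entropies (u-k)^+ and (k-u)^+ serve twice: comparing with the
   solution 0, where no monotonicity of the velocities is needed, gives u >= 0, and after that
   comparing u with ubar in both orders gives the contraction. *)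
theory Submission
  imports Defs
begin

section \<open>Smooth bump functions and mollifiers\<close>

text \<open>The flux is only Lipschitz, so the matching entropy flux has no closed form, but it
  stays within a multiple of d of \<open>eta'(u) (f u - f k)\<close>. In the limit the jump point
  receives the value 1/2 for both one-sided entropies. Hence the inequality in (t,x) and the one in
  (s,y) carry one common factor \<open>heaviside (u - ubar)\<close>; this is what makes the fluxes
  cancel and lets the sources be summed over the lanes. Working without a cutoff requires majorants
  that are integrable over the whole plane. Fluxes and sources are therefore bounded by multiples of
  the sum of all |u_j|, and the solutions are truncated to a strip [0,T] and to a bounded range. The
  truncation also turns a sign known a.e. into a sign at every point, which the exchange inequality
  between two arbitrary points demands. Test functions supported in (0,T) do not see the initial
  data. The trace at time 0 is identified separately, and L1 continuity lets the starting time of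
  the comparison tend to 0.\<close>

definition bump_function :: "(real \<Rightarrow> real) \<Rightarrow> bool" where
  "bump_function f \<longleftrightarrow>
     (\<exists>D :: nat \<Rightarrow> real \<Rightarrow> real. D 0 = f \<and> (\<forall>n x. (D n has_real_derivative D (Suc n) x) (at x))) \<and>
     (\<exists>R. \<forall>x. f x \<noteq> 0 \<longrightarrow> \<bar>x\<bar> \<le> R)"

text \<open>The functions \<open>flat p\<close> are closed under differentiation and contain
  \<open>exp (- 1 / x)\<close> extended by 0.\<close>

definition flat :: "real poly \<Rightarrow> real \<Rightarrow> real" where
  "flat p x = (if x > 0 then poly p (1 / x) * exp (- (1 / x)) else 0)"

lemma poly_exp_tendsto_0:
  fixes p :: "real poly"
  shows "((\<lambda>z. poly p z * exp (- z)) \<longlongrightarrow> 0) at_top"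
proof -
  have "((\<lambda>z::real. \<Sum>i\<le>degree p. coeff p i * (z ^ i / exp z)) \<longlongrightarrow> 0) at_top"
    by (intro tendsto_null_sum tendsto_mult_right_zero tendsto_power_div_exp_0)
  then show ?thesis
    by (rule tendsto_cong[THEN iffD1, rotated])
       (auto simp: poly_altdef exp_minus field_simps sum_distrib_left intro!: always_eventually)
qed

text \<open>Differentiating p(1/x) exp(-1/x) brings out 1/x^2, the factor
  \<open>[:0, 0, 1:]\<close>, times p - p'. At 0 the right difference quotient is z p(z) exp(-z)
  with z = 1/y tending to infinity.\<close>

lemma flat_has_derivative:
  "(flat p has_real_derivative flat ([:0, 0, 1:] * (p - pderiv p)) x) (at x)"
proof -
  consider "x > 0" | "x < 0" | "x = 0" by linarith
  then show ?thesis
  proof cases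
    case 1
    have "((\<lambda>x. poly p (1 / x) * exp (- (1 / x))) has_real_derivative
            flat ([:0, 0, 1:] * (p - pderiv p)) x) (at x)"
      using 1 unfolding flat_def
      by (auto intro!: derivative_eq_intros poly_DERIV[THEN DERIV_chain2]
            simp: field_simps power2_eq_square)
    then show ?thesis
      by (rule DERIV_cong_ev[THEN iffD1, rotated 3])
         (use 1 in \<open>auto simp: flat_def intro!: eventually_mono[OF eventually_gt_at_top]
            eventually_mono[OF eventually_nhds_in_open[of "{0<..}"]]\<close>)
  next
    case 2
    have "((\<lambda>x. 0) has_real_derivative flat ([:0, 0, 1:] * (p - pderiv p)) x) (at x)"
      using 2 by (auto simp: flat_def)
    then show ?thesis
      by (rule DERIV_cong_ev[THEN iffD1, rotated 3])
         (use 2 in \<open>auto simp: flat_def intro!: eventually_mono[OF eventually_nhds_in_open[of "{..<0}"]]\<close>)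
  next
    case 3
    have "((\<lambda>y. poly (pCons 0 p) (inverse y) * exp (- inverse y)) \<longlongrightarrow> 0) (at_right 0)"
      by (rule filterlim_compose[OF poly_exp_tendsto_0 filterlim_inverse_at_top_right])
    then have R: "((\<lambda>y. flat p y / y) \<longlongrightarrow> 0) (at_right 0)"
      by (rule tendsto_cong[THEN iffD1, rotated])
         (auto simp: flat_def field_simps eventually_at_right_less intro!: eventually_mono[OF eventually_at_right_less[of 0]])
    have L: "((\<lambda>y. flat p y / y) \<longlongrightarrow> 0) (at_left 0)"
      by (rule tendsto_cong[THEN iffD1, rotated, OF tendsto_const])
         (auto simp: flat_def intro!: eventually_at_leftI[of "-1"])
    from L R have "((\<lambda>y. flat p y / y) \<longlongrightarrow> 0) (at 0)"
      by (simp add: filterlim_at_split)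
    then show ?thesis using 3
      by (simp add: has_field_derivative_iff flat_def)
  qed
qed

lemma Leibniz_derivatives:
  fixes D E :: "nat \<Rightarrow> real \<Rightarrow> real"
  assumes D: "\<And>n x. (D n has_real_derivative D (Suc n) x) (at x)"
    and E: "\<And>n x. (E n has_real_derivative E (Suc n) x) (at x)"
  shows "((\<lambda>x. \<Sum>k\<le>n. real (n choose k) * (D k x * E (n - k) x)) has_real_derivative
          (\<Sum>k\<le>Suc n. real (Suc n choose k) * (D k x * E (Suc n - k) x))) (at x)"
proof -
  have "((\<lambda>x. \<Sum>k\<le>n. real (n choose k) * (D k x * E (n - k) x)) has_real_derivative
          (\<Sum>k\<le>n. real (n choose k) * (D (Suc k) x * E (n - k) x + D k x * E (Suc (n - k)) x))) (at x)"
    by (auto intro!: derivative_eq_intros D E simp: algebra_simps)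
  also have "(\<Sum>k\<le>n. real (n choose k) * (D (Suc k) x * E (n - k) x + D k x * E (Suc (n - k)) x))
     = (\<Sum>k\<le>n. real (n choose k) * (D (Suc k) x * E (n - k) x))
       + (\<Sum>k\<le>n. real (n choose k) * (D k x * E (Suc n - k) x))"
    by (simp add: sum.distrib distrib_left Suc_diff_le)
  also have "\<dots> = (\<Sum>k\<le>Suc n. real (Suc n choose k) * (D k x * E (Suc n - k) x))"
  proof -
    \<comment> \<open>The added top term has the coefficient \<open>n choose Suc n\<close> = 0;
      after the index shift Pascal's rule merges the two sums.\<close>
    have "(\<Sum>k\<le>n. real (n choose k) * (D k x * E (Suc n - k) x))
        = (\<Sum>k\<le>Suc n. real (n choose k) * (D k x * E (Suc n - k) x))" by simp
    also have "\<dots> = D 0 x * E (Suc n) x + (\<Sum>k\<le>n. real (n choose Suc k) * (D (Suc k) x * E (n - k) x))"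
      by (subst sum.atMost_Suc_shift) simp
    finally have e: "(\<Sum>k\<le>n. real (n choose k) * (D k x * E (Suc n - k) x))
        = D 0 x * E (Suc n) x + (\<Sum>k\<le>n. real (n choose Suc k) * (D (Suc k) x * E (n - k) x))" .
    show ?thesis
      unfolding e sum.atMost_Suc_shift by (simp add: sum.distrib distrib_right)
  qed
  finally show ?thesis .
qed

text \<open>One factor vanishes for x <= -1, the other for x >= 1, and Leibniz' rule writes all
  derivatives of the product explicitly.\<close>

lemma bump_function_mult_flat: "bump_function (\<lambda>x. flat 1 (1 + x) * flat 1 (1 - x))"
proof -
  \<comment> \<open>Polynomials of the successive derivatives of \<open>flat 1\<close>, by iterating
    \<open>flat_has_derivative\<close>.\<close>
  define p where "p = rec_nat 1 (\<lambda>_ p. [:0, 0, 1:] * (p - pderiv p :: real poly))"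
  have p0: "p 0 = 1" and pS: "\<And>n. p (Suc n) = [:0, 0, 1:] * (p n - pderiv (p n))"
    by (simp_all add: p_def)
  have flat: "(flat (p n) has_real_derivative flat (p (Suc n)) x) (at x)" for n x
    unfolding pS by (rule flat_has_derivative)
  define D where "D n x = flat (p n) (1 + x)" for n x
  define E where "E n x = (- 1) ^ n * flat (p n) (1 - x)" for n x
  have D: "(D n has_real_derivative D (Suc n) x) (at x)" for n x
  proof -
    have "((\<lambda>x. flat (p n) (1 + x)) has_real_derivative flat (p (Suc n)) (1 + x) * 1) (at x)"
      by (rule DERIV_chain2[OF flat]) (auto intro!: derivative_eq_intros)
    then show ?thesis by (simp add: D_def[abs_def])
  qed
  have E: "(E n has_real_derivative E (Suc n) x) (at x)" for n x
  proof -
    have "((\<lambda>x. flat (p n) (1 - x)) has_real_derivative flat (p (Suc n)) (1 - x) * (- 1)) (at x)"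
      by (rule DERIV_chain2[OF flat]) (auto intro!: derivative_eq_intros)
    from DERIV_cmult[OF this, of "(- 1) ^ n"] show ?thesis by (simp add: E_def[abs_def])
  qed
  have "\<bar>x\<bar> \<le> 1" if "flat 1 (1 + x) * flat 1 (1 - x) \<noteq> 0" for x
    using that by (auto simp: flat_def split: if_splits)
  then show ?thesis
    unfolding bump_function_def
    by (intro conjI exI[of _ "\<lambda>n x. \<Sum>k\<le>n. real (n choose k) * (D k x * E (n - k) x)"]
          allI Leibniz_derivatives D E exI[of _ 1])
       (auto simp: D_def E_def p0)
qed

lemma bump_function_affine:
  assumes "bump_function f" and "c \<noteq> 0"
  shows "bump_function (\<lambda>x. a * f (c * x + d))"
proof -
  obtain D R where D: "D 0 = f" "\<And>n x. (D n has_real_derivative D (Suc n) x) (at x)"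
    and R: "\<And>x. f x \<noteq> 0 \<Longrightarrow> \<bar>x\<bar> \<le> R"
    using assms(1) unfolding bump_function_def by metis
  define E where "E n x = a * c ^ n * D n (c * x + d)" for n x
  have E: "(E n has_real_derivative E (Suc n) x) (at x)" for n x
  proof -
    have "((\<lambda>x. D n (c * x + d)) has_real_derivative D (Suc n) (c * x + d) * c) (at x)"
      by (rule DERIV_chain2[OF D(2)]) (auto intro!: derivative_eq_intros)
    from DERIV_cmult[OF this, of "a * c ^ n"] show ?thesis by (simp add: E_def[abs_def] mult_ac)
  qed
  have "\<bar>x\<bar> \<le> (R + \<bar>d\<bar>) / \<bar>c\<bar>" if "a * f (c * x + d) \<noteq> 0" for x
  proof -
    have "\<bar>c * x + d\<bar> \<le> R" using that by (intro R) auto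
    then have "\<bar>c * x\<bar> \<le> R + \<bar>d\<bar>" by linarith
    then show ?thesis using assms(2) by (simp add: abs_mult field_simps)
  qed
  then show ?thesis
    unfolding bump_function_def
    by (intro conjI exI[of _ E] exI[of _ "(R + \<bar>d\<bar>) / \<bar>c\<bar>"] allI E) (auto simp: E_def D(1))
qed

lemma bump_function_deriv:
  assumes "bump_function f"
  shows "(f has_real_derivative deriv f x) (at x)" and "isCont (deriv f) x"
    and "isCont f x" and "\<exists>R. \<forall>x. \<bar>x\<bar> > R \<longrightarrow> f x = 0 \<and> deriv f x = 0" (is ?A)
proof -
  obtain D R where D: "D 0 = f" "\<And>n x. (D n has_real_derivative D (Suc n) x) (at x)"
    and R: "\<And>x. f x \<noteq> 0 \<Longrightarrow> \<bar>x\<bar> \<le> R"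
    using assms unfolding bump_function_def by metis
  have d: "(f has_real_derivative D 1 x) (at x)" for x using D(2)[of 0] by (simp add: D(1))
  then have e: "deriv f = D 1" by (auto intro: DERIV_imp_deriv)
  show "(f has_real_derivative deriv f x) (at x)" using d e by simp
  show "isCont (deriv f) x" unfolding e using D(2)[of 1] by (rule DERIV_isCont)
  show "isCont f x" using d by (rule DERIV_isCont)
  have "D 1 x = 0" if "\<bar>x\<bar> > R" for x
  proof -
    have "eventually (\<lambda>y. f y = 0) (nhds x)"
    proof -
      have "open {y. \<bar>y\<bar> > R}" by (intro open_Collect_less continuous_intros)
      then have "eventually (\<lambda>y. y \<in> {y. \<bar>y\<bar> > R}) (nhds x)"
        using that by (intro eventually_nhds_in_open) auto
      then show ?thesis by (rule eventually_mono) (metis R mem_Collect_eq not_le)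
    qed
    then have "((\<lambda>y. 0) has_real_derivative D 1 x) (at x)"
      using DERIV_cong_ev[THEN iffD1, OF refl _ refl d[of x]] by simp
    from DERIV_unique[OF DERIV_const this] show ?thesis by simp
  qed
  then show ?A
    using R e by (intro exI[of _ R]) force
qed

lemma bump_function_bounded:
  assumes "bump_function f"
  shows "\<exists>B. \<forall>x. \<bar>f x\<bar> \<le> B \<and> \<bar>deriv f x\<bar> \<le> B"
proof -
  obtain R where R: "\<And>x. \<bar>x\<bar> > R \<Longrightarrow> f x = 0 \<and> deriv f x = 0"
    using bump_function_deriv(4)[OF assms] by blast
  have "continuous_on {-R..R} (\<lambda>x. \<bar>f x\<bar> + \<bar>deriv f x\<bar>)"
    using bump_function_deriv(2,3)[OF assms]
    by (intro continuous_intros continuous_at_imp_continuous_on) auto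
  then have "bounded ((\<lambda>x. \<bar>f x\<bar> + \<bar>deriv f x\<bar>) ` {-R..R})"
    by (intro compact_imp_bounded compact_continuous_image) auto
  then obtain B where "\<forall>z\<in>(\<lambda>x. \<bar>f x\<bar> + \<bar>deriv f x\<bar>) ` {-R..R}. norm z \<le> B"
    unfolding bounded_iff by blast
  then have B: "\<bar>\<bar>f x\<bar> + \<bar>deriv f x\<bar>\<bar> \<le> B" if "x \<in> {-R..R}" for x
    using that by fastforce
  have "\<bar>f x\<bar> \<le> max B 0 \<and> \<bar>deriv f x\<bar> \<le> max B 0" for x
  proof (cases "\<bar>x\<bar> > R")
    case True then show ?thesis using R by auto
  next
    case False
    then have "\<bar>\<bar>f x\<bar> + \<bar>deriv f x\<bar>\<bar> \<le> B" by (intro B) auto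
    then show ?thesis by linarith
  qed
  then show ?thesis by blast
qed

lemma bump_function_borel:
  assumes "bump_function f"
  shows "f \<in> borel_measurable borel" and "deriv f \<in> borel_measurable borel"
  using bump_function_deriv(2,3)[OF assms]
  by (auto intro!: borel_measurable_continuous_onI continuous_at_imp_continuous_on)

lemma bump_function_integrable:
  assumes "bump_function f"
  shows "integrable lborel f" and "integrable lborel (deriv f)"
proof -
  obtain R where R: "\<And>x. \<bar>x\<bar> > R \<Longrightarrow> f x = 0 \<and> deriv f x = 0"
    using bump_function_deriv(4)[OF assms] by blast
  have "integrable lborel (\<lambda>x. f x * indicator {-R..R} x)"
       "integrable lborel (\<lambda>x. deriv f x * indicator {-R..R} x)"
    using bump_function_deriv(2,3)[OF assms]
    by (auto intro!: borel_integrable_atLeastAtMost simp: mult.commute)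
  moreover have "(\<lambda>x. f x * indicator {-R..R} x) = f" "(\<lambda>x. deriv f x * indicator {-R..R} x) = deriv f"
    using R by (force simp: indicator_def abs_le_iff not_le)+
  ultimately show "integrable lborel f" "integrable lborel (deriv f)" by simp_all
qed

text \<open>The half-line integral keeps the boundary value at 0. It yields the initial term when a
  time mollifier is centred at 0.\<close>

lemma bump_function_integral_deriv:
  assumes "bump_function f"
  shows "(LBINT x. deriv f x) = 0"
    and "(LBINT x. indicator {0..} x * deriv f x) = - f 0" (is ?A)
proof -
  obtain R where R: "\<And>x. \<bar>x\<bar> > R \<Longrightarrow> f x = 0 \<and> deriv f x = 0"
    using bump_function_deriv(4)[OF assms] by blast
  \<comment> \<open>Strictly beyond the support, and positive, so that both integrals reduce to
    compact intervals with vanishing outer endpoints.\<close>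
  define S where "S = \<bar>R\<bar> + 1"
  have S: "f S = 0" "f (- S) = 0" "\<And>x. \<bar>x\<bar> \<ge> S \<Longrightarrow> deriv f x = 0" "S > 0" using R by (auto simp: S_def)
  have *: "(LBINT x. deriv f x * indicator {a..S} x) = f S - f a" if "a \<le> S" for a
    using that bump_function_deriv[OF assms] by (intro integral_FTC_Icc_real) auto
  have z: "deriv f x = 0" if "x < - S \<or> x > S" for x using that S(3)[of x] by linarith
  have e: "(\<lambda>x. deriv f x) = (\<lambda>x. deriv f x * indicator {-S..S} x)"
    "(\<lambda>x. indicator {0..} x * deriv f x) = (\<lambda>x. deriv f x * indicator {0..S} x)"
    using z S(4) by (auto simp: indicator_def fun_eq_iff) (meson not_le)+
  have "(LBINT x. deriv f x) = (LBINT x. deriv f x * indicator {-S..S} x)"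
    using e(1) by metis
  then show "(LBINT x. deriv f x) = 0" using *[of "- S"] S by simp
  show ?A
    unfolding e(2) using *[of 0] S by simp
qed

lemma test_function_tensor:
  assumes "bump_function a" and "bump_function b"
  shows "test_function (\<lambda>t x. a t * b x)"
    and "dt (\<lambda>t x. a t * b x) t x = deriv a t * b x" (is ?A)
    and "dx (\<lambda>t x. a t * b x) t x = a t * deriv b x" (is ?B)
proof -
  obtain A Ra where A: "A 0 = a" "\<And>n x. (A n has_real_derivative A (Suc n) x) (at x)"
    and Ra: "\<And>x. a x \<noteq> 0 \<Longrightarrow> \<bar>x\<bar> \<le> Ra"
    using assms(1) unfolding bump_function_def by metis
  obtain B Rb where B: "B 0 = b" "\<And>n x. (B n has_real_derivative B (Suc n) x) (at x)"
    and Rb: "\<And>x. b x \<noteq> 0 \<Longrightarrow> \<bar>x\<bar> \<le> Rb"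
    using assms(2) unfolding bump_function_def by metis
  have cA: "continuous_on UNIV (A n)" for n
    using A(2) by (meson DERIV_isCont continuous_at_imp_continuous_on)
  have cB: "continuous_on UNIV (B n)" for n
    using B(2) by (meson DERIV_isCont continuous_at_imp_continuous_on)
  have "continuous_on UNIV (\<lambda>(t, x). A j t * B k x)" for j k
    unfolding case_prod_beta
    by (intro continuous_intros continuous_on_compose2[OF cA] continuous_on_compose2[OF cB]) auto
  then have "smooth (\<lambda>t x. a t * b x)"
    unfolding smooth_def
    by (intro exI[of _ "\<lambda>j k t x. A j t * B k x"])
       (auto simp: A(1) B(1) intro!: derivative_eq_intros A(2) B(2))
  moreover have "\<bar>t\<bar> \<le> max Ra Rb \<and> \<bar>x\<bar> \<le> max Ra Rb" if "a t * b x \<noteq> 0" for t x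
    using that Ra[of t] Rb[of x] by auto
  ultimately show "test_function (\<lambda>t x. a t * b x)"
    unfolding test_function_def by blast
  show ?A
    by (rule DERIV_imp_deriv) (auto intro!: derivative_eq_intros bump_function_deriv(1) assms)
  show ?B
    by (rule DERIV_imp_deriv) (auto intro!: derivative_eq_intros bump_function_deriv(1) assms)
qed

definition std_bump :: "real \<Rightarrow> real" where
  "std_bump x = flat 1 (1 + x) * flat 1 (1 - x)"

definition mollifier :: "real \<Rightarrow> real \<Rightarrow> real" where
  "mollifier h x = std_bump (x / h) / (h * (LBINT y. std_bump y))"

lemma std_bump: "bump_function std_bump" "std_bump x \<ge> 0" "std_bump (- x) = std_bump x"
  "\<bar>x\<bar> \<ge> 1 \<Longrightarrow> std_bump x = 0" "std_bump 0 > 0"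
  using bump_function_mult_flat by (auto simp: std_bump_def[abs_def] flat_def)

text \<open>A continuous nonnegative function that is positive at 0 is positive on an interval
  around 0, which has positive measure.\<close>

lemma std_bump_integral_pos: "(LBINT y. std_bump y) > 0"
proof -
  have "isCont std_bump 0" by (rule bump_function_deriv(3)[OF std_bump(1)])
  then have "(LBINT y. std_bump y) \<noteq> 0"
  proof -
    have "\<not> (AE x in lborel. std_bump x = 0)"
    proof
      assume "AE x in lborel. std_bump x = 0"
      have "continuous_on UNIV std_bump"
        using bump_function_deriv(3)[OF std_bump(1)] by (intro continuous_at_imp_continuous_on) auto
      then have "open {x. std_bump x > 0}" by (intro open_Collect_less continuous_intros) auto
      then obtain e where e: "e > 0" "ball 0 e \<subseteq> {x. std_bump x > 0}"
        using std_bump(5) by (metis (mono_tags) mem_Collect_eq open_contains_ball)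
      have "AE x in lborel. x \<notin> ball (0::real) e"
        using \<open>AE x in lborel. std_bump x = 0\<close>
        by eventually_elim (use e(2) in auto)
      moreover have be: "ball (0::real) e = {-e<..<e}" by (auto simp: dist_real_def)
      ultimately have "{-e<..<e} \<in> null_sets lborel" by (simp add: AE_iff_null_sets)
      then have "emeasure lborel {-e<..<e} = 0" by (rule null_setsD1)
      then show False using e(1) by simp
    qed
    then show ?thesis
      using integral_nonneg_eq_0_iff_AE[OF bump_function_integrable(1)[OF std_bump(1)]] std_bump(2) by auto
  qed
  moreover have "(LBINT y. std_bump y) \<ge> 0" using std_bump(2) by (intro Bochner_Integration.integral_nonneg)
  ultimately show ?thesis by simp
qed

lemma mollifier_bump_function:
  assumes "h > 0" "c \<noteq> 0"
  shows "bump_function (\<lambda>x. mollifier h (c * x + d))"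
proof -
  have "(\<lambda>x. mollifier h (c * x + d))
      = (\<lambda>x. (1 / (h * (LBINT y. std_bump y))) * std_bump ((c / h) * x + d / h))"
    by (auto simp: mollifier_def add_divide_distrib)
  then show ?thesis using assms by (simp only:) (rule bump_function_affine[OF std_bump(1)], simp)
qed

lemma mollifier:
  assumes "h > 0"
  shows "mollifier h x \<ge> 0" "mollifier h (- x) = mollifier h x" "\<bar>x\<bar> \<ge> h \<Longrightarrow> mollifier h x = 0"
    "bump_function (mollifier h)" "(LBINT x. mollifier h x) = 1" "mollifier h 0 = mollifier 1 0 / h"
    "mollifier h 0 > 0"
proof -
  show "mollifier h x \<ge> 0" "mollifier h (- x) = mollifier h x" "mollifier h 0 > 0"
    using assms std_bump std_bump_integral_pos by (auto simp: mollifier_def)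
  show "\<bar>x\<bar> \<ge> h \<Longrightarrow> mollifier h x = 0"
    using assms std_bump(4)[of "x / h"] by (auto simp: mollifier_def)
  show "bump_function (mollifier h)" using mollifier_bump_function[of h 1 0] assms by simp
  have "(LBINT x. std_bump (x / h)) = h * (LBINT y. std_bump y)"
    using lborel_integral_real_affine[of h "\<lambda>x. std_bump (x / h)" 0] assms by simp
  then show "(LBINT x. mollifier h x) = 1"
    unfolding mollifier_def using assms std_bump_integral_pos by simp
  show "mollifier h 0 = mollifier 1 0 / h" by (simp add: mollifier_def)
qed

text \<open>All by uniqueness of derivatives. Oddness makes the fluxes cancel in the doubling; the
  scaling with h^-2 gives the derivative an L1 norm of order 1 / h, which enters the estimate at
  time 0.\<close>

lemma mollifier_deriv:
  assumes "h > 0"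
  shows "deriv (mollifier h) (- x) = - deriv (mollifier h) x" (is ?A)
    and "deriv (mollifier h) x = deriv (mollifier 1) (x / h) / h ^ 2" (is ?B)
    and "\<bar>x\<bar> > h \<Longrightarrow> deriv (mollifier h) x = 0"
    and "((\<lambda>x. mollifier h (x - r)) has_real_derivative deriv (mollifier h) (x - r)) (at x)" (is ?C)
proof -
  have d: "(mollifier h has_real_derivative deriv (mollifier h) x) (at x)" if "h > 0" for h x
    using that by (intro bump_function_deriv(1) mollifier)
  have "((\<lambda>x. mollifier h (- x)) has_real_derivative deriv (mollifier h) (- x) * (- 1)) (at x)"
    by (rule DERIV_chain2[OF d[OF assms]]) (auto intro!: derivative_eq_intros)
  then have "((\<lambda>x. mollifier h (- x)) has_real_derivative - deriv (mollifier h) (- x)) (at x)"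
    by simp
  then have "(mollifier h has_real_derivative - deriv (mollifier h) (- x)) (at x)"
    by (simp add: mollifier(2)[OF assms])
  then have "- deriv (mollifier h) (- x) = deriv (mollifier h) x"
    by (rule DERIV_unique) (rule d[OF assms])
  then show ?A by simp
  have "((\<lambda>x. mollifier 1 (x / h)) has_real_derivative deriv (mollifier 1) (x / h) * (1 / h)) (at x)"
    by (rule DERIV_chain2[OF d]) (use assms in \<open>auto intro!: derivative_eq_intros\<close>)
  from DERIV_cdivide[OF this, of h]
  have "((\<lambda>x. mollifier 1 (x / h) / h) has_real_derivative deriv (mollifier 1) (x / h) / h ^ 2) (at x)"
    by (simp add: power2_eq_square)
  moreover have "(\<lambda>x. mollifier 1 (x / h) / h) = mollifier h" by (auto simp: mollifier_def)
  ultimately show ?B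
    by (metis DERIV_unique d[OF assms])
  show ?C
    using DERIV_chain2[OF d[OF assms] DERIV_diff[OF DERIV_ident DERIV_const]] by simp
  assume x: "\<bar>x\<bar> > h"
  have "open {y. \<bar>y\<bar> > h}" by (intro open_Collect_less continuous_intros)
  then have "eventually (\<lambda>y. mollifier h y = 0) (nhds x)"
    using eventually_nhds_in_open[of "{y. \<bar>y\<bar> > h}" x] x mollifier(3)[OF assms]
    by (auto elim!: eventually_mono)
  then have "((\<lambda>y. 0) has_real_derivative deriv (mollifier h) x) (at x)"
    using DERIV_cong_ev[THEN iffD1, OF refl _ refl d[OF assms, of x]] by simp
  from DERIV_unique[OF DERIV_const this] show "deriv (mollifier h) x = 0" by simp
qed

section \<open>Continuity of translations in \<open>L\<^sup>1\<close>\<close>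

abbreviation (input) "L1_dist g k \<equiv> LBINT x. \<bar>g x - k x :: real\<bar>"
abbreviation (input) "slice_dist f s t \<equiv> LBINT x. \<bar>f (s, x) - f (t, x) :: real\<bar>"
abbreviation (input) "shift_dist f z \<equiv> LBINT x. \<bar>f (x + z) - f x :: real\<bar>"
abbreviation (input) "L1_excess g k \<equiv> LBINT x. max 0 (g x - k x :: real)"
abbreviation (input) "slice_excess f g t \<equiv> LBINT x. max 0 (f (t, x) - g (t, x) :: real)"

lemmas integrable_arith = Bochner_Integration.integrable_add Bochner_Integration.integrable_diff

text \<open>Sequential, so that dominated convergence applies directly;
  \<open>L1_translation_continuousD\<close> returns to epsilon and delta.\<close>

definition L1_translation_continuous :: "(real \<Rightarrow> real) \<Rightarrow> bool" where
  "L1_translation_continuous f \<longleftrightarrow>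
     (\<forall>z. z \<longlonglongrightarrow> 0 \<longrightarrow> (\<lambda>n. shift_dist f (z n)) \<longlonglongrightarrow> 0)"

lemma integrable_translate:
  fixes f :: "real \<Rightarrow> real"
  assumes "integrable lborel f"
  shows "integrable lborel (\<lambda>x. f (x + z))" "(LBINT x. f (x + z)) = (LBINT x. f x)"
  using lborel_integrable_real_affine[OF assms, of 1 z] lborel_integral_real_affine[of 1 f z]
  by (simp_all add: add.commute)

text \<open>Three-term estimate: by translation invariance of Lebesgue measure the shifted
  approximation error has the same integral as the unshifted one.\<close>

lemma L1_translation_continuous_approx:
  fixes f :: "real \<Rightarrow> real"
  assumes f: "integrable lborel f"
    and approx: "\<And>e. e > 0 \<Longrightarrow> \<exists>g. integrable lborel g \<and> L1_translation_continuous g \<and>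
                         (L1_dist f g) \<le> e"
  shows "L1_translation_continuous f"
  unfolding L1_translation_continuous_def
proof (intro allI impI LIMSEQ_I)
  fix z :: "nat \<Rightarrow> real" and e :: real
  assume z: "z \<longlonglongrightarrow> 0" and e: "e > 0"
  obtain g where g: "integrable lborel g" "L1_translation_continuous g" "L1_dist f g \<le> e / 4"
    using approx[of "e / 4"] e by auto
  have "(\<lambda>n. shift_dist g (z n)) \<longlonglongrightarrow> 0"
    using g(2) z by (simp add: L1_translation_continuous_def)
  then obtain n0 where n0: "\<And>n. n \<ge> n0 \<Longrightarrow> \<bar>shift_dist g (z n)\<bar> < e / 2"
    using LIMSEQ_D[of _ 0 "e / 2"] e by force
  have "\<bar>shift_dist f (z n)\<bar> < e" if n: "n \<ge> n0" for n
  proof -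
    note int = f g(1) integrable_translate(1)[OF f] integrable_translate(1)[OF g(1)]
    have "(shift_dist f (z n))
        \<le> (LBINT x. \<bar>f (x + z n) - g (x + z n)\<bar> + \<bar>g (x + z n) - g x\<bar> + \<bar>f x - g x\<bar>)"
      by (intro integral_mono Bochner_Integration.integrable_add integrable_abs
            Bochner_Integration.integrable_diff int) auto
    also have "\<dots> = (LBINT x. \<bar>f (x + z n) - g (x + z n)\<bar>)
        + (shift_dist g (z n)) + (L1_dist f g)"
      by (simp add: int)
    also have "(LBINT x. \<bar>f (x + z n) - g (x + z n)\<bar>) = (L1_dist f g)"
      by (rule integrable_translate(2)) (simp add: int)
    finally have "shift_dist f (z n) < e"
      using n0[OF n] g(3) by linarith
    moreover have "(shift_dist f (z n)) \<ge> 0" by simp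
    ultimately show ?thesis by simp
  qed
  then show "\<exists>n0. \<forall>n\<ge>n0. norm ((shift_dist f (z n)) - 0) < e"
    by (intro exI[of _ n0]) simp
qed

text \<open>Let s be the difference of the shifted and the original indicator. Then |s| = 2 max(0,
  -s) + s, and s integrates to 0. The part max(0, -s) is dominated by the indicator of U, and
  openness makes it vanish eventually at each point of U.\<close>

lemma L1_translation_continuous_open:
  assumes "open (U :: real set)" and fin: "emeasure lborel U < \<infinity>"
  shows "L1_translation_continuous (\<lambda>x. indicator U x * c)"
  unfolding L1_translation_continuous_def
proof (intro allI impI)
  fix z :: "nat \<Rightarrow> real"
  assume z: "z \<longlonglongrightarrow> 0"
  have U: "U \<in> sets lborel" using assms(1) by simp
  have iU: "integrable lborel (indicator U :: real \<Rightarrow> real)"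
    using U fin by (intro integrable_real_indicator) auto
  define d where "d n x = max 0 (indicator U x - indicator U (x + z n) :: real)" for n x
  have dlim: "(\<lambda>n. LBINT x. d n x) \<longlonglongrightarrow> (LBINT x::real. 0::real)"
  proof (rule integral_dominated_convergence[where w = "indicator U"])
    show "integrable lborel (indicator U :: real \<Rightarrow> real)" by (rule iU)
    show "d n \<in> borel_measurable lborel" for n
      using borel_measurable_integrable[OF iU] borel_measurable_integrable[OF integrable_translate(1)[OF iU]]
      unfolding d_def by (intro borel_measurable_max borel_measurable_diff) auto
    show "AE x in lborel. norm (d n x) \<le> indicator U x" for n
      by (auto simp: d_def indicator_def)
    show "AE x in lborel. (\<lambda>n. d n x) \<longlonglongrightarrow> 0"
    proof (rule AE_I2)
      fix x
      show "(\<lambda>n. d n x) \<longlonglongrightarrow> 0"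
      proof (cases "x \<in> U")
        case True
        have "(\<lambda>n. x + z n) \<longlonglongrightarrow> x" using tendsto_add[OF tendsto_const z, of x] by simp
        then have "eventually (\<lambda>n. x + z n \<in> U) sequentially"
          using assms(1) True by (rule topological_tendstoD)
        then have "eventually (\<lambda>n. d n x = 0) sequentially"
          by eventually_elim (use True in \<open>auto simp: d_def\<close>)
        then show ?thesis by (rule tendsto_eventually)
      qed (auto simp: d_def indicator_def)
    qed
  qed simp
  have "(LBINT x. \<bar>indicator U (x + z n) * c - indicator U x * c\<bar>)
      = 2 * \<bar>c\<bar> * (LBINT x. d n x)" for n
  proof -
    note int = iU integrable_translate(1)[OF iU, of "z n"]
    have id: "integrable lborel (d n)" unfolding d_def by (intro integrable_max int Bochner_Integration.integrable_diff) auto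
    have "\<bar>indicator U (x + z n) * c - indicator U x * c\<bar>
        = 2 * \<bar>c\<bar> * d n x + \<bar>c\<bar> * (indicator U (x + z n) - indicator U x)" for x
      by (auto simp: d_def indicator_def)
    then have "(LBINT x. \<bar>indicator U (x + z n) * c - indicator U x * c\<bar>)
        = (LBINT x. 2 * \<bar>c\<bar> * d n x + \<bar>c\<bar> * (indicator U (x + z n) - indicator U x))" by simp
    also have "\<dots> = 2 * \<bar>c\<bar> * (LBINT x. d n x)
        + \<bar>c\<bar> * ((LBINT x. indicator U (x + z n)) - (LBINT x. indicator U x))"
      using id int by simp
    also have "(LBINT x. indicator U (x + z n)) = (LBINT x. indicator U x :: real)"
      by (rule integrable_translate(2)[OF iU])
    finally show ?thesis by simp
  qed
  then show "(\<lambda>n. LBINT x. \<bar>indicator U (x + z n) * c - indicator U x * c\<bar>) \<longlonglongrightarrow> 0"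
    using tendsto_mult[OF tendsto_const dlim, of "2 * \<bar>c\<bar>"] by simp
qed

text \<open>Induction over integrable functions: indicators are approximated by open supersets
  (outer regularity), sums are handled by the triangle inequality, limits by dominated
  convergence.\<close>

lemma integrable_imp_L1_translation_continuous:
  fixes f :: "real \<Rightarrow> real"
  assumes "integrable lborel f"
  shows "L1_translation_continuous f"
  using assms
proof induct
  case (base A c)
  note A = base[simplified]
  have iA: "integrable lborel (\<lambda>x. indicator A x * c :: real)"
    using A by (intro integrable_mult_left integrable_real_indicator) auto
  have "L1_translation_continuous (\<lambda>x. indicator A x * c)"
  proof (rule L1_translation_continuous_approx[OF iA])
    fix e :: real assume e: "e > 0"
    \<comment> \<open>The error is |c| times a measure; the added 1 covers c = 0.\<close>
    define e' where "e' = e / (\<bar>c\<bar> + 1)"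
    have e': "e' > 0" using e by (simp add: e'_def)
    obtain U where U: "open U" "A \<subseteq> U" "emeasure lborel (U - A) < e'"
      using outer_regular_lborel[OF A(1) e'] by blast
    have "emeasure lborel U = emeasure lborel (U - A) + emeasure lborel A"
      using U(1,2) A by (subst plus_emeasure) (auto simp: Un_absorb2)
    also have "\<dots> < \<infinity>" using U(3) A(2) by (simp add: less_top[symmetric]) (metis ennreal_less_top order.strict_trans less_irrefl top.not_eq_extremum)
    finally have fin: "emeasure lborel U < \<infinity>" .
    have iU: "integrable lborel (\<lambda>x. indicator U x * c :: real)"
      using fin U(1) by (intro integrable_mult_left integrable_real_indicator) auto
    have mm: "measure lborel (U - A) \<le> e'"
      using U(3) e' unfolding measure_def by (intro enn2real_leI) auto
    have "(LBINT x. \<bar>indicator A x * c - indicator U x * c\<bar>) = (LBINT x. indicator (U - A) x * \<bar>c\<bar>)"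
      using U(2) by (intro Bochner_Integration.integral_cong refl) (auto simp: indicator_def)
    also have "\<dots> = measure lborel (U - A) * \<bar>c\<bar>" by simp
    also have "\<dots> \<le> e' * (\<bar>c\<bar> + 1)" using mm e' by (intro mult_mono) auto
    also have "\<dots> = e" by (simp add: e'_def)
    finally show "\<exists>g. integrable lborel g \<and> L1_translation_continuous g \<and>
        (LBINT x. \<bar>indicator A x * c - g x\<bar>) \<le> e"
      using L1_translation_continuous_open[OF U(1) fin, of c] iU by blast
  qed
  then show ?case by (simp add: fun_eq_iff)
next
  case (add f g)
  show ?case
    unfolding L1_translation_continuous_def
  proof (intro allI impI)
    fix z :: "nat \<Rightarrow> real" assume z: "z \<longlonglongrightarrow> 0"
    note int = add(1,3) integrable_translate(1)[OF add(1)] integrable_translate(1)[OF add(3)]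
    have "(\<lambda>n. (shift_dist f (z n)) + (shift_dist g (z n))) \<longlonglongrightarrow> 0 + 0"
      using add(2,4) z by (intro tendsto_add) (auto simp: L1_translation_continuous_def)
    then have lim: "(\<lambda>n. (shift_dist f (z n)) + (shift_dist g (z n))) \<longlonglongrightarrow> 0"
      by simp
    show "(\<lambda>n. LBINT x. \<bar>f (x + z n) + g (x + z n) - (f x + g x)\<bar>) \<longlonglongrightarrow> 0"
    proof (rule tendsto_sandwich[OF _ _ tendsto_const lim]; intro always_eventually allI)
      fix n
      show "0 \<le> (LBINT x. \<bar>f (x + z n) + g (x + z n) - (f x + g x)\<bar>)" by simp
      have "(LBINT x. \<bar>f (x + z n) + g (x + z n) - (f x + g x)\<bar>)
          \<le> (LBINT x. \<bar>f (x + z n) - f x\<bar> + \<bar>g (x + z n) - g x\<bar>)"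
        by (intro integral_mono Bochner_Integration.integrable_add integrable_abs
              Bochner_Integration.integrable_diff int) auto
      then show "(LBINT x. \<bar>f (x + z n) + g (x + z n) - (f x + g x)\<bar>)
          \<le> (shift_dist f (z n)) + (shift_dist g (z n))"
        by (simp add: int)
    qed
  qed
next
  case (lim f s)
  show ?case
  proof (rule L1_translation_continuous_approx[OF lim(5)])
    fix e :: real assume e: "e > 0"
    have "(\<lambda>i. L1_dist f (s i)) \<longlonglongrightarrow> (LBINT x::real. 0::real)"
    \<comment> \<open>The approximants satisfy |s i| <= 2 |f|, hence the factor 3.\<close>
    proof (rule integral_dominated_convergence[where w = "\<lambda>x. 3 * \<bar>f x\<bar>"])
      show "(\<lambda>x. \<bar>f x - s i x\<bar>) \<in> borel_measurable lborel" for i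
        using lim(1,5) by (intro borel_measurable_abs borel_measurable_diff) auto
      show "integrable lborel (\<lambda>x. 3 * \<bar>f x\<bar>)" using lim(5) by auto
      show "AE x in lborel. norm \<bar>f x - s i x\<bar> \<le> 3 * \<bar>f x\<bar>" for i
      proof (rule AE_I2)
        fix x show "norm \<bar>f x - s i x\<bar> \<le> 3 * \<bar>f x\<bar>" using lim(4)[of x i] by simp
      qed
      show "AE x in lborel. (\<lambda>i. \<bar>f x - s i x\<bar>) \<longlonglongrightarrow> 0"
      proof (rule AE_I2)
        fix x
        have "(\<lambda>i. \<bar>f x - s i x\<bar>) \<longlonglongrightarrow> \<bar>f x - f x\<bar>" using lim(3)[of x] by (intro tendsto_intros) auto
        then show "(\<lambda>i. \<bar>f x - s i x\<bar>) \<longlonglongrightarrow> 0" by simp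
      qed
    qed simp
    then obtain i where "\<bar>L1_dist f (s i)\<bar> < e"
      using LIMSEQ_D[of _ 0 e] e by force
    then show "\<exists>g. integrable lborel g \<and> L1_translation_continuous g \<and> (L1_dist f g) \<le> e"
      using lim(1,2) by (intro exI[of _ "s i"]) auto
  qed
qed

lemma L1_translation_continuousD:
  fixes f :: "real \<Rightarrow> real"
  assumes f: "integrable lborel f" and e: "e > 0"
  shows "\<exists>d>0. \<forall>z. \<bar>z\<bar> < d \<longrightarrow> shift_dist f z < e"
proof -
  have "((\<lambda>z. shift_dist f z) \<longlongrightarrow> 0) (at 0)"
    using integrable_imp_L1_translation_continuous[OF f]
    by (auto simp: tendsto_at_iff_sequentially L1_translation_continuous_def o_def)
  then obtain d where d: "d > 0" "\<And>z. z \<noteq> 0 \<Longrightarrow> \<bar>z\<bar> < d \<Longrightarrow> \<bar>shift_dist f z\<bar> < e"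
    using LIM_D[of _ 0 0 e] e by force
  have "shift_dist f z < e" if "\<bar>z\<bar> < d" for z
    using d(2)[of z] that e by (cases "z = 0") auto
  then show ?thesis using d(1) by blast
qed

section \<open>Regularised one-sided entropies\<close>

text \<open>For d > 0 a smooth convex substitute for the positive part, within d of it.
  \<open>soft_step\<close> and \<open>soft_peak\<close> are its first and second derivatives;
  \<open>soft_peak\<close> concentrates at 0 as d tends to 0.\<close>

definition soft_pos :: "real \<Rightarrow> real \<Rightarrow> real" where
  "soft_pos d z = (z + sqrt (z\<^sup>2 + d\<^sup>2)) / 2"

definition soft_step :: "real \<Rightarrow> real \<Rightarrow> real" where
  "soft_step d z = (1 + z / sqrt (z\<^sup>2 + d\<^sup>2)) / 2"

definition soft_peak :: "real \<Rightarrow> real \<Rightarrow> real" where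
  "soft_peak d z = d\<^sup>2 / (2 * sqrt (z\<^sup>2 + d\<^sup>2) ^ 3)"

text \<open>The value 1/2 at 0 is inherited from \<open>soft_step\<close>, which takes it at 0 for
  every d.\<close>

definition heaviside :: "real \<Rightarrow> real" where
  "heaviside z = (1 + sgn z) / 2"

lemma soft_root_pos: "d > 0 \<Longrightarrow> z\<^sup>2 + d\<^sup>2 > (0::real)"
  by (simp add: add_nonneg_pos)

lemma soft_root_le: "\<bar>z\<bar> \<le> sqrt (z\<^sup>2 + d\<^sup>2)"
  using real_sqrt_le_mono[of "z\<^sup>2" "z\<^sup>2 + d\<^sup>2"] by simp

lemma soft_pos_has_derivative:
  assumes "d > 0"
  shows "(soft_pos d has_real_derivative soft_step d z) (at z)"
  unfolding soft_pos_def[abs_def] soft_step_def using soft_root_pos[OF assms, of z]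
  by (auto intro!: derivative_eq_intros simp: field_simps)

lemma soft_step_has_derivative:
  assumes "d > 0"
  shows "(soft_step d has_real_derivative soft_peak d z) (at z)"
proof -
  define s where "s = sqrt (z\<^sup>2 + d\<^sup>2)"
  have s: "s > 0" "s\<^sup>2 = z\<^sup>2 + d\<^sup>2" using soft_root_pos[OF assms, of z] by (auto simp: s_def)
  have "((\<lambda>z. sqrt (z\<^sup>2 + d\<^sup>2)) has_real_derivative z / s) (at z)"
    unfolding s_def using soft_root_pos[OF assms, of z]
    by (auto intro!: derivative_eq_intros simp: field_simps)
  moreover have "sqrt (z\<^sup>2 + d\<^sup>2) \<noteq> 0" using s(1) unfolding s_def by linarith
  ultimately have "((\<lambda>z. z / sqrt (z\<^sup>2 + d\<^sup>2)) has_real_derivative (1 * s - z * (z / s)) / (s * s)) (at z)"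
    unfolding s_def by (rule DERIV_divide[OF DERIV_ident])
  also have "(1 * s - z * (z / s)) / (s * s) = d\<^sup>2 / s ^ 3"
    using s by (simp add: field_simps power2_eq_square power3_eq_cube)
  finally have "((\<lambda>z. (1 + z / sqrt (z\<^sup>2 + d\<^sup>2)) / 2) has_real_derivative (0 + d\<^sup>2 / s ^ 3) / 2) (at z)"
    by (intro DERIV_cdivide DERIV_add DERIV_const)
  then show ?thesis unfolding soft_step_def[abs_def] soft_peak_def s_def by (simp add: mult.commute)
qed

lemma soft_peak_continuous: "d > 0 \<Longrightarrow> isCont (soft_peak d) z"
  unfolding soft_peak_def[abs_def] using soft_root_pos[of d z]
  by (intro continuous_intros) auto

lemma soft_peak_nonneg: "d > 0 \<Longrightarrow> soft_peak d z \<ge> 0"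
  by (simp add: soft_peak_def)

lemma soft_peak_even: "soft_peak d (- z) = soft_peak d z"
  by (simp add: soft_peak_def)

lemma soft_step_bounds: "0 \<le> soft_step d z" "soft_step d z \<le> 1"
proof -
  define x where "x = z / sqrt (z\<^sup>2 + d\<^sup>2)"
  have "\<bar>x\<bar> \<le> 1" unfolding x_def
    using soft_root_le[of z d] not_sum_power2_lt_zero[of z d]
    by (simp add: abs_divide divide_le_eq)
  then show "0 \<le> soft_step d z" "soft_step d z \<le> 1" unfolding soft_step_def x_def[symmetric] by auto
qed

lemma soft_pos_bound:
  assumes "d > 0"
  shows "\<bar>soft_pos d z - max 0 z\<bar> \<le> d"
proof -
  have "sqrt (z\<^sup>2 + d\<^sup>2) \<le> \<bar>z\<bar> + d" using sqrt_add_le_add_sqrt[of "z\<^sup>2" "d\<^sup>2"] assms by simp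
  then show ?thesis using soft_root_le[of z d] assms unfolding soft_pos_def
    by (auto simp: abs_le_iff max_def)
qed

lemma soft_step_tendsto:
  assumes "d \<longlonglongrightarrow> 0"
  shows "(\<lambda>n. soft_step (d n) z) \<longlonglongrightarrow> heaviside z"
proof (cases "z = 0")
  case True
  then show ?thesis by (simp add: soft_step_def heaviside_def)
next
  case False
  then have "(\<lambda>n. soft_step (d n) z) \<longlonglongrightarrow> (1 + z / sqrt (z\<^sup>2 + 0\<^sup>2)) / 2"
    unfolding soft_step_def by (intro tendsto_intros assms) auto
  also have "(1 + z / sqrt (z\<^sup>2 + 0\<^sup>2)) / 2 = heaviside z"
    using False by (simp add: heaviside_def sgn_real_def)
  finally show ?thesis .
qed

lemma heaviside_bounds: "0 \<le> heaviside z" "heaviside z \<le> 1" "\<bar>heaviside z\<bar> \<le> 1"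
  by (auto simp: heaviside_def sgn_real_def)

lemma heaviside_borel [measurable]: "heaviside \<in> borel_measurable borel"
proof -
  have e: "heaviside = (\<lambda>z. if z > 0 then 1 else if z < 0 then 0 else 1 / 2)"
    by (auto simp: heaviside_def sgn_real_def fun_eq_iff)
  show ?thesis by (subst e) measurable
qed

lemma lipschitz_isCont:
  fixes g :: "real \<Rightarrow> real"
  assumes "\<And>r. \<exists>L. L-lipschitz_on {-r..r} g"
  shows "isCont g x"
proof -
  obtain L where "L-lipschitz_on {-(\<bar>x\<bar> + 1)..\<bar>x\<bar> + 1} g" using assms by blast
  from lipschitz_on_continuous_on[OF this] show ?thesis
    by (rule continuous_on_interior) auto
qed

text \<open>The derivative is bounded on the compact interval. This supplies the local Lipschitz
  half of \<open>entropy_flux\<close> for the smooth ingredients.\<close>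

lemma C1_lipschitz_on_interval:
  fixes F :: "real \<Rightarrow> real"
  assumes "\<And>x. (F has_real_derivative F' x) (at x)" and "\<And>x. isCont F' x"
  shows "\<exists>L. L-lipschitz_on {-r..r} F"
proof -
  have "bounded (F' ` {-r..r})"
    using assms(2) by (intro compact_imp_bounded compact_continuous_image continuous_at_imp_continuous_on) auto
  then obtain B where B: "\<And>x. x \<in> {-r..r} \<Longrightarrow> \<bar>F' x\<bar> \<le> B"
    unfolding bounded_iff by force
  have "\<bar>B\<bar>-lipschitz_on {-r..r} F"
  proof (rule lipschitz_onI)
    fix x y assume "x \<in> {-r..r}" "y \<in> {-r..r}"
    then have "norm (F x - F y) \<le> \<bar>B\<bar> * norm (x - y)"
      using B by (intro field_differentiable_bound[where S = "{-r..r}" and f' = F'])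
        (auto intro: DERIV_subset[OF assms(1)] order_trans[OF _ abs_ge_self])
    then show "dist (F x) (F y) \<le> \<bar>B\<bar> * dist x y" by (simp add: dist_norm)
  qed simp
  then show ?thesis by blast
qed

lemma lipschitz_on_interval_mult:
  fixes f g :: "real \<Rightarrow> real"
  assumes "\<exists>L. L-lipschitz_on {-r..r} f" and "\<exists>L. L-lipschitz_on {-r..r} g"
  shows "\<exists>L. L-lipschitz_on {-r..r} (\<lambda>x. f x * g x)"
proof -
  obtain L1 L2 where L1: "L1-lipschitz_on {-r..r} f" and L2: "L2-lipschitz_on {-r..r} g"
    using assms by blast
  have "bounded (f ` {-r..r})" "bounded (g ` {-r..r})"
    using lipschitz_on_continuous_on[OF L1] lipschitz_on_continuous_on[OF L2]
    by (auto intro!: compact_imp_bounded compact_continuous_image)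
  then obtain B1 B2 where B1: "\<And>x. x \<in> {-r..r} \<Longrightarrow> \<bar>f x\<bar> \<le> B1" and B2: "\<And>x. x \<in> {-r..r} \<Longrightarrow> \<bar>g x\<bar> \<le> B2"
    unfolding bounded_iff by force
  have "(\<bar>B1\<bar> * L2 + \<bar>B2\<bar> * L1)-lipschitz_on {-r..r} (\<lambda>x. f x * g x)"
  proof (rule lipschitz_onI)
    fix x y assume xy: "x \<in> {-r..r}" "y \<in> {-r..r}"
    have "\<bar>f x * g x - f y * g y\<bar> = \<bar>f x * (g x - g y) + g y * (f x - f y)\<bar>" by (simp add: algebra_simps)
    also have "\<dots> \<le> \<bar>f x\<bar> * \<bar>g x - g y\<bar> + \<bar>g y\<bar> * \<bar>f x - f y\<bar>"
      by (rule order_trans[OF abs_triangle_ineq]) (simp add: abs_mult)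
    also have "\<dots> \<le> \<bar>B1\<bar> * (L2 * \<bar>x - y\<bar>) + \<bar>B2\<bar> * (L1 * \<bar>x - y\<bar>)"
      using lipschitz_onD[OF L1 xy] lipschitz_onD[OF L2 xy] B1[OF xy(1)] B2[OF xy(2)]
      by (intro add_mono mult_mono) (auto simp: dist_real_def)
    finally show "dist (f x * g x) (f y * g y) \<le> (\<bar>B1\<bar> * L2 + \<bar>B2\<bar> * L1) * dist x y"
      by (simp add: dist_real_def algebra_simps)
  qed (use lipschitz_on_nonneg[OF L1] lipschitz_on_nonneg[OF L2] in auto)
  then show ?thesis by blast
qed

lemma soft_entropy:
  assumes d: "d > 0" and sg: "sg \<in> {1, - 1 :: real}"
  shows "((\<lambda>u. soft_pos d (sg * (u - k))) has_real_derivative sg * soft_step d (sg * (u - k))) (at u)"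
    and "((\<lambda>u. sg * soft_step d (sg * (u - k))) has_real_derivative soft_peak d (u - k)) (at u)"
    and "convex_on UNIV (\<lambda>u. soft_pos d (sg * (u - k)))" (is ?A)
    and "(\<lambda>u. soft_pos d (sg * (u - k))) differentiable_on UNIV" (is ?B)
    and "deriv (\<lambda>u. soft_pos d (sg * (u - k))) u = sg * soft_step d (sg * (u - k))" (is ?C)
proof -
  have l: "((\<lambda>u. sg * (u - k)) has_real_derivative sg) (at u)" for u
    by (auto intro!: derivative_eq_intros)
  show 1: "((\<lambda>u. soft_pos d (sg * (u - k))) has_real_derivative sg * soft_step d (sg * (u - k))) (at u)" for u
    using DERIV_chain2[OF soft_pos_has_derivative[OF d] l] by (simp add: mult.commute)
  show 2: "((\<lambda>u. sg * soft_step d (sg * (u - k))) has_real_derivative soft_peak d (u - k)) (at u)" for u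
  proof -
    have "soft_peak d (sg * (u - k)) = soft_peak d (u - k)" "sg * (soft_peak d (u - k) * sg) = soft_peak d (u - k)"
      using sg soft_peak_even[of d "u - k"] by auto
    with DERIV_cmult[OF DERIV_chain2[OF soft_step_has_derivative[OF d] l], of sg u] show ?thesis by simp
  qed
  show ?A
    using soft_peak_nonneg[OF d] by (intro f''_ge0_imp_convex[OF _ 1 2]) auto
  show ?B
    using 1 by (auto simp: differentiable_on_def intro: differentiableI has_field_derivative_imp_has_derivative)
  show ?C
    by (rule DERIV_imp_deriv[OF 1])
qed

text \<open>Since \<open>f\<close> is only differentiable almost everywhere, the flux is written through an
  integration by parts, with a \<open>C\<^sup>1\<close> antiderivative \<open>\<Phi>\<close> of \<open>\<eta>'' (f - f k)\<close>.\<close>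

lemma soft_entropy_flux:
  fixes f :: "real \<Rightarrow> real"
  assumes d: "d > 0" and sg: "sg \<in> {1, - 1 :: real}"
    and lip: "\<And>r. \<exists>L. L-lipschitz_on {-r..r} f"
    and L: "L-lipschitz_on {-M..M} f" and k: "\<bar>k\<bar> \<le> M"
  shows "\<exists>q. entropy_flux (\<lambda>u. soft_pos d (sg * (u - k))) f q \<and>
             (\<forall>u. \<bar>u\<bar> \<le> M \<longrightarrow> \<bar>q u - sg * soft_step d (sg * (u - k)) * (f u - f k)\<bar> \<le> L * d)"
proof -
  have fcont: "isCont f x" for x by (rule lipschitz_isCont[OF lip])
  define g where "g z = f z - f k" for z
  have "isCont (\<lambda>z. soft_peak d (z - k) * g z) x" for x
    unfolding g_def using fcont soft_peak_continuous[OF d]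
    by (intro continuous_mult isCont_o2[of _ "\<lambda>z. z - k" "soft_peak d"] continuous_diff) auto
  then obtain \<Phi> where \<Phi>: "\<And>x. (\<Phi> has_real_derivative soft_peak d (x - k) * g x) (at x)"
    using einterval_antiderivative[of "-\<infinity>" "\<infinity>" "\<lambda>z. soft_peak d (z - k) * g z"]
    by (auto simp: has_real_derivative_iff_has_vector_derivative)
  define A where "A u = sg * soft_step d (sg * (u - k))" for u
  have A: "(A has_real_derivative soft_peak d (u - k)) (at u)" for u
    unfolding A_def[abs_def] by (rule soft_entropy(2)[OF d sg])
  \<comment> \<open>The product rule gives A f' + A' g, and the derivative of \<open>\<Phi>\<close>
    removes A' g; what remains is eta' f' wherever f is differentiable.\<close>
  define q where "q u = A u * g u - (\<Phi> u - \<Phi> k)" for u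
  have "entropy_flux (\<lambda>u. soft_pos d (sg * (u - k))) f q"
    unfolding entropy_flux_def
  proof (intro conjI allI impI)
    fix r
    obtain Lf where Lf: "Lf-lipschitz_on {-r..r} f" using lip by blast
    have 1: "\<exists>L. L-lipschitz_on {-r..r} g"
      using lipschitz_on_diff[OF Lf lipschitz_on_constant] unfolding g_def[abs_def] by blast
    have 2: "\<exists>L. L-lipschitz_on {-r..r} A"
      by (rule C1_lipschitz_on_interval[OF A], rule isCont_o2[of _ "\<lambda>z. z - k" "soft_peak d"])
         (auto intro: soft_peak_continuous[OF d])
    obtain LA where LA: "LA-lipschitz_on {-r..r} (\<lambda>u. A u * g u)"
      using lipschitz_on_interval_mult[OF 2 1] by blast
    obtain LP where LP: "LP-lipschitz_on {-r..r} \<Phi>"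
      using C1_lipschitz_on_interval[OF \<Phi>] \<open>\<And>x. isCont (\<lambda>z. soft_peak d (z - k) * g z) x\<close> by blast
    show "\<exists>L. L-lipschitz_on {-r..r} q"
      using lipschitz_on_diff[OF LA lipschitz_on_diff[OF LP lipschitz_on_constant]]
      unfolding q_def[abs_def] by blast
  next
    fix s assume "f differentiable at s"
    then have f: "(f has_real_derivative deriv f s) (at s)"
      by (metis DERIV_deriv_iff_real_differentiable)
    then have "(g has_real_derivative deriv f s) (at s)"
      unfolding g_def[abs_def] by (auto intro!: derivative_eq_intros)
    from DERIV_mult[OF A this]
    have "(q has_real_derivative soft_peak d (s - k) * g s + deriv f s * A s - (soft_peak d (s - k) * g s - 0)) (at s)"
      unfolding q_def[abs_def] by (intro DERIV_diff \<Phi> DERIV_const) auto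
    then show "(q has_real_derivative deriv (\<lambda>u. soft_pos d (sg * (u - k))) s * deriv f s) (at s)"
      by (simp add: soft_entropy(5)[OF d sg] A_def mult_ac)
  qed
  moreover have "\<bar>q u - sg * soft_step d (sg * (u - k)) * (f u - f k)\<bar> \<le> L * d" if u: "\<bar>u\<bar> \<le> M" for u
  proof -
    have L0: "L \<ge> 0" by (rule lipschitz_on_nonneg[OF L])
    \<comment> \<open>Explicit antiderivative of L (z - k) \<open>soft_peak d (z - k)\<close>. Its
      least value is -L d / 2, taken at k, and it stays <= 0, so it grows by at most L d / 2 away
      from k.\<close>
    define \<Psi> where "\<Psi> z = - (L * d\<^sup>2 / 2) / sqrt ((z - k)\<^sup>2 + d\<^sup>2)" for z
    have \<Psi>: "(\<Psi> has_real_derivative L * (z - k) * soft_peak d (z - k)) (at z)" for z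
    proof -
      define s where "s = sqrt ((z - k)\<^sup>2 + d\<^sup>2)"
      have s: "s > 0" using soft_root_pos[OF d, of "z - k"] by (auto simp: s_def)
      have "((\<lambda>z. sqrt ((z - k)\<^sup>2 + d\<^sup>2)) has_real_derivative (z - k) / s) (at z)"
        unfolding s_def using soft_root_pos[OF d, of "z - k"]
        by (auto intro!: derivative_eq_intros) (simp add: divide_simps)
      moreover have "sqrt ((z - k)\<^sup>2 + d\<^sup>2) \<noteq> 0" using s unfolding s_def by linarith
      ultimately have "(\<Psi> has_real_derivative (0 * s - - (L * d\<^sup>2 / 2) * ((z - k) / s)) / (s * s)) (at z)"
        unfolding \<Psi>_def[abs_def] s_def by (rule DERIV_divide[OF DERIV_const])
      also have "(0 * s - - (L * d\<^sup>2 / 2) * ((z - k) / s)) / (s * s) = L * (z - k) * soft_peak d (z - k)"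
        using s unfolding soft_peak_def s_def[symmetric] by (simp add: field_simps power3_eq_cube)
      finally show ?thesis .
    qed
    have b: "\<bar>soft_peak d (z - k) * g z\<bar> \<le> L * \<bar>z - k\<bar> * soft_peak d (z - k)" if "\<bar>z\<bar> \<le> M" for z
    proof -
      have "\<bar>g z\<bar> \<le> L * \<bar>z - k\<bar>"
        using lipschitz_onD[OF L, of z k] that k by (simp add: g_def dist_real_def abs_le_iff)
      then show ?thesis using soft_peak_nonneg[OF d, of "z - k"]
        by (simp add: abs_mult mult.commute[of "soft_peak d (z - k)"] mult_right_mono)
    qed
    have \<Psi>b: "\<Psi> u - \<Psi> k \<le> L * d"
    proof -
      have "\<Psi> u \<le> 0" using L0 by (simp add: \<Psi>_def)
      moreover have "\<Psi> k = - (L * d / 2)" using d by (simp add: \<Psi>_def power2_eq_square)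
      ultimately show ?thesis using L0 d mult_nonneg_nonneg[of L d] by linarith
    qed
    have "\<bar>\<Phi> u - \<Phi> k\<bar> \<le> \<Psi> u - \<Psi> k"
    proof (cases "k \<le> u")
      case True
      \<comment> \<open>Using c = 1 and c = -1 turns this monotonicity into a bound on the absolute
        increment of \<open>\<Phi>\<close>.\<close>
      have "\<Psi> k - c * \<Phi> k \<le> \<Psi> u - c * \<Phi> u" if c: "c \<in> {1, - 1 :: real}" for c
      proof (rule DERIV_nonneg_imp_nondecreasing[OF True], intro exI conjI)
        fix z assume z: "k \<le> z" "z \<le> u"
        show "((\<lambda>z. \<Psi> z - c * \<Phi> z) has_real_derivative
                L * (z - k) * soft_peak d (z - k) - c * (soft_peak d (z - k) * g z)) (at z)"
          by (intro DERIV_diff DERIV_cmult \<Psi> \<Phi>)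
        show "0 \<le> L * (z - k) * soft_peak d (z - k) - c * (soft_peak d (z - k) * g z)"
        proof -
          have "\<bar>z\<bar> \<le> M" using z u k by linarith
          then have "\<bar>soft_peak d (z - k) * g z\<bar> \<le> L * (z - k) * soft_peak d (z - k)"
            using b[of z] z by simp
          then show ?thesis using c by auto
        qed
      qed
      from this[of 1] this[of "- 1"] show ?thesis by auto
    next
      case False
      then have uk: "u \<le> k" by simp
      \<comment> \<open>Left of k, \<open>\<Psi>\<close> decreases, so it enters with the opposite
        sign.\<close>
      have "- \<Psi> u - c * \<Phi> u \<le> - \<Psi> k - c * \<Phi> k" if c: "c \<in> {1, - 1 :: real}" for c
      proof (rule DERIV_nonneg_imp_nondecreasing[OF uk], intro exI conjI)
        fix z assume z: "u \<le> z" "z \<le> k"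
        show "((\<lambda>z. - \<Psi> z - c * \<Phi> z) has_real_derivative
                - (L * (z - k) * soft_peak d (z - k)) - c * (soft_peak d (z - k) * g z)) (at z)"
          by (intro DERIV_diff DERIV_cmult DERIV_minus \<Psi> \<Phi>)
        have "\<bar>soft_peak d (z - k) * g z\<bar> \<le> - (L * (z - k) * soft_peak d (z - k))"
        proof -
          have "\<bar>z\<bar> \<le> M" using z u k by linarith
          then show ?thesis using b[of z] z by (simp add: algebra_simps)
        qed
        then show "0 \<le> - (L * (z - k) * soft_peak d (z - k)) - c * (soft_peak d (z - k) * g z)"
          using c by auto
      qed
      from this[of 1] this[of "- 1"] show ?thesis by auto
    qed
    then show ?thesis using \<Psi>b unfolding q_def A_def g_def by simp
  qed
  ultimately show ?thesis by blast
qed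

section \<open>Local Lipschitz continuity of the fluxes; sign and monotonicity of the lane
  change\<close>

lemma flux_lipschitz:
  assumes "\<exists>L. L-lipschitz_on UNIV (v i)"
  shows "\<exists>L. L-lipschitz_on {-r..r} (flux v i)"
  unfolding flux_def[abs_def]
proof (rule lipschitz_on_interval_mult)
  show "\<exists>L. L-lipschitz_on {-r..r} (\<lambda>x::real. x)" using lipschitz_on_id by blast
  show "\<exists>L. L-lipschitz_on {-r..r} (v i)" using assms by (meson lipschitz_on_subset subset_UNIV)
qed

text \<open>The positive and negative parts of the velocity difference are nonnegative coefficients,
  so the signs of the densities decide. This is what a comparison with the zero state can use before
  positivity is known.\<close>

lemma lane_change_sign:
  "a \<le> 0 \<Longrightarrow> 0 \<le> b \<Longrightarrow> lane_change N v i a b \<le> 0"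
  "0 \<le> a \<Longrightarrow> b \<le> 0 \<Longrightarrow> 0 \<le> lane_change N v i a b"
proof -
  let ?d = "v (i + 1) b - v i a"
  show "lane_change N v i a b \<le> 0" if "a \<le> 0" "0 \<le> b"
    using mult_nonneg_nonpos[of "max ?d 0" a] mult_nonneg_nonneg[of "- min ?d 0" b] that
    unfolding lane_change_def by (auto split: if_splits)
  show "0 \<le> lane_change N v i a b" if "0 \<le> a" "b \<le> 0"
    using mult_nonneg_nonneg[of "max ?d 0" a] mult_nonneg_nonpos[of "- min ?d 0" b] that
    unfolding lane_change_def by (auto split: if_splits)
qed

text \<open>Raising a cannot speed up lane i and lowering b cannot slow down lane i + 1. So the
  positive part of the velocity difference does not decrease, nor does its factor a, while the
  negative part and its factor b do not increase. Nonnegative densities let the products be compared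
  factor by factor.\<close>

lemma lane_change_mono:
  assumes dec: "\<And>i. i \<in> {1..N} \<Longrightarrow> antimono_on {0..} (v i)"
    and i: "i \<in> {1..<N}" and a: "0 \<le> a" "a \<le> a'" and b: "0 \<le> b'" "b' \<le> b"
  shows "lane_change N v i a b \<le> lane_change N v i a' b'"
proof -
  have 1: "v i a' \<le> v i a" "v (i + 1) b \<le> v (i + 1) b'"
    using dec[of i] dec[of "i + 1"] i a b by (auto simp: monotone_on_def)
  let ?d = "v (i + 1) b - v i a" and ?d' = "v (i + 1) b' - v i a'"
  have "max ?d 0 * a \<le> max ?d' 0 * a'" using 1 a by (intro mult_mono) auto
  moreover have "(- min ?d' 0) * b' \<le> (- min ?d 0) * b" using 1 b by (intro mult_mono) auto
  ultimately show ?thesis using i by (simp add: lane_change_def)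
qed

text \<open>Different values exclude that both arguments lie strictly on the same side of 0; the
  value 1/2 is why the resulting signs are only weak.\<close>

lemma heaviside_mono_neq: "heaviside x > heaviside y \<Longrightarrow> x \<ge> 0 \<and> y \<le> 0"
  by (auto simp: heaviside_def sgn_real_def split: if_splits)

text \<open>Different Heaviside values force a and b to have opposite weak signs, where
  \<open>lane_change_sign\<close> applies. The zeros are written out because they are the state and
  the exchange of the zero solution.\<close>

lemma lane_change_comparison_zero:
  "(heaviside (0 - a) - heaviside (0 - b)) * (0 - lane_change N v i a b) \<ge> 0"
proof -
  consider "heaviside (- a) > heaviside (- b)" | "heaviside (- a) < heaviside (- b)"
    | "heaviside (- a) = heaviside (- b)" by linarith
  then show ?thesis
  proof cases
    case 1
    then show ?thesis using lane_change_sign(1)[of a b N v i] heaviside_mono_neq[OF 1]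
      by (simp add: mult_nonneg_nonpos)
  next
    case 2
    then show ?thesis using lane_change_sign(2)[of a b N v i] heaviside_mono_neq[OF 2]
      by (simp add: mult_nonpos_nonneg)
  qed simp
qed

text \<open>If the Heaviside values differ, the two states are ordered oppositely in the two lanes,
  which is exactly the situation of \<open>lane_change_mono\<close>.\<close>

lemma lane_change_comparison:
  assumes dec: "\<And>i. i \<in> {1..N} \<Longrightarrow> antimono_on {0..} (v i)"
    and i: "i \<in> {1..<N}" and nn: "0 \<le> a" "0 \<le> a'" "0 \<le> b" "0 \<le> b'"
  shows "(heaviside (a - a') - heaviside (b - b')) * (lane_change N v i a b - lane_change N v i a' b') \<ge> 0"
proof -
  consider "heaviside (a - a') > heaviside (b - b')" | "heaviside (a - a') < heaviside (b - b')"
    | "heaviside (a - a') = heaviside (b - b')" by linarith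
  then show ?thesis
  proof cases
    case 1
    then show ?thesis
      using lane_change_mono[of N v i a' a b b', OF dec i] heaviside_mono_neq[OF 1] nn by simp
  next
    case 2
    then show ?thesis
      using lane_change_mono[of N v i a a' b' b, OF dec i] heaviside_mono_neq[OF 2] nn
      by (simp add: mult_nonpos_nonpos)
  qed simp
qed

section \<open>Solutions on a time strip\<close>

type_synonym pt = "real \<times> real"

text \<open>At each time in the strip this changes the solution on a null set only, but it yields a
  bounded function that is integrable over the plane.\<close>

definition strip_cut :: "real \<Rightarrow> real \<Rightarrow> real \<Rightarrow> (real \<Rightarrow> real \<Rightarrow> real) \<Rightarrow> pt \<Rightarrow> real" where
  "strip_cut T lo hi w p =
     (let z = indicator ({0..T} \<times> UNIV) p * w (fst p) (snd p) in if lo \<le> z \<and> z \<le> hi then z else 0)"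

text \<open>Outflow minus inflow, the sign on the right-hand side of the entropy inequality. The
  argument type is left open because the expression occurs on the plane and on single time
  slices.\<close>

definition lane_source ::
    "nat \<Rightarrow> (nat \<Rightarrow> real \<Rightarrow> real) \<Rightarrow> nat \<Rightarrow> (nat \<Rightarrow> 'a \<Rightarrow> real) \<Rightarrow> 'a \<Rightarrow> real" where
  "lane_source N v i U p =
     lane_change N v i (U i p) (U (i + 1) p) - lane_change N v (i - 1) (U (i - 1) p) (U i p)"

section \<open>Fubini, Tonelli and tensor products for Borel functions\<close>

lemma lborel_Fubini:
  fixes f :: "'a::euclidean_space \<times> 'b::euclidean_space \<Rightarrow> real"
  assumes "integrable lborel f"
  shows "(LBINT p. f p) = (LBINT x. LBINT y. f (x, y))" (is ?A)
    and "(LBINT p. f p) = (LBINT y. LBINT x. f (x, y))" (is ?B)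
    and "integrable lborel (\<lambda>x. LBINT y. f (x, y))" (is ?C)
    and "integrable lborel (\<lambda>y. LBINT x. f (x, y))" (is ?D)
proof -
  have f: "integrable (lborel \<Otimes>\<^sub>M lborel) f" using assms by (simp add: lborel_prod)
  then have f': "integrable (lborel \<Otimes>\<^sub>M lborel) (case_prod (\<lambda>x y. f (x, y)))" by simp
  show ?A
    using lborel_pair.integral_fst'[OF f] by (simp add: lborel_prod)
  show ?B
    using lborel_pair.integral_snd[OF f'] by (simp add: lborel_prod)
  show ?C by (rule lborel_pair.integrable_fst'[OF f])
  show ?D using lborel_pair.integrable_snd[OF f'] by simp
qed

lemma lborel_swap:
  fixes f :: "'a::euclidean_space \<times> 'b::euclidean_space \<Rightarrow> real"
  assumes "integrable lborel f"
  shows "integrable lborel (\<lambda>p. f (snd p, fst p))" (is ?A)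
    and "(LBINT p. f (snd p, fst p)) = (LBINT p. f p)"
proof -
  have f: "integrable (lborel \<Otimes>\<^sub>M lborel) f" using assms by (simp add: lborel_prod)
  show ?A "(LBINT p. f (snd p, fst p)) = (LBINT p. f p)"
    using lborel_pair.integrable_product_swap[OF f] lborel_pair.integral_product_swap[OF borel_measurable_integrable[OF f]]
    by (simp_all add: split_beta' lborel_prod)
qed

text \<open>Tonelli's criterion; the second alternative is reduced to the first by swapping the
  factors.\<close>

lemma lborel_Fubini_integrable:
  fixes f :: "'a::euclidean_space \<times> 'b::euclidean_space \<Rightarrow> real"
  assumes f: "f \<in> borel_measurable borel"
    and "(\<forall>x. integrable lborel (\<lambda>y. f (x, y))) \<and> integrable lborel (\<lambda>x. LBINT y. \<bar>f (x, y)\<bar>)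
       \<or> (\<forall>y. integrable lborel (\<lambda>x. f (x, y))) \<and> integrable lborel (\<lambda>y. LBINT x. \<bar>f (x, y)\<bar>)"
  shows "integrable lborel f"
  using assms(2)
proof
  assume "(\<forall>x. integrable lborel (\<lambda>y. f (x, y))) \<and> integrable lborel (\<lambda>x. LBINT y. \<bar>f (x, y)\<bar>)"
  then have "integrable (lborel \<Otimes>\<^sub>M lborel) f"
    using f by (intro lborel_pair.Fubini_integrable) (auto simp: lborel_prod)
  then show ?thesis by (simp add: lborel_prod)
next
  assume *: "(\<forall>y. integrable lborel (\<lambda>x. f (x, y))) \<and> integrable lborel (\<lambda>y. LBINT x. \<bar>f (x, y)\<bar>)"
  have "f \<in> borel_measurable (lborel \<Otimes>\<^sub>M lborel)" using f by (simp add: lborel_prod)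
  from measurable_compose[OF measurable_pair_swap' this]
  have "(\<lambda>(y, x). f (x, y)) \<in> borel_measurable (lborel \<Otimes>\<^sub>M lborel)" by (simp add: case_prod_beta)
  then have "integrable (lborel \<Otimes>\<^sub>M lborel) (\<lambda>(y, x). f (x, y))"
    using * by (intro lborel_pair.Fubini_integrable) auto
  then have "integrable lborel (\<lambda>p. f (snd p, fst p))" by (simp add: split_beta' lborel_prod)
  from lborel_swap(1)[OF this] show ?thesis by simp
qed

lemma borel_measurable_fst_snd:
  fixes g :: "'a::topological_space \<Rightarrow> 'c::topological_space" and k :: "'b::topological_space \<Rightarrow> 'c"
  shows "g \<in> borel_measurable borel \<Longrightarrow> (\<lambda>p::'a\<times>'b. g (fst p)) \<in> borel_measurable borel"
    and "k \<in> borel_measurable borel \<Longrightarrow> (\<lambda>p::'a\<times>'b. k (snd p)) \<in> borel_measurable borel"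
proof -
  have "(fst :: 'a \<times> 'b \<Rightarrow> 'a) \<in> borel_measurable borel" "(snd :: 'a \<times> 'b \<Rightarrow> 'b) \<in> borel_measurable borel"
    by (auto intro!: borel_measurable_continuous_onI continuous_intros)
  then show "g \<in> borel_measurable borel \<Longrightarrow> (\<lambda>p::'a\<times>'b. g (fst p)) \<in> borel_measurable borel"
    "k \<in> borel_measurable borel \<Longrightarrow> (\<lambda>p::'a\<times>'b. k (snd p)) \<in> borel_measurable borel"
    using measurable_compose by blast+
qed

lemma integrable_tensor:
  fixes a :: "'a::euclidean_space \<Rightarrow> real" and b :: "'b::euclidean_space \<Rightarrow> real"
  assumes "integrable lborel a" "integrable lborel b"
  shows "integrable lborel (\<lambda>p. a (fst p) * b (snd p))" (is ?A)
    and "(LBINT p. a (fst p) * b (snd p)) = (LBINT x. a x) * (LBINT y. b y)" (is ?B)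
proof -
  have "a \<in> borel_measurable borel" "b \<in> borel_measurable borel"
    using assms by auto
  then have "(\<lambda>p. a (fst p) * b (snd p)) \<in> borel_measurable borel"
    by (intro borel_measurable_times borel_measurable_fst_snd)
  then show 1: ?A
    using assms by (intro lborel_Fubini_integrable disjI1 conjI) (auto simp: abs_mult)
  show ?B
    using lborel_Fubini(1)[OF 1] by simp
qed

lemma integrable_bounded_mult:
  fixes G g :: "'a \<Rightarrow> real"
  assumes "integrable M g" "G \<in> borel_measurable M" "\<And>p. \<bar>G p\<bar> \<le> C"
  shows "integrable M (\<lambda>p. G p * g p)"
proof (rule Bochner_Integration.integrable_bound)
  show "integrable M (\<lambda>p. C * \<bar>g p\<bar>)" using assms(1) by auto
  show "(\<lambda>p. G p * g p) \<in> borel_measurable M" using assms(1,2) by auto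
  show "AE p in M. norm (G p * g p) \<le> norm (C * \<bar>g p\<bar>)"
  proof (rule AE_I2)
    fix p
    have "\<bar>G p\<bar> * \<bar>g p\<bar> \<le> \<bar>C\<bar> * \<bar>g p\<bar>" using assms(3)[of p] by (intro mult_right_mono) auto
    then show "norm (G p * g p) \<le> norm (C * \<bar>g p\<bar>)" by (simp add: abs_mult)
  qed
qed

lemma abs_indicator_mult_le: "\<bar>z\<bar> \<le> C \<Longrightarrow> \<bar>indicator A p * z\<bar> \<le> (C::real)"
  by (auto simp: indicator_def)

lemma continuous_bounded_on_interval:
  fixes g :: "real \<Rightarrow> real"
  assumes "\<And>x. isCont g x"
  shows "\<exists>C\<ge>0. \<forall>x. lo \<le> x \<longrightarrow> x \<le> hi \<longrightarrow> \<bar>g x\<bar> \<le> C"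
proof -
  have "bounded (g ` {lo..hi})"
    using assms by (intro compact_imp_bounded compact_continuous_image continuous_at_imp_continuous_on) auto
  then obtain B where B: "\<And>x. x \<in> {lo..hi} \<Longrightarrow> \<bar>g x\<bar> \<le> B" unfolding bounded_iff by force
  then show ?thesis by (intro exI[of _ "\<bar>B\<bar>"]) (force intro: order_trans[OF _ abs_ge_self])
qed

lemma isCont_borel: "(\<And>x. isCont g x) \<Longrightarrow> (g :: real \<Rightarrow> real) \<in> borel_measurable borel"
  by (auto intro!: borel_measurable_continuous_onI continuous_at_imp_continuous_on)

section \<open>Bounds and measurability of velocities, fluxes and lane sources\<close>

context
  fixes N :: nat and v :: "nat \<Rightarrow> real \<Rightarrow> real"
  assumes v_lipschitz: "\<And>i. i \<in> {1..N} \<Longrightarrow> \<exists>L. L-lipschitz_on UNIV (v i)"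
begin

lemma velocity_isCont: "i \<in> {1..N} \<Longrightarrow> isCont (v i) x"
  using v_lipschitz[of i] by (intro lipschitz_isCont) (meson lipschitz_on_subset subset_UNIV)

lemma velocity_bound: "i \<in> {1..N} \<Longrightarrow> \<exists>C\<ge>0. \<forall>a. \<bar>a\<bar> \<le> M \<longrightarrow> \<bar>v i a\<bar> \<le> C"
  using continuous_bounded_on_interval[OF velocity_isCont, of i "-M" M] by (auto simp: abs_le_iff)

text \<open>The factor |a| makes the flux of a bounded integrable density integrable over the whole
  line, which takes the place of a spatial cutoff.\<close>

lemma flux_bound:
  assumes "i \<in> {1..N}"
  shows "\<exists>C\<ge>0. \<forall>a. \<bar>a\<bar> \<le> M \<longrightarrow> \<bar>flux v i a\<bar> \<le> C * \<bar>a\<bar>"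
proof -
  obtain C where C: "C \<ge> 0" "\<And>a. \<bar>a\<bar> \<le> M \<Longrightarrow> \<bar>v i a\<bar> \<le> C" using velocity_bound[OF assms] by blast
  have "\<bar>flux v i a\<bar> \<le> C * \<bar>a\<bar>" if "\<bar>a\<bar> \<le> M" for a
    using mult_left_mono[OF C(2)[OF that], of "\<bar>a\<bar>"] by (simp add: flux_def abs_mult mult.commute)
  then show ?thesis using C(1) by blast
qed

lemma lane_change_bound:
  assumes "i \<le> N"
  shows "\<exists>C\<ge>0. \<forall>a b. \<bar>a\<bar> \<le> M \<longrightarrow> \<bar>b\<bar> \<le> M \<longrightarrow> \<bar>lane_change N v i a b\<bar> \<le> C * (\<bar>a\<bar> + \<bar>b\<bar>)"
proof (cases "i = 0 \<or> i = N")
  case True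
  then show ?thesis by (intro exI[of _ 0]) (auto simp: lane_change_def)
next
  case False
  then have i: "i \<in> {1..N}" "i + 1 \<in> {1..N}" using assms by auto
  obtain C where C: "C \<ge> 0" "\<And>a. \<bar>a\<bar> \<le> M \<Longrightarrow> \<bar>v i a\<bar> \<le> C" using velocity_bound[OF i(1)] by blast
  obtain D where D: "D \<ge> 0" "\<And>a. \<bar>a\<bar> \<le> M \<Longrightarrow> \<bar>v (i + 1) a\<bar> \<le> D" using velocity_bound[OF i(2)] by blast
  have "\<bar>lane_change N v i a b\<bar> \<le> (C + D) * (\<bar>a\<bar> + \<bar>b\<bar>)" if "\<bar>a\<bar> \<le> M" "\<bar>b\<bar> \<le> M" for a b
  proof -
    define d where "d = v (i + 1) b - v i a"
    have d: "\<bar>d\<bar> \<le> C + D" using C(2)[OF that(1)] D(2)[OF that(2)] by (simp add: d_def)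
    have "\<bar>lane_change N v i a b\<bar> = \<bar>max d 0 * a - (- min d 0) * b\<bar>"
      using False by (simp add: lane_change_def d_def)
    also have "\<dots> \<le> \<bar>max d 0\<bar> * \<bar>a\<bar> + \<bar>min d 0\<bar> * \<bar>b\<bar>"
      using abs_triangle_ineq4[of "max d 0 * a" "(- min d 0) * b"] by (simp add: abs_mult)
    also have "\<dots> \<le> (C + D) * \<bar>a\<bar> + (C + D) * \<bar>b\<bar>"
      using d by (intro add_mono mult_right_mono) auto
    finally show ?thesis by (simp add: distrib_left)
  qed
  then show ?thesis using C(1) D(1) by (intro exI[of _ "C + D"]) auto
qed

text \<open>Nothing is known about the functions in lanes 0 and N + 1; wherever they would enter,
  the boundary condition makes the term 0.\<close>

lemma lane_change_measurable:
  assumes i: "i \<le> N" and w: "\<And>j. j \<in> {1..N} \<Longrightarrow> w j \<in> borel_measurable M"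
  shows "(\<lambda>p. lane_change N v i (w i p) (w (i + 1) p)) \<in> borel_measurable M"
proof (cases "i = 0 \<or> i = N")
  case True
  then have "(\<lambda>p. lane_change N v i (w i p) (w (i + 1) p)) = (\<lambda>p. 0)" by (auto simp: lane_change_def)
  then show ?thesis by simp
next
  case False
  then have i: "i \<in> {1..N}" "i + 1 \<in> {1..N}" using assms by auto
  note [measurable] = w[OF i(1)] w[OF i(2)] isCont_borel[OF velocity_isCont[OF i(1)]]
    isCont_borel[OF velocity_isCont[OF i(2)]]
  have "(\<lambda>p. lane_change N v i (w i p) (w (i + 1) p))
      = (\<lambda>p. max (v (i + 1) (w (i + 1) p) - v i (w i p)) 0 * w i p
             - (- min (v (i + 1) (w (i + 1) p) - v i (w i p)) 0) * w (i + 1) p)"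
    using False by (simp add: lane_change_def)
  then show ?thesis by (simp only:) measurable
qed

lemma lane_source_measurable:
  assumes i: "i \<in> {1..N}" and w: "\<And>j. j \<in> {1..N} \<Longrightarrow> U j \<in> borel_measurable M"
  shows "lane_source N v i U \<in> borel_measurable M"
proof -
  have "i - 1 \<le> N" "i \<le> N" "i - 1 + 1 = i" using i by auto
  then show ?thesis
    using lane_change_measurable[of "i - 1" U M] lane_change_measurable[of i U M] w
    unfolding lane_source_def[abs_def] by auto
qed

text \<open>Taking the sum over all lanes gives one common majorant, integrable over the plane, for
  the sources of every lane.\<close>

lemma lane_source_bound:
  assumes i: "i \<in> {1..N}" and U: "\<And>j p. j \<in> {1..N} \<Longrightarrow> \<bar>U j p\<bar> \<le> M"
  shows "\<exists>C\<ge>0. \<forall>p. \<bar>lane_source N v i U p\<bar> \<le> C * (\<Sum>j=1..N. \<bar>U j p\<bar>)"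
proof -
  have one: "\<exists>C\<ge>0. \<forall>p. \<bar>lane_change N v i (U i p) (U (i + 1) p)\<bar> \<le> C * (\<Sum>j=1..N. \<bar>U j p\<bar>)" if iN: "i \<le> N" for i
  proof (cases "i = 0 \<or> i = N")
    case True
    then show ?thesis by (intro exI[of _ 0]) (auto simp: lane_change_def)
  next
    case False
    then have i: "i \<in> {1..N}" "i + 1 \<in> {1..N}" using iN by auto
    obtain C where C: "C \<ge> 0" "\<And>a b. \<bar>a\<bar> \<le> M \<Longrightarrow> \<bar>b\<bar> \<le> M \<Longrightarrow> \<bar>lane_change N v i a b\<bar> \<le> C * (\<bar>a\<bar> + \<bar>b\<bar>)"
      using lane_change_bound[OF iN] by blast
    have "\<bar>lane_change N v i (U i p) (U (i + 1) p)\<bar> \<le> C * (\<Sum>j=1..N. \<bar>U j p\<bar>)" for p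
    proof -
      have "\<bar>U i p\<bar> + \<bar>U (i + 1) p\<bar> = (\<Sum>j\<in>{i, i + 1}. \<bar>U j p\<bar>)" by simp
      also have "\<dots> \<le> (\<Sum>j=1..N. \<bar>U j p\<bar>)" using i by (intro sum_mono2) auto
      finally show ?thesis
        using order_trans[OF C(2)[OF U[OF i(1)] U[OF i(2)]] mult_left_mono[OF _ C(1)]] by blast
    qed
    then show ?thesis using C(1) by blast
  qed
  have i': "i \<le> N" "i - 1 \<le> N" "i - 1 + 1 = i" using i by auto
  obtain C where C: "C \<ge> 0" "\<And>p. \<bar>lane_change N v i (U i p) (U (i + 1) p)\<bar> \<le> C * (\<Sum>j=1..N. \<bar>U j p\<bar>)"
    using one[OF i'(1)] by blast
  obtain D where D: "D \<ge> 0" "\<And>p. \<bar>lane_change N v (i - 1) (U (i - 1) p) (U i p)\<bar> \<le> D * (\<Sum>j=1..N. \<bar>U j p\<bar>)"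
    using one[OF i'(2)] i'(3) by auto
  have "\<bar>lane_source N v i U p\<bar> \<le> (C + D) * (\<Sum>j=1..N. \<bar>U j p\<bar>)" for p
    using C(2)[of p] D(2)[of p] unfolding lane_source_def by (simp add: distrib_right)
  then show ?thesis using C(1) D(1) by (intro exI[of _ "C + D"]) auto
qed

end

section \<open>Truncated solutions and the entropy inequality on the plane\<close>

text \<open>The range is a parameter because the locale serves twice: with [-M, M] before positivity
  is known, and with [0, M] afterwards.\<close>

locale bounded_solution =
  fixes N :: nat and v :: "nat \<Rightarrow> real \<Rightarrow> real" and u0 :: "nat \<Rightarrow> real \<Rightarrow> real"
    and u :: "nat \<Rightarrow> real \<Rightarrow> real \<Rightarrow> real" and T lo hi :: real
  assumes v_lipschitz: "\<And>i. i \<in> {1..N} \<Longrightarrow> \<exists>L. L-lipschitz_on UNIV (v i)"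
    and u0: "\<And>i. i \<in> {1..N} \<Longrightarrow> L1_Linf (u0 i)"
    and solution: "entropy_solution N v u0 u"
    and T: "0 < T" and range: "lo \<le> 0" "0 \<le> hi"
    and bound: "\<And>i t. i \<in> {1..N} \<Longrightarrow> t \<in> {0..T} \<Longrightarrow> AE x in lborel. lo \<le> u i t x \<and> u i t x \<le> hi"
begin

definition U :: "nat \<Rightarrow> pt \<Rightarrow> real" where
  "U i = strip_cut T lo hi (u i)"

lemma continuous: "i \<in> {1..N} \<Longrightarrow> continuous_into_L1 (u i)"
  using solution unfolding entropy_solution_def weak_solution_def by blast

lemma u_integrable: "i \<in> {1..N} \<Longrightarrow> 0 \<le> t \<Longrightarrow> integrable lborel (u i t)"
  using continuous unfolding continuous_into_L1_def by blast

lemma u_L1_continuous: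
  "i \<in> {1..N} \<Longrightarrow> 0 \<le> t \<Longrightarrow> ((\<lambda>s. L1_dist (u i s) (u i t)) \<longlongrightarrow> 0) (at t within {0..})"
  using continuous unfolding continuous_into_L1_def by blast

lemma U_range: "lo \<le> U i p" "U i p \<le> hi"
  using range by (auto simp: U_def strip_cut_def Let_def)

lemma U_bound: "\<bar>U i p\<bar> \<le> max (- lo) hi"
  using U_range[of i p] by linarith

lemma U_outside: "t \<notin> {0..T} \<Longrightarrow> U i (t, x) = 0"
  by (auto simp: U_def strip_cut_def Let_def)

lemma U_borel:
  assumes "i \<in> {1..N}"
  shows "U i \<in> borel_measurable borel"
proof -
  have m1: "(\<lambda>p. indicator ({0..} \<times> UNIV) p * u i (fst p) (snd p)) \<in> borel_measurable borel"
    using continuous[OF assms] unfolding continuous_into_L1_def set_borel_measurable_def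
    by (simp add: case_prod_beta)
  have m2: "(indicator ({0..T} \<times> UNIV) :: pt \<Rightarrow> real) \<in> borel_measurable borel"
    by (intro borel_measurable_indicator borel_closed closed_Times) auto
  \<comment> \<open>Measurability is given for t >= 0 only, so the indicator of the strip is
    factored through that of the half-plane.\<close>
  define F where "F p = indicator ({0..T} \<times> UNIV) p * (indicator ({0..} \<times> UNIV) p * u i (fst p) (snd p))" for p
  have [measurable]: "F \<in> borel_measurable borel"
    unfolding F_def[abs_def] by (rule borel_measurable_times[OF m2 m1])
  have e: "U i = (\<lambda>p. if lo \<le> F p \<and> F p \<le> hi then F p else 0)"
    by (auto simp: fun_eq_iff U_def strip_cut_def Let_def indicator_def F_def)
  show ?thesis by (subst e) measurable
qed

lemma U_AE:
  assumes "i \<in> {1..N}" "t \<in> {0..T}"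
  shows "AE x in lborel. U i (t, x) = u i t x"
  using bound[OF assms] by eventually_elim (use assms in \<open>auto simp: U_def strip_cut_def Let_def\<close>)

lemma U_AE_all: "t \<in> {0..T} \<Longrightarrow> AE x in lborel. \<forall>i\<in>{1..N}. U i (t, x) = u i t x"
  using U_AE by (intro AE_finite_allI) auto

lemma U_slice_borel:
  assumes "i \<in> {1..N}"
  shows "(\<lambda>x. U i (t, x)) \<in> borel_measurable lborel"
proof -
  have "(\<lambda>x::real. (t, x)) \<in> borel_measurable borel"
    by (intro borel_measurable_continuous_onI continuous_intros)
  from measurable_compose[OF this U_borel[OF assms]] show ?thesis by simp
qed

lemma U_slice_integrable:
  assumes "i \<in> {1..N}"
  shows "integrable lborel (\<lambda>x. U i (t, x))"
proof (cases "t \<in> {0..T}")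
  case True
  then have "integrable lborel (u i t)" using u_integrable[OF assms] by simp
  then show ?thesis
    by (rule integrable_cong_AE_imp) (use U_slice_borel[OF assms] U_AE[OF assms True] in auto)
qed (simp add: U_outside)

text \<open>The L1 norm is continuous in time, hence bounded on the compact interval. This makes the
  truncated solution integrable over the plane.\<close>

lemma L1_norm_bounded:
  assumes i: "i \<in> {1..N}"
  shows "\<exists>B. \<forall>t\<in>{0..T}. (LBINT x. \<bar>u i t x\<bar>) \<le> B"
proof -
  have "continuous_on {0..T} (\<lambda>t. LBINT x. \<bar>u i t x\<bar>)"
    unfolding continuous_on_def
  proof
    fix t assume t: "t \<in> {0..T}"
    have "((\<lambda>s. L1_dist (u i s) (u i t)) \<longlongrightarrow> 0) (at t within {0..T})"
      using u_L1_continuous[OF i, of t] t by (auto intro: tendsto_within_subset)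
    then have "((\<lambda>s. (LBINT x. \<bar>u i s x\<bar>) - (LBINT x. \<bar>u i t x\<bar>)) \<longlongrightarrow> 0) (at t within {0..T})"
    proof (rule Lim_null_comparison[rotated])
      have "\<bar>(LBINT x. \<bar>u i s x\<bar>) - (LBINT x. \<bar>u i t x\<bar>)\<bar> \<le> (L1_dist (u i s) (u i t))"
        if s: "s \<in> {0..T}" for s
      proof -
        note int = u_integrable[OF i, of s] u_integrable[OF i, of t]
        have "(LBINT x. \<bar>u i s x\<bar>) - (LBINT x. \<bar>u i t x\<bar>) = (LBINT x. \<bar>u i s x\<bar> - \<bar>u i t x\<bar>)"
          using int s t by simp
        also have "\<bar>\<dots>\<bar> \<le> (LBINT x. \<bar>\<bar>u i s x\<bar> - \<bar>u i t x\<bar>\<bar>)" by (rule integral_abs_bound)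
        also have "\<dots> \<le> (L1_dist (u i s) (u i t))"
          using int s t by (intro integral_mono) auto
        finally show ?thesis .
      qed
      then show "\<forall>\<^sub>F s in at t within {0..T}. norm ((LBINT x. \<bar>u i s x\<bar>) - (LBINT x. \<bar>u i t x\<bar>))
          \<le> (L1_dist (u i s) (u i t))"
        by (auto simp: eventually_at_filter)
    qed
    then show "((\<lambda>t. LBINT x. \<bar>u i t x\<bar>) \<longlongrightarrow> (LBINT x. \<bar>u i t x\<bar>)) (at t within {0..T})"
      by (rule LIM_zero_cancel)
  qed
  then have "bounded ((\<lambda>t. LBINT x. \<bar>u i t x\<bar>) ` {0..T})"
    by (intro compact_imp_bounded compact_continuous_image) auto
  then obtain B where "\<And>t. t \<in> {0..T} \<Longrightarrow> norm (LBINT x. \<bar>u i t x\<bar>) \<le> B"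
    unfolding bounded_iff by blast
  then show ?thesis by (intro exI[of _ B]) auto
qed

lemma U_integrable:
  assumes i: "i \<in> {1..N}"
  shows "integrable lborel (U i)"
proof -
  have "integrable (lborel \<Otimes>\<^sub>M lborel) (U i)"
  proof (rule lborel_pair.Fubini_integrable)
    show m: "U i \<in> borel_measurable (lborel \<Otimes>\<^sub>M lborel)"
      using U_borel[OF i] by (simp add: lborel_prod)
    show "AE x in lborel. integrable lborel (\<lambda>y. U i (x, y))" using U_slice_integrable[OF i] by simp
    obtain B where B: "\<And>t. t \<in> {0..T} \<Longrightarrow> (LBINT x. \<bar>u i t x\<bar>) \<le> B"
      using L1_norm_bounded[OF i] by blast
    show "integrable lborel (\<lambda>x. LBINT y. norm (U i (x, y)))"
    proof (rule Bochner_Integration.integrable_bound)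
      show "integrable lborel (\<lambda>t. indicator {0..T} t * B)"
        by (intro integrable_mult_left integrable_real_indicator) (auto simp: emeasure_lborel_Icc_eq)
      show "(\<lambda>x. LBINT y. norm (U i (x, y))) \<in> borel_measurable lborel"
        by (rule lborel.borel_measurable_lebesgue_integral) (use m in \<open>auto simp: case_prod_beta\<close>)
      show "AE t in lborel. norm (LBINT y. norm (U i (t, y))) \<le> norm (indicator {0..T} t * B)"
      proof (rule AE_I2)
        fix t
        show "norm (LBINT y. norm (U i (t, y))) \<le> norm (indicator {0..T} t * B)"
        proof (cases "t \<in> {0..T}")
          case True
          have "(LBINT y. norm (U i (t, y))) = (LBINT y. \<bar>u i t y\<bar>)"
            using U_slice_borel[OF i] u_integrable[OF i, of t] U_AE[OF i True] True
            by (intro integral_cong_AE) auto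
          then show ?thesis using B[OF True] True by simp
        qed (simp add: U_outside)
      qed
    qed
  qed
  then show ?thesis by (simp add: lborel_prod)
qed

lemma U_source_bounded:
  assumes "i \<in> {1..N}"
  shows "\<exists>C\<ge>0. \<forall>p. \<bar>lane_source N v i U p\<bar> \<le> C"
proof -
  obtain C where C: "C \<ge> 0" "\<And>p. \<bar>lane_source N v i U p\<bar> \<le> C * (\<Sum>j=1..N. \<bar>U j p\<bar>)"
    using lane_source_bound[where N = N and v = v and U = U and M = "max (- lo) hi", OF v_lipschitz assms] U_bound
    by blast
  have "\<bar>lane_source N v i U p\<bar> \<le> C * (\<Sum>j=1..N. max (- lo) hi)" for p
    using C U_bound by (meson order_trans mult_left_mono sum_mono)
  then show ?thesis by (meson abs_ge_zero order_trans)
qed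

text \<open>Product test functions turn the iterated integrals into plane integrals of the
  everywhere bounded \<open>U\<close>. As a and its derivative vanish after T, only time slices on
  which \<open>U\<close> agrees a.e. with the solution contribute.\<close>

lemma entropy_inequality_plane:
  assumes i: "i \<in> {1..N}" and a: "bump_function a" and b: "bump_function b"
    and nonneg: "\<And>t. 0 \<le> a t" "\<And>x. 0 \<le> b x"
    and support: "\<And>t. T < t \<Longrightarrow> a t = 0 \<and> deriv a t = 0"
    and \<eta>: "convex_on UNIV \<eta>" "\<eta> differentiable_on UNIV" "\<And>x. isCont (deriv \<eta>) x"
    and q: "entropy_flux \<eta> (flux v i) q"
  shows "integrable lborel (\<lambda>p. indicator ({0..} \<times> UNIV) p * (\<eta> (U i p) * (deriv a (fst p) * b (snd p))
      + q (U i p) * (a (fst p) * deriv b (snd p)) - deriv \<eta> (U i p) * lane_source N v i U p * (a (fst p) * b (snd p))))"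
    (is "integrable _ ?Z")
    and "0 \<le> (LBINT p. indicator ({0..} \<times> UNIV) p * (\<eta> (U i p) * (deriv a (fst p) * b (snd p))
      + q (U i p) * (a (fst p) * deriv b (snd p)) - deriv \<eta> (U i p) * lane_source N v i U p * (a (fst p) * b (snd p))))
      + a 0 * (LBINT x. \<eta> (u0 i x) * b x)"
proof -
  have c\<eta>: "isCont \<eta> x" for x
    using \<eta>(2) differentiable_imp_continuous_within by (auto simp: differentiable_on_def)
  have cq: "isCont q x" for x using q by (intro lipschitz_isCont) (auto simp: entropy_flux_def)
  note [measurable] = isCont_borel[OF c\<eta>] isCont_borel[OF cq] isCont_borel[OF \<eta>(3)] U_borel[OF i]
    bump_function_borel[OF a] bump_function_borel[OF b]
  have [measurable]: "lane_source N v i U \<in> borel_measurable borel"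
    by (rule lane_source_measurable[OF v_lipschitz i]) (auto intro: U_borel)
  have [measurable]: "(indicator ({0..} \<times> UNIV) :: pt \<Rightarrow> real) \<in> borel_measurable borel"
    by (intro borel_measurable_indicator borel_closed closed_Times) auto
  obtain C1 where C1: "\<And>x. lo \<le> x \<Longrightarrow> x \<le> hi \<Longrightarrow> \<bar>\<eta> x\<bar> \<le> C1"
    using continuous_bounded_on_interval[OF c\<eta>] by blast
  obtain C2 where C2: "\<And>x. lo \<le> x \<Longrightarrow> x \<le> hi \<Longrightarrow> \<bar>q x\<bar> \<le> C2"
    using continuous_bounded_on_interval[OF cq] by blast
  obtain C3 where C3: "C3 \<ge> 0" "\<And>x. lo \<le> x \<Longrightarrow> x \<le> hi \<Longrightarrow> \<bar>deriv \<eta> x\<bar> \<le> C3"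
    using continuous_bounded_on_interval[OF \<eta>(3)] by blast
  obtain C5 where C5: "\<And>p. \<bar>lane_source N v i U p\<bar> \<le> C5" using U_source_bounded[OF i] by blast
  let ?e = "\<lambda>t x. \<eta> (u i t x) * dt (\<lambda>t x. a t * b x) t x + q (u i t x) * dx (\<lambda>t x. a t * b x) t x"
  let ?s = "\<lambda>t x. deriv \<eta> (u i t x)
      * (lane_change N v i (u i t x) (u (i + 1) t x) - lane_change N v (i - 1) (u (i - 1) t x) (u i t x)) * (a t * b x)"
  let ?I = "indicator ({0..} \<times> UNIV) :: pt \<Rightarrow> real"
  define X where "X p = ?I p * (\<eta> (U i p) * (deriv a (fst p) * b (snd p)) + q (U i p) * (a (fst p) * deriv b (snd p)))" for p
  define Y where "Y p = ?I p * (deriv \<eta> (U i p) * lane_source N v i U p * (a (fst p) * b (snd p)))" for p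
  note ia = bump_function_integrable[OF a] and ib = bump_function_integrable[OF b]
  have "integrable lborel (\<lambda>p. (?I p * \<eta> (U i p)) * (deriv a (fst p) * b (snd p)))"
    by (rule integrable_bounded_mult[OF integrable_tensor(1)[OF ia(2) ib(1)], of _ C1])
       (use C1[OF U_range] in \<open>auto intro!: abs_indicator_mult_le\<close>)
  moreover have "integrable lborel (\<lambda>p. (?I p * q (U i p)) * (a (fst p) * deriv b (snd p)))"
    by (rule integrable_bounded_mult[OF integrable_tensor(1)[OF ia(1) ib(2)], of _ C2])
       (use C2[OF U_range] in \<open>auto intro!: abs_indicator_mult_le\<close>)
  ultimately have iX: "integrable lborel X"
    unfolding X_def distrib_left by (auto simp: mult.assoc)
  have "integrable lborel (\<lambda>p. (?I p * (deriv \<eta> (U i p) * lane_source N v i U p)) * (a (fst p) * b (snd p)))"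
  proof (rule integrable_bounded_mult[OF integrable_tensor(1)[OF ia(1) ib(1)], of _ "C3 * C5"])
    show "\<bar>?I p * (deriv \<eta> (U i p) * lane_source N v i U p)\<bar> \<le> C3 * C5" for p
    proof -
      have "\<bar>deriv \<eta> (U i p)\<bar> * \<bar>lane_source N v i U p\<bar> \<le> C3 * C5"
        using C3 C5[of p] U_range by (intro mult_mono) auto
      moreover have "C3 * C5 \<ge> 0" using C3(1) C5[of p] by (intro mult_nonneg_nonneg) auto
      ultimately show ?thesis by (auto simp: indicator_def abs_mult)
    qed
  qed auto
  then have iY: "integrable lborel Y" unfolding Y_def by (auto simp: mult.assoc)
  have Z: "?Z = (\<lambda>p. X p - Y p)" by (auto simp: X_def Y_def algebra_simps)
  show "integrable lborel ?Z" unfolding Z using iX iY by simp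
  note test = test_function_tensor(1)[OF a b] and dt = test_function_tensor(2)[OF a b]
    and dx = test_function_tensor(3)[OF a b]
  have slice: "u j t \<in> borel_measurable lborel" if "j \<in> {1..N}" "0 \<le> t" for j t
    using u_integrable[OF that] by auto
  have ii: "i - 1 + 1 = i" "i - 1 \<le> N" "i \<le> N" using i by auto
  \<comment> \<open>Outside [0, T] both sides vanish: for t < 0 by the indicator, for t > T by the
    support of a.\<close>
  have "indicator {0..} t *\<^sub>R (LBINT x. ?e t x) = (LBINT x. X (t, x))" for t
  proof (cases "0 \<le> t \<and> t \<le> T")
    case True
    have t0: "0 \<le> t" using True by simp
    note [measurable] = slice[OF i t0] U_slice_borel[OF i, of t]
    have "(LBINT x. ?e t x) = (LBINT x. X (t, x))"
    proof (rule integral_cong_AE)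
      show "AE x in lborel. ?e t x = X (t, x)"
        using U_AE[OF i, of t] True by (auto elim!: eventually_mono simp: X_def dt dx)
      show "(\<lambda>x. X (t, x)) \<in> borel_measurable lborel"
        using True unfolding X_def by (simp add: indicator_times)
    qed (use True in \<open>auto simp: dt dx\<close>)
    then show ?thesis using True by simp
  next
    case False
    then show ?thesis using support[of t] by (cases "0 \<le> t") (auto simp: X_def dt dx)
  qed
  then have X: "(LINT t:{0..}|lborel. (LBINT x. ?e t x))
      = (LBINT p. X p)"
    unfolding set_lebesgue_integral_def using lborel_pair.integral_fst'[of X] iX by (simp add: lborel_prod)
  have "indicator {0..} t *\<^sub>R (LBINT x. ?s t x)
      = (LBINT x. Y (t, x))" for t
  proof (cases "0 \<le> t \<and> t \<le> T")
    case True
    have t0: "0 \<le> t" using True by simp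
    note [measurable] = slice[OF i t0] U_slice_borel[OF i, of t]
    have lcm [measurable]: "(\<lambda>x. lane_change N v i (u i t x) (u (i + 1) t x)) \<in> borel_measurable lborel"
      "(\<lambda>x. lane_change N v (i - 1) (u (i - 1) t x) (u i t x)) \<in> borel_measurable lborel"
      "(\<lambda>x. lane_source N v i U (t, x)) \<in> borel_measurable lborel"
      using lane_change_measurable[where N = N and v = v and w = "\<lambda>i. u i t" and M = lborel, OF v_lipschitz ii(3)]
        lane_change_measurable[where N = N and v = v and w = "\<lambda>i. u i t" and M = lborel, OF v_lipschitz ii(2)] slice True ii(1)
        lane_source_measurable[where N = N and v = v and U = "\<lambda>i x. U i (t, x)" and M = lborel, OF v_lipschitz i] U_slice_borel
      by (auto simp: lane_source_def[abs_def])
    \<comment> \<open>For j = 0 and j = N both sides are 0, whatever the functions outside the lanes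
      1 to N are.\<close>
    have lc: "AE x in lborel. lane_change N v j (U j (t, x)) (U (j + 1) (t, x)) = lane_change N v j (u j t x) (u (j + 1) t x)" if "j \<le> N" for j
    proof (cases "j = 0 \<or> j = N")
      case True then show ?thesis by (auto simp: lane_change_def)
    next
      case False
      then have "j \<in> {1..N}" "j + 1 \<in> {1..N}" using that by auto
      with U_AE_all[of t] True show ?thesis by (auto elim!: eventually_mono)
    qed
    have "AE x in lborel. lane_source N v i U (t, x) =
       lane_change N v i (u i t x) (u (i + 1) t x) - lane_change N v (i - 1) (u (i - 1) t x) (u i t x)"
      using lc[OF ii(2)] lc[OF ii(3)] unfolding ii(1) by eventually_elim (simp add: lane_source_def)
    then have "(LBINT x. ?s t x)
      = (LBINT x. Y (t, x))"
    proof (intro integral_cong_AE)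
      assume "AE x in lborel. lane_source N v i U (t, x) =
         lane_change N v i (u i t x) (u (i + 1) t x) - lane_change N v (i - 1) (u (i - 1) t x) (u i t x)"
      moreover have "AE x in lborel. U i (t, x) = u i t x" using U_AE[OF i, of t] True by simp
      ultimately show "AE x in lborel. ?s t x
         = Y (t, x)"
        by eventually_elim (use True in \<open>simp add: Y_def\<close>)
      show "(\<lambda>x. Y (t, x)) \<in> borel_measurable lborel"
        using True unfolding Y_def by (simp add: indicator_times)
      show "(\<lambda>x. ?s t x)
        \<in> borel_measurable lborel"
        by (rule borel_measurable_times[OF borel_measurable_times[OF _ borel_measurable_diff[OF lcm(1,2)]]]) auto
    qed
    then show ?thesis using True by simp
  next
    case False
    then show ?thesis using support[of t] by (cases "0 \<le> t") (auto simp: Y_def)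
  qed
  then have Y: "(LINT t:{0..}|lborel. (LBINT x. ?s t x))
      = (LBINT p. Y p)"
    unfolding set_lebesgue_integral_def using lborel_pair.integral_fst'[of Y] iY by (simp add: lborel_prod)
  have "(LBINT p. X p) + (LBINT x. \<eta> (u0 i x) * (a 0 * b x)) \<ge> (LBINT p. Y p)"
    unfolding X[symmetric] Y[symmetric]
  proof -
    have "\<forall>t\<ge>0. \<forall>x. 0 \<le> a t * b x" using nonneg by simp
    with solution i \<eta>(1,2) q test
    show "(LINT t:{0..}|lborel. (LBINT x. ?e t x))
       + (LBINT x. \<eta> (u0 i x) * (a 0 * b x))
      \<ge> (LINT t:{0..}|lborel. (LBINT x. ?s t x))"
      unfolding entropy_solution_def by blast
  qed
  moreover have "(LBINT x. \<eta> (u0 i x) * (a 0 * b x)) = a 0 * (LBINT x. \<eta> (u0 i x) * b x)"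
    by (subst integral_mult_right_zero[symmetric]) (simp add: mult_ac)
  ultimately show "0 \<le> (LBINT p. ?Z p) + a 0 * (LBINT x. \<eta> (u0 i x) * b x)"
    unfolding Z using iX iY by simp
qed

end

section \<open>Kruzkov inequalities\<close>

text \<open>With \<open>sg = 1\<close> this belongs to the entropy \<open>(u - k)\<^sup>+\<close>, with \<open>sg = - 1\<close> to
  \<open>(k - u)\<^sup>+\<close>; \<open>a'\<close> and \<open>b'\<close> stand for the derivatives of \<open>a\<close> and \<open>b\<close>.\<close>

definition kruzkov_integrand ::
    "nat \<Rightarrow> (nat \<Rightarrow> real \<Rightarrow> real) \<Rightarrow> (nat \<Rightarrow> pt \<Rightarrow> real) \<Rightarrow> nat \<Rightarrow> real \<Rightarrow> real \<Rightarrow>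
     (real \<Rightarrow> real) \<Rightarrow> (real \<Rightarrow> real) \<Rightarrow> (real \<Rightarrow> real) \<Rightarrow> (real \<Rightarrow> real) \<Rightarrow> pt \<Rightarrow> real" where
  "kruzkov_integrand N v U i sg k a a' b b' p =
     max 0 (sg * (U i p - k)) * (a' (fst p) * b (snd p))
     + sg * heaviside (sg * (U i p - k)) *
         ((flux v i (U i p) - flux v i k) * (a (fst p) * b' (snd p))
          - lane_source N v i U p * (a (fst p) * b (snd p)))"

abbreviation (input) "mollified_integrand N v U i sg k h r e y \<equiv> kruzkov_integrand N v U i sg k
  (\<lambda>t. mollifier h (t - r)) (\<lambda>t. deriv (mollifier h) (t - r))
  (\<lambda>x. mollifier e (x - y)) (\<lambda>x. deriv (mollifier e) (x - y))"

text \<open>The interface to the doubling argument. The zero state satisfies it as well, so one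
  comparison serves positivity and contraction alike. The conditions on h and r keep the time
  mollifier supported inside (0, T), where no initial term arises.\<close>

definition kruzkov_family ::
    "nat \<Rightarrow> (nat \<Rightarrow> real \<Rightarrow> real) \<Rightarrow> real \<Rightarrow> (nat \<Rightarrow> pt \<Rightarrow> real) \<Rightarrow> bool" where
  "kruzkov_family N v T U \<longleftrightarrow> (\<forall>i\<in>{1..N}.
     U i \<in> borel_measurable borel \<and> (\<exists>M. \<forall>p. \<bar>U i p\<bar> \<le> M) \<and> integrable lborel (U i) \<and>
     (\<forall>t. integrable lborel (\<lambda>x. U i (t, x))) \<and>
     (\<forall>r. 0 < r \<longrightarrow> r < T \<longrightarrow> ((\<lambda>t. slice_dist (U i) t r) \<longlongrightarrow> 0) (at r)) \<and>
     (\<forall>sg\<in>{1, - 1}. \<forall>k h r e y. 0 < h \<longrightarrow> h < r \<longrightarrow> r + h < T \<longrightarrow> 0 < e \<longrightarrow>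
        0 \<le> (LBINT p. mollified_integrand N v U i sg k h r e y p)))"



lemma mollifier_shift:
  assumes "h > 0"
  shows "bump_function (\<lambda>x. mollifier h (x - r))" (is ?A)
    and "deriv (\<lambda>x. mollifier h (x - r)) = (\<lambda>x. deriv (mollifier h) (x - r))" (is ?B)
    and "integrable lborel (\<lambda>x. mollifier h (x - r))" (is ?C) "(LBINT x. mollifier h (x - r)) = 1"
    and "integrable lborel (\<lambda>x. deriv (mollifier h) (x - r))" (is ?D)
    and "(LBINT x. deriv (mollifier h) (x - r)) = 0"
proof -
  show 1: ?A
    using mollifier_bump_function[OF assms, of 1 "- r"] by simp
  show 2: ?B
    using mollifier_deriv(4)[OF assms] by (auto intro: DERIV_imp_deriv)
  show ?C ?D
    "(LBINT x. deriv (mollifier h) (x - r)) = 0"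
    using bump_function_integrable[OF 1] bump_function_integral_deriv(1)[OF 1] unfolding 2 by auto
  show "(LBINT x. mollifier h (x - r)) = 1"
    using integrable_translate(2)[OF bump_function_integrable(1)[OF mollifier(4)[OF assms]], of "- r"]
      mollifier(5)[OF assms] by simp
qed

text \<open>For a constant state every term contains the derivative of a mollifier, which has
  integral 0, and the zero state has no source.\<close>

lemma kruzkov_family_zero: "kruzkov_family N v T (\<lambda>i p. 0)"
  unfolding kruzkov_family_def
proof (intro ballI conjI allI impI)
  fix i sg k h r e y :: real
  fix j :: nat
  assume h: "0 < h" and e: "0 < e"
  have lc: "lane_source N v j (\<lambda>i p. 0) p = 0" for p :: "pt"
    by (simp add: lane_source_def lane_change_def)
  have 1: "(LBINT p. deriv (mollifier h) (fst p - r) * mollifier e (snd p - y)) = 0"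
    using integrable_tensor(2)[OF mollifier_shift(5)[OF h] mollifier_shift(3)[OF e]] mollifier_shift(6)[OF h] by simp
  have 2: "(LBINT p. mollifier h (fst p - r) * deriv (mollifier e) (snd p - y)) = 0"
    using integrable_tensor(2)[OF mollifier_shift(3)[OF h] mollifier_shift(5)[OF e]] mollifier_shift(6)[OF e] by simp
  have i1: "integrable lborel (\<lambda>p::pt. deriv (mollifier h) (fst p - r) * mollifier e (snd p - y))"
    by (rule integrable_tensor(1)[OF mollifier_shift(5)[OF h] mollifier_shift(3)[OF e]])
  have i2: "integrable lborel (\<lambda>p::pt. mollifier h (fst p - r) * deriv (mollifier e) (snd p - y))"
    by (rule integrable_tensor(1)[OF mollifier_shift(3)[OF h] mollifier_shift(5)[OF e]])
  have "(LBINT p. mollified_integrand N v (\<lambda>i p. 0) j sg k h r e y p)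
     = (LBINT p::pt. max 0 (sg * (0 - k)) * (deriv (mollifier h) (fst p - r) * mollifier e (snd p - y))
        + (sg * heaviside (sg * (0 - k)) * (flux v j 0 - flux v j k)) * (mollifier h (fst p - r) * deriv (mollifier e) (snd p - y)))"
    unfolding kruzkov_integrand_def lc by (simp add: mult.assoc)
  also have "\<dots> = max 0 (sg * (0 - k)) * 0 + (sg * heaviside (sg * (0 - k)) * (flux v j 0 - flux v j k)) * 0"
    by (subst Bochner_Integration.integral_add[OF integrable_mult_right[OF i1] integrable_mult_right[OF i2]])
       (simp add: 1 2)
  finally show "0 \<le> (LBINT p. mollified_integrand N v (\<lambda>i p. 0) j sg k h r e y p)" by simp
qed auto

context bounded_solution
begin

text \<open>Limit of the regularised entropies under dominated convergence. The support of a in (0,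
  T) removes the initial term and the restriction to t >= 0.\<close>

lemma kruzkov_inequality:
  assumes i: "i \<in> {1..N}" and sg: "sg \<in> {1, - 1}" and a: "bump_function a" and b: "bump_function b"
    and nonneg: "\<And>t. 0 \<le> a t" "\<And>x. 0 \<le> b x"
    and support: "\<And>t. t \<notin> {0<..<T} \<Longrightarrow> a t = 0 \<and> deriv a t = 0"
  shows "0 \<le> (LBINT p. kruzkov_integrand N v U i sg k a (deriv a) b (deriv b) p)"
proof -
  define M where "M = max (max (- lo) hi) \<bar>k\<bar>"
  have UM: "\<bar>U j p\<bar> \<le> M" for j p using U_bound[of j p] by (simp add: M_def)
  have kM: "\<bar>k\<bar> \<le> M" by (simp add: M_def)
  have M0: "M \<ge> 0" using kM by linarith
  define f where "f = flux v i"
  have flip: "\<exists>L. L-lipschitz_on {-r..r} f" for r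
    unfolding f_def by (rule flux_lipschitz) (rule v_lipschitz[OF i])
  obtain L where L: "L-lipschitz_on {-M..M} f" using flip by blast
  have L0: "L \<ge> 0" by (rule lipschitz_on_nonneg[OF L])
  obtain F where F: "F \<ge> 0" "\<And>x. \<bar>x\<bar> \<le> M \<Longrightarrow> \<bar>f x\<bar> \<le> F"
    using continuous_bounded_on_interval[OF lipschitz_isCont[OF flip], of "-M" M] by (auto simp: abs_le_iff)
  obtain C where C: "\<And>p. \<bar>lane_source N v i U p\<bar> \<le> C" using U_source_bounded[OF i] by blast
  define d where "d n = inverse (real (Suc n))" for n
  have d: "d n > 0" "d n \<le> 1" for n by (auto simp: d_def inverse_le_1_iff)
  have dlim: "d \<longlonglongrightarrow> 0" unfolding d_def[abs_def] by (rule LIMSEQ_inverse_real_of_nat)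
  define \<eta> where "\<eta> n x = soft_pos (d n) (sg * (x - k))" for n x
  have d\<eta>: "deriv (\<eta> n) = (\<lambda>x. sg * soft_step (d n) (sg * (x - k)))" for n
    unfolding \<eta>_def[abs_def] using soft_entropy(5)[OF d(1) sg] by blast
  have "\<forall>n. \<exists>q. entropy_flux (\<eta> n) f q \<and>
      (\<forall>x. \<bar>x\<bar> \<le> M \<longrightarrow> \<bar>q x - sg * soft_step (d n) (sg * (x - k)) * (f x - f k)\<bar> \<le> L * d n)"
    unfolding \<eta>_def[abs_def] using soft_entropy_flux[OF d(1) sg flip L kM] by blast
  then obtain q where q: "\<And>n. entropy_flux (\<eta> n) f (q n)"
    "\<And>n x. \<bar>x\<bar> \<le> M \<Longrightarrow> \<bar>q n x - sg * soft_step (d n) (sg * (x - k)) * (f x - f k)\<bar> \<le> L * d n"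
    by metis
  define Z where "Z n p = \<eta> n (U i p) * (deriv a (fst p) * b (snd p))
      + q n (U i p) * (a (fst p) * deriv b (snd p)) - deriv (\<eta> n) (U i p) * lane_source N v i U p * (a (fst p) * b (snd p))" for n p
  have ind: "indicator ({0..} \<times> UNIV) p * Z n p = Z n p" for n p
    using support[of "fst p"] by (cases "fst p \<ge> 0") (auto simp: Z_def indicator_def mem_Times_iff)
  have \<eta>p: "convex_on UNIV (\<eta> n)" "\<eta> n differentiable_on UNIV" for n
    using soft_entropy(3,4)[OF d(1)[of n] sg, of k] unfolding \<eta>_def[abs_def] by auto
  have \<eta>c: "isCont (deriv (\<eta> n)) x" for n x
    unfolding d\<eta> by (rule DERIV_isCont[OF soft_entropy(2)[OF d(1) sg]])
  have supp': "a t = 0 \<and> deriv a t = 0" if "T < t" for t using support[of t] that by auto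
  have iZ: "integrable lborel (Z n)" for n
    using entropy_inequality_plane(1)[OF i a b nonneg supp' \<eta>p \<eta>c q(1)[unfolded f_def]]
    unfolding Z_def[symmetric] ind by simp
  have a0: "a 0 = 0" using support[of 0] by simp
  have pZ: "0 \<le> (LBINT p. Z n p)" for n
    using entropy_inequality_plane(2)[OF i a b nonneg supp' \<eta>p \<eta>c q(1)[unfolded f_def]]
    unfolding Z_def[symmetric] ind a0 by simp
  note ia = bump_function_integrable[OF a] and ib = bump_function_integrable[OF b]
  note [measurable] = U_borel[OF i] bump_function_borel[OF a] bump_function_borel[OF b]
    isCont_borel[OF lipschitz_isCont[OF flip]]
  have [measurable]: "lane_source N v i U \<in> borel_measurable borel"
    by (rule lane_source_measurable[OF v_lipschitz i]) (auto intro: U_borel)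
  have sg1: "\<bar>sg\<bar> = 1" using sg by auto
  \<comment> \<open>|U - k| <= 2 M, and the regularisation adds at most d n <= 1. The entropy flux
    is within L d n <= L of a term bounded by 2 F.\<close>
  let ?w = "\<lambda>p::pt. (2 * M + 1) * \<bar>deriv a (fst p) * b (snd p)\<bar>
        + (2 * F + L) * \<bar>a (fst p) * deriv b (snd p)\<bar> + C * \<bar>a (fst p) * b (snd p)\<bar>"
  have "(\<lambda>n. LBINT p. Z n p) \<longlonglongrightarrow> (LBINT p. kruzkov_integrand N v U i sg k a (deriv a) b (deriv b) p)"
  proof (rule integral_dominated_convergence[where w = ?w])
    note [measurable] = borel_measurable_fst_snd(1)[OF bump_function_borel(1)[OF a]]
      borel_measurable_fst_snd(1)[OF bump_function_borel(2)[OF a]]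
      borel_measurable_fst_snd(2)[OF bump_function_borel(1)[OF b]]
      borel_measurable_fst_snd(2)[OF bump_function_borel(2)[OF b]]
    have "(\<lambda>p. kruzkov_integrand N v U i sg k a (deriv a) b (deriv b) p) \<in> borel_measurable borel"
      unfolding kruzkov_integrand_def f_def[symmetric] by measurable
    then show "(\<lambda>p. kruzkov_integrand N v U i sg k a (deriv a) b (deriv b) p) \<in> borel_measurable lborel"
      by simp
    show "Z n \<in> borel_measurable lborel" for n using iZ by auto
    show "integrable lborel ?w"
      by (intro Bochner_Integration.integrable_add integrable_mult_right integrable_abs integrable_tensor ia ib)
    show "AE p in lborel. norm (Z n p) \<le> ?w p" for n
    proof (rule AE_I2)
      fix p
      have "\<bar>sg * (U i p - k)\<bar> \<le> 2 * M" using UM[of i p] kM sg1 by (simp add: abs_mult)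
      then have 1: "\<bar>\<eta> n (U i p)\<bar> \<le> 2 * M + 1"
        using soft_pos_bound[OF d(1), of n "sg * (U i p - k)"] d(2)[of n] unfolding \<eta>_def by linarith
      have s: "\<bar>sg * soft_step (d n) (sg * (U i p - k))\<bar> \<le> 1"
        using soft_step_bounds[of "d n" "sg * (U i p - k)"] sg1 by (simp add: abs_mult)
      have "\<bar>f (U i p) - f k\<bar> \<le> 2 * F" using F(2)[OF UM[of i p]] F(2)[OF kM] by linarith
      then have "\<bar>sg * soft_step (d n) (sg * (U i p - k)) * (f (U i p) - f k)\<bar> \<le> 1 * (2 * F)"
        unfolding abs_mult[of "sg * soft_step (d n) (sg * (U i p - k))"] using s by (intro mult_mono) auto
      moreover have "L * d n \<le> L" using L0 d(2)[of n] by (simp add: mult_left_le)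
      ultimately have 2: "\<bar>q n (U i p)\<bar> \<le> 2 * F + L" using q(2)[OF UM[of i p], of n] by linarith
      have 3: "\<bar>deriv (\<eta> n) (U i p) * lane_source N v i U p\<bar> \<le> C"
        unfolding d\<eta> using mult_mono[OF s C[of p]] by (simp add: abs_mult)
      have "\<bar>Z n p\<bar> \<le> \<bar>\<eta> n (U i p)\<bar> * \<bar>deriv a (fst p) * b (snd p)\<bar> + \<bar>q n (U i p)\<bar> * \<bar>a (fst p) * deriv b (snd p)\<bar>
         + \<bar>deriv (\<eta> n) (U i p) * lane_source N v i U p\<bar> * \<bar>a (fst p) * b (snd p)\<bar>"
        unfolding Z_def abs_mult[symmetric] by linarith
      also have "\<dots> \<le> ?w p"
        by (intro add_mono mult_right_mono 1 2 3) auto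
      finally show "norm (Z n p) \<le> ?w p" by simp
    qed
    show "AE p in lborel. (\<lambda>n. Z n p) \<longlonglongrightarrow> kruzkov_integrand N v U i sg k a (deriv a) b (deriv b) p"
    proof (rule AE_I2)
      fix p
      have 1: "(\<lambda>n. \<eta> n (U i p)) \<longlonglongrightarrow> max 0 (sg * (U i p - k))"
      proof (rule LIM_zero_cancel, rule Lim_null_comparison[OF _ dlim], intro always_eventually allI)
        show "norm (\<eta> n (U i p) - max 0 (sg * (U i p - k))) \<le> d n" for n
          using soft_pos_bound[OF d(1)] unfolding \<eta>_def by simp
      qed
      have s: "(\<lambda>n. sg * soft_step (d n) (sg * (U i p - k))) \<longlonglongrightarrow> sg * heaviside (sg * (U i p - k))"
        by (intro tendsto_intros soft_step_tendsto dlim)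
      have "(\<lambda>n. q n (U i p) - sg * soft_step (d n) (sg * (U i p - k)) * (f (U i p) - f k)) \<longlonglongrightarrow> 0"
        by (rule Lim_null_comparison[OF _ tendsto_mult_right_zero[OF dlim, of L]], intro always_eventually allI)
           (simp only: real_norm_def q(2)[OF UM[of i p]])
      from tendsto_add[OF this tendsto_mult[OF s tendsto_const[of "f (U i p) - f k"]]]
      have 2: "(\<lambda>n. q n (U i p)) \<longlonglongrightarrow> sg * heaviside (sg * (U i p - k)) * (f (U i p) - f k)" by simp
      have "(\<lambda>n. Z n p) \<longlonglongrightarrow> max 0 (sg * (U i p - k)) * (deriv a (fst p) * b (snd p))
        + sg * heaviside (sg * (U i p - k)) * (f (U i p) - f k) * (a (fst p) * deriv b (snd p))
        - sg * heaviside (sg * (U i p - k)) * lane_source N v i U p * (a (fst p) * b (snd p))"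
        unfolding Z_def d\<eta> by (intro tendsto_intros 1 2 s)
      then show "(\<lambda>n. Z n p) \<longlonglongrightarrow> kruzkov_integrand N v U i sg k a (deriv a) b (deriv b) p"
        unfolding kruzkov_integrand_def f_def by (simp add: algebra_simps)
    qed
  qed
  then show ?thesis by (rule LIMSEQ_le_const) (use pZ in auto)
qed

lemma kruzkov_family_U: "kruzkov_family N v T U"
  unfolding kruzkov_family_def
proof (intro ballI conjI allI impI)
  fix i assume i: "i \<in> {1..N}"
  show "U i \<in> borel_measurable borel" "integrable lborel (U i)" using i U_borel U_integrable by auto
  show "integrable lborel (\<lambda>x. U i (t, x))" for t using i U_slice_integrable by auto
  show "\<exists>M. \<forall>p. \<bar>U i p\<bar> \<le> M" using U_bound by blast
  show "((\<lambda>t. slice_dist (U i) t r) \<longlongrightarrow> 0) (at r)" if r: "0 < r" "r < T" for r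
  proof -
    have "((\<lambda>s. L1_dist (u i s) (u i r)) \<longlongrightarrow> 0) (at r within {0<..<T})"
      by (rule tendsto_within_subset[OF u_L1_continuous[OF i]]) (use r in auto)
    then have "((\<lambda>s. L1_dist (u i s) (u i r)) \<longlongrightarrow> 0) (at r)"
      using r by (simp add: at_within_open[of r "{0<..<T}"])
    moreover have "eventually (\<lambda>t. t \<in> {0<..<T}) (at r)"
      using r by (intro eventually_at_in_open') auto
    then have "eventually (\<lambda>t. (L1_dist (u i t) (u i r)) = (slice_dist (U i) t r)) (at r)"
    proof eventually_elim
      case (elim t)
      have "AE x in lborel. U i (t, x) = u i t x" "AE x in lborel. U i (r, x) = u i r x"
        using U_AE[OF i] elim r by auto
      then have "AE x in lborel. \<bar>u i t x - u i r x\<bar> = \<bar>U i (t, x) - U i (r, x)\<bar>" by eventually_elim simp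
      then show ?case
        using u_integrable[OF i, of t] u_integrable[OF i, of r] elim r U_slice_borel[OF i]
        by (intro integral_cong_AE) auto
    qed
    ultimately show ?thesis by (rule Lim_transform_eventually)
  qed
  fix sg k h r e y :: real
  assume *: "sg \<in> {1, - 1}" "0 < h" "h < r" "r + h < T" "0 < e"
  have "0 \<le> (LBINT p. kruzkov_integrand N v U i sg k
               (\<lambda>t. mollifier h (t - r)) (deriv (\<lambda>t. mollifier h (t - r)))
               (\<lambda>x. mollifier e (x - y)) (deriv (\<lambda>x. mollifier e (x - y))) p)"
  proof (rule kruzkov_inequality[OF i *(1) mollifier_shift(1)[OF *(2)] mollifier_shift(1)[OF *(5)]])
    show "mollifier h (t - r) = 0 \<and> deriv (\<lambda>x. mollifier h (x - r)) t = 0" if "t \<notin> {0<..<T}" for t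
      unfolding mollifier_shift(2)[OF *(2)] using that *
      by (auto intro!: mollifier(3) mollifier_deriv(3))
  qed (use * in \<open>auto intro: mollifier(1)\<close>)
  then show "0 \<le> (LBINT p. mollified_integrand N v U i sg k h r e y p)"
    unfolding mollifier_shift(2)[OF *(2)] mollifier_shift(2)[OF *(5)] .
qed

end

section \<open>Doubling of variables\<close>

abbreviation (input) t1 :: "('a \<times> 'b) \<times> 'c \<Rightarrow> 'a" where "t1 P \<equiv> fst (fst P)"
abbreviation (input) x1 :: "('a \<times> 'b) \<times> 'c \<Rightarrow> 'b" where "x1 P \<equiv> snd (fst P)"
abbreviation (input) t2 :: "'c \<times> 'a \<times> 'b \<Rightarrow> 'a" where "t2 P \<equiv> fst (snd P)"
abbreviation (input) x2 :: "'c \<times> 'a \<times> 'b \<Rightarrow> 'b" where "x2 P \<equiv> snd (snd P)"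

abbreviation (input) "kern A B C P \<equiv> (A (t1 P) * (B (t2 P) * C (x1 P - x2 P)) :: real)"

lemma integrable_reflect:
  fixes C :: "real \<Rightarrow> real"
  assumes "integrable lborel C"
  shows "integrable lborel (\<lambda>y. C (x - y))" "(LBINT y. C (x - y)) = (LBINT y. C y)"
  using lborel_integrable_real_affine[OF assms, of "- 1" x] lborel_integral_real_affine[of "- 1" C x] by simp_all

lemma borel_measurable_diff_kernel:
  assumes "C \<in> borel_measurable borel"
  shows "(\<lambda>P::pt \<times> pt. C (x1 P - x2 P) :: real) \<in> borel_measurable borel"
proof -
  have "(\<lambda>P::pt \<times> pt. x1 P - x2 P) \<in> borel_measurable borel"
    by (auto intro!: borel_measurable_continuous_onI continuous_intros)
  from measurable_compose[OF this assms] show ?thesis .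
qed

text \<open>Integrating over the second point first, the translation in C disappears and only the
  integrals of B and C remain.\<close>

lemma integrable_kernel_fst:
  fixes g :: "pt \<Rightarrow> real" and B C :: "real \<Rightarrow> real"
  assumes g: "integrable lborel g" and B: "integrable lborel B" and C: "integrable lborel C"
  shows "integrable lborel (\<lambda>P. g (fst P) * (B (t2 P) * C (x1 P - x2 P)))" (is ?I)
    and "(LBINT P. g (fst P) * (B (t2 P) * C (x1 P - x2 P)))
          = (LBINT p. g p) * ((LBINT s. B s) * (LBINT z. C z))" (is ?E)
proof -
  have m: "g \<in> borel_measurable borel" "B \<in> borel_measurable borel" "C \<in> borel_measurable borel"
    using assms by auto
  have meas: "(\<lambda>P::pt \<times> pt. g (fst P) * (B (t2 P) * C (x1 P - x2 P))) \<in> borel_measurable borel"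
    by (intro borel_measurable_times borel_measurable_diff_kernel borel_measurable_fst_snd
          borel_measurable_fst_snd(1)[THEN borel_measurable_fst_snd(2)] m)
  note t = integrable_tensor[OF B integrable_reflect(1)[OF C]]
  note t' = integrable_tensor[OF integrable_abs[OF B] integrable_abs[OF integrable_reflect(1)[OF C]]]
  show ?I
  proof (rule lborel_Fubini_integrable[OF meas], intro disjI1 conjI allI)
    fix p show "integrable lborel (\<lambda>q. g (fst (p, q)) * (B (fst (snd (p, q))) * C (snd (fst (p, q)) - snd (snd (p, q)))))"
      using integrable_mult_right[OF t(1), of "g p" "snd p"] by simp
  next
    have "(LBINT q. \<bar>g (fst (p, q)) * (B (fst (snd (p, q))) * C (snd (fst (p, q)) - snd (snd (p, q))))\<bar>)
       = \<bar>g p\<bar> * ((LBINT s. \<bar>B s\<bar>) * (LBINT z. \<bar>C z\<bar>))" for p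
      using t'(2)[of "snd p"] integrable_reflect(2)[OF integrable_abs[OF C], of "snd p"]
      by (simp add: abs_mult)
    then show "integrable lborel (\<lambda>p. LBINT q. \<bar>g (fst (p, q)) * (B (fst (snd (p, q))) * C (snd (fst (p, q)) - snd (snd (p, q))))\<bar>)"
      using g by simp
  qed
  from lborel_Fubini(1)[OF this] show ?E
    using t(2) integrable_reflect(2)[OF C] by simp
qed

text \<open>Swapping the two points reflects C, which leaves its integral unchanged.\<close>

lemma integrable_kernel_snd:
  fixes g :: "pt \<Rightarrow> real" and A C :: "real \<Rightarrow> real"
  assumes g: "integrable lborel g" and A: "integrable lborel A" and C: "integrable lborel C"
  shows "integrable lborel (\<lambda>P. g (snd P) * (A (t1 P) * C (x1 P - x2 P)))" (is ?A)
    and "(LBINT P. g (snd P) * (A (t1 P) * C (x1 P - x2 P))) = (LBINT p. g p) * ((LBINT s. A s) * (LBINT z. C z))" (is ?B)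
proof -
  have C': "integrable lborel (\<lambda>z. C (- z))" "(LBINT z. C (- z)) = (LBINT z. C z)"
    using integrable_reflect[OF C, of 0] by simp_all
  note k = integrable_kernel_fst[OF g A C'(1)]
  show ?A
    ?B
    using lborel_swap[OF k(1)] k(2) C'(2) by simp_all
qed

text \<open>The kernel does not decay along the diagonal x = y; integrability in that direction
  comes from g and g'. The majorant is split accordingly: g absorbs the bounded A and is integrated
  against B and C, while g' absorbs the bounded B and is integrated against A and C.\<close>

lemma integrable_weighted:
  fixes G :: "pt \<times> pt \<Rightarrow> real"
  assumes G: "G \<in> borel_measurable borel" and le: "\<And>p q. \<bar>G (p, q)\<bar> \<le> c * (g p + g' q)"
    and g: "integrable lborel g" "integrable lborel g'"
    and A: "integrable lborel A" "\<And>t. \<bar>A t\<bar> \<le> a"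
    and B: "integrable lborel B" "\<And>t. \<bar>B t\<bar> \<le> b" and C: "integrable lborel C"
  shows "integrable lborel (\<lambda>P. G P * kern A B C P)"
proof (rule Bochner_Integration.integrable_bound)
  let ?w = "\<lambda>P::pt \<times> pt. \<bar>c * ((A (t1 P) * g (fst P)) * (B (t2 P) * C (x1 P - x2 P)))\<bar>
      + \<bar>c * ((B (t2 P) * g' (snd P)) * (A (t1 P) * C (x1 P - x2 P)))\<bar>"
  let ?K = "\<lambda>P::pt \<times> pt. kern A B C P"
  have Am: "A \<in> borel_measurable borel" "B \<in> borel_measurable borel" using A B by auto
  have gA: "integrable lborel (\<lambda>p. A (fst p) * g p)" and gB: "integrable lborel (\<lambda>p. B (fst p) * g' p)"
    using borel_measurable_fst_snd(1)[OF Am(1)] borel_measurable_fst_snd(1)[OF Am(2)] A(2) B(2) g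
    by (auto intro!: integrable_bounded_mult)
  show "integrable lborel ?w"
    by (intro Bochner_Integration.integrable_add integrable_abs integrable_mult_right
          integrable_kernel_fst(1)[OF gA B(1) C] integrable_kernel_snd(1)[OF gB A(1) C])
  have "?K \<in> borel_measurable borel"
    using A B C
    by (intro borel_measurable_times borel_measurable_diff_kernel
          borel_measurable_fst_snd(1)[THEN borel_measurable_fst_snd(1)] borel_measurable_fst_snd(1)[THEN borel_measurable_fst_snd(2)]) auto
  then show "(\<lambda>P. G P * ?K P) \<in> borel_measurable lborel" using G by simp
  show "AE P in lborel. norm (G P * ?K P) \<le> norm (?w P)"
  proof (rule AE_I2)
    fix P :: "pt \<times> pt"
    have "\<bar>G P * ?K P\<bar> \<le> \<bar>c * (g (fst P) + g' (snd P))\<bar> * \<bar>?K P\<bar>"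
      unfolding abs_mult[of "G P"] using le[of "fst P" "snd P"] by (intro mult_right_mono) auto
    also have "\<dots> = \<bar>c * g (fst P) * ?K P + c * g' (snd P) * ?K P\<bar>"
      by (simp add: abs_mult[symmetric] algebra_simps)
    also have "\<dots> \<le> \<bar>c * g (fst P) * ?K P\<bar> + \<bar>c * g' (snd P) * ?K P\<bar>" by (rule abs_triangle_ineq)
    finally show "norm (G P * ?K P) \<le> norm (?w P)"
      by (simp add: mult_ac)
  qed
qed

lemma sum_by_parts_source:
  fixes c s :: "nat \<Rightarrow> real"
  shows "(\<Sum>i=1..n. c i * (s i - s (i - 1))) = c (n + 1) * s n - c 1 * s 0 + (\<Sum>i=1..n. (c i - c (i + 1)) * s i)"
  by (induction n) (auto simp: algebra_simps)

text \<open>\<open>exchange\<close> is the condition linking lane changes and comparison, and it is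
  required at all pairs of points. The instances are (zero state, solution) for positivity and two
  solutions in both orders for the contraction.\<close>

locale kruzkov_pair =
  fixes N :: nat and v :: "nat \<Rightarrow> real \<Rightarrow> real" and T :: real
    and U V :: "nat \<Rightarrow> pt \<Rightarrow> real"
  assumes v_lipschitz: "\<And>i. i \<in> {1..N} \<Longrightarrow> \<exists>L. L-lipschitz_on UNIV (v i)"
    and U: "kruzkov_family N v T U" and V: "kruzkov_family N v T V"
    and exchange: "\<And>i p q. i \<in> {1..<N} \<Longrightarrow>
      0 \<le> (heaviside (U i p - V i q) - heaviside (U (i + 1) p - V (i + 1) q)) *
           (lane_change N v i (U i p) (U (i + 1) p) - lane_change N v i (V i q) (V (i + 1) q))"
begin

text \<open>Abel summation over the lanes: the boundary conditions remove the end terms, and each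
  remaining term is an instance of \<open>exchange\<close>.\<close>

lemma source_sign:
  "0 \<le> (\<Sum>i=1..N. heaviside (U i p - V i q) * (lane_source N v i U p - lane_source N v i V q))"
proof -
  define c where "c i = heaviside (U i p - V i q)" for i
  define s where "s i = lane_change N v i (U i p) (U (i + 1) p) - lane_change N v i (V i q) (V (i + 1) q)" for i
  have s0: "s 0 = 0" "s N = 0" by (simp_all add: s_def lane_change_def)
  have "(\<Sum>i=1..N. c i * (lane_source N v i U p - lane_source N v i V q)) = (\<Sum>i=1..N. c i * (s i - s (i - 1)))"
    by (intro sum.cong refl) (auto simp: s_def lane_source_def)
  also have "\<dots> = (\<Sum>i=1..N. (c i - c (i + 1)) * s i)"
    using sum_by_parts_source[of c s N] s0 by simp
  also have "\<dots> \<ge> 0"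
  proof (rule sum_nonneg)
    fix i assume "i \<in> {1..N}"
    then consider "i = N" | "i \<in> {1..<N}" by force
    then show "0 \<le> (c i - c (i + 1)) * s i"
      using s0 exchange[of i p q] by cases (auto simp: c_def s_def)
  qed
  finally show ?thesis by (simp add: c_def)
qed

definition excess :: "nat \<Rightarrow> pt \<times> pt \<Rightarrow> real" where
  "excess i P = max 0 (U i (fst P) - V i (snd P))"

lemma regular:
  assumes "i \<in> {1..N}"
  shows "U i \<in> borel_measurable borel" "V i \<in> borel_measurable borel"
    "integrable lborel (U i)" "integrable lborel (V i)"
    "integrable lborel (\<lambda>x. U i (t, x))" "integrable lborel (\<lambda>x. V i (t, x))"
  using U V assms unfolding kruzkov_family_def by blast+

lemma uniform_bound: "\<exists>M. \<forall>i\<in>{1..N}. \<forall>p. \<bar>U i p\<bar> \<le> M \<and> \<bar>V i p\<bar> \<le> M"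
proof -
  have "\<forall>i\<in>{1..N}. \<exists>M. \<forall>p. \<bar>U i p\<bar> \<le> M \<and> \<bar>V i p\<bar> \<le> M"
  proof
    fix i assume i: "i \<in> {1..N}"
    obtain M1 M2 where "\<And>p. \<bar>U i p\<bar> \<le> M1" "\<And>p. \<bar>V i p\<bar> \<le> M2"
      using U V i unfolding kruzkov_family_def by metis
    then show "\<exists>M. \<forall>p. \<bar>U i p\<bar> \<le> M \<and> \<bar>V i p\<bar> \<le> M"
      by (intro exI[of _ "max M1 M2"]) (simp add: le_max_iff_disj)
  qed
  then obtain M where M: "\<And>i p. i \<in> {1..N} \<Longrightarrow> \<bar>U i p\<bar> \<le> M i \<and> \<bar>V i p\<bar> \<le> M i" by metis
  have "M i \<le> Max (M ` {1..N})" if "i \<in> {1..N}" for i using that by auto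
  then show ?thesis using M by (meson order_trans)
qed

lemma excess_bound: "\<bar>excess i (p, q)\<bar> \<le> 1 * (\<bar>U i p\<bar> + \<bar>V i q\<bar>)"
  by (auto simp: excess_def)

lemma excess_borel: "i \<in> {1..N} \<Longrightarrow> excess i \<in> borel_measurable borel"
  unfolding excess_def[abs_def] using regular(1,2)
  by (intro borel_measurable_max borel_measurable_diff borel_measurable_fst_snd) auto

lemma mollifier_bounds:
  assumes "h > 0"
  shows "\<exists>B. \<forall>t. \<bar>mollifier h (t - r)\<bar> \<le> B \<and> \<bar>deriv (mollifier h) (t - r)\<bar> \<le> B"
  using bump_function_bounded[OF mollifier(4)[OF assms]] by blast

lemma doubled_inequality:
  assumes h: "0 < h" "h < r" "r + h < T" and e: "0 < e"
  shows "0 \<le> (LBINT P. (\<Sum>i=1..N. excess i P) *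
     ((deriv (mollifier h) (t1 P - r) * mollifier h (t2 P - r)
       + mollifier h (t1 P - r) * deriv (mollifier h) (t2 P - r))
      * mollifier e (x1 P - x2 P)))"
proof -
  define k where "k t = mollifier h (t - r)" for t
  define k' where "k' t = deriv (mollifier h) (t - r)" for t
  define om where "om = mollifier e"
  define om' where "om' = deriv (mollifier e)"
  have even: "om (x - y) = om (y - x)" "om' (x - y) = - om' (y - x)" for x y
    using mollifier(2)[OF e, of "y - x"] mollifier_deriv(1)[OF e, of "y - x"] by (simp_all add: om_def om'_def)
  have k0: "k t \<ge> 0" for t unfolding k_def by (rule mollifier(1)[OF h(1)])
  have om0: "om t \<ge> 0" for t unfolding om_def by (rule mollifier(1)[OF e])
  note int = mollifier_shift(3,5)[OF h(1), of r, folded k_def k'_def]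
    bump_function_integrable[OF mollifier(4)[OF e], folded om_def om'_def]
  obtain B where B: "\<And>t. \<bar>k t\<bar> \<le> B" "\<And>t. \<bar>k' t\<bar> \<le> B"
    using mollifier_bounds[OF h(1), of r] unfolding k_def k'_def by blast
  obtain M where M: "\<And>i p. i \<in> {1..N} \<Longrightarrow> \<bar>U i p\<bar> \<le> M" "\<And>i p. i \<in> {1..N} \<Longrightarrow> \<bar>V i p\<bar> \<le> M"
    using uniform_bound by blast
  define gU where "gU p = (\<Sum>j=1..N. \<bar>U j p\<bar>)" for p
  define gV where "gV p = (\<Sum>j=1..N. \<bar>V j p\<bar>)" for p
  have gint: "integrable lborel gU" "integrable lborel gV"
    unfolding gU_def[abs_def] gV_def[abs_def]
    by (intro Bochner_Integration.integrable_sum integrable_abs regular; simp)+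
  have gle: "\<bar>U i p\<bar> \<le> gU p" "\<bar>V i p\<bar> \<le> gV p" if "i \<in> {1..N}" for i p
    unfolding gU_def gV_def using that by (intro member_le_sum; simp)+
  have g0: "0 \<le> gU p" "0 \<le> gV p" for p by (simp_all add: gU_def gV_def sum_nonneg)
  define H where "H i P = heaviside (U i (fst P) - V i (snd P))" for i and P :: "pt \<times> pt"
  define F where "F i P = H i P * (flux v i (U i (fst P)) - flux v i (V i (snd P)))" for i P
  define SU where "SU i P = H i P * lane_source N v i U (fst P)" for i P
  define SV where "SV i P = H i P * lane_source N v i V (snd P)" for i P
  define K where "K A B C P = kern A B C P"
    for A B C :: "real \<Rightarrow> real" and P :: "pt \<times> pt"
  \<comment> \<open>A single form of majorant for all terms, so that \<open>wi\<close> settles every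
    integrability question.\<close>
  let ?dom = "\<lambda>G. \<exists>c. \<forall>p q. \<bar>G (p, q) :: real\<bar> \<le> c * (gU p + gV q)"
  have wi: "integrable lborel (\<lambda>P. G P * K a b c P)"
    if G: "G \<in> borel_measurable borel" "?dom G"
      and abc: "a \<in> {k, k'}" "b \<in> {k, k'}" "c \<in> {om, om'}" for G a b c
  proof -
    obtain c0 where c0: "\<And>p q. \<bar>G (p, q)\<bar> \<le> c0 * (gU p + gV q)" using G(2) by blast
    have ab: "integrable lborel a" "\<And>t. \<bar>a t\<bar> \<le> B" "integrable lborel b" "\<And>t. \<bar>b t\<bar> \<le> B" "integrable lborel c"
      using abc B int by auto
    show ?thesis
      unfolding K_def by (rule integrable_weighted[OF G(1) c0 gint ab])
  qed
  have integrability: "excess i \<in> borel_measurable borel" "?dom (excess i)"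
    "F i \<in> borel_measurable borel" "?dom (F i)"
    "SU i \<in> borel_measurable borel" "?dom (SU i)"
    "SV i \<in> borel_measurable borel" "?dom (SV i)"
    if i: "i \<in> {1..N}" for i
  proof -
    have Hb: "\<bar>H i P * z\<bar> \<le> \<bar>z\<bar>" for P z
      unfolding H_def abs_mult using heaviside_bounds(3) by (simp add: mult_left_le_one_le)
    have [measurable]: "(\<lambda>P::pt \<times> pt. U i (fst P)) \<in> borel_measurable borel"
      "(\<lambda>P::pt \<times> pt. V i (snd P)) \<in> borel_measurable borel"
      using regular[OF i] by (auto intro: borel_measurable_fst_snd)
    have Hm [measurable]: "H i \<in> borel_measurable borel" unfolding H_def[abs_def] by measurable
    have "isCont (flux v i) x" for x
      by (rule lipschitz_isCont, rule flux_lipschitz, rule v_lipschitz[OF i])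
    note [measurable] = isCont_borel[OF this]
    show "excess i \<in> borel_measurable borel" by (rule excess_borel[OF i])
    show "?dom (excess i)"
      using excess_bound[of i] gle[OF i] by (intro exI[of _ 1]) (smt (verit, best))
    show "F i \<in> borel_measurable borel" unfolding F_def[abs_def] by measurable
    obtain c where c: "c \<ge> 0" "\<And>a. \<bar>a\<bar> \<le> M \<Longrightarrow> \<bar>flux v i a\<bar> \<le> c * \<bar>a\<bar>"
      using flux_bound[where N = N and v = v and M = M, OF v_lipschitz i] by blast
    have "\<bar>F i (p, q)\<bar> \<le> c * (gU p + gV q)" for p q
    proof -
      have "\<bar>F i (p, q)\<bar> \<le> \<bar>flux v i (U i p)\<bar> + \<bar>flux v i (V i q)\<bar>"
        unfolding F_def using Hb[of "(p, q)"] abs_triangle_ineq4 by (force intro: order_trans)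
      also have "\<dots> \<le> c * \<bar>U i p\<bar> + c * \<bar>V i q\<bar>" using c(2) M[OF i] by (intro add_mono) auto
      also have "\<dots> \<le> c * gU p + c * gV q" using gle[OF i] c(1) by (intro add_mono mult_left_mono) auto
      finally show ?thesis by (simp add: distrib_left)
    qed
    then show "?dom (F i)" by blast
    obtain c1 where c1: "c1 \<ge> 0" "\<And>p. \<bar>lane_source N v i U p\<bar> \<le> c1 * gU p"
      using lane_source_bound[where N = N and v = v and U = U and M = M, OF v_lipschitz i] M(1)
      unfolding gU_def by blast
    have "\<bar>SU i (p, q)\<bar> \<le> c1 * (gU p + gV q)" for p q
      using Hb[of "(p, q)" "lane_source N v i U p"] c1(2)[of p] mult_nonneg_nonneg[OF c1(1) g0(2)[of q]]
      unfolding SU_def by (simp add: distrib_left)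
    then show "?dom (SU i)" by blast
    obtain c2 where c2: "c2 \<ge> 0" "\<And>p. \<bar>lane_source N v i V p\<bar> \<le> c2 * gV p"
      using lane_source_bound[where N = N and v = v and U = V and M = M, OF v_lipschitz i] M(2)
      unfolding gV_def by blast
    have "\<bar>SV i (p, q)\<bar> \<le> c2 * (gU p + gV q)" for p q
      using Hb[of "(p, q)" "lane_source N v i V q"] c2(2)[of q] mult_nonneg_nonneg[OF c2(1) g0(1)[of p]]
      unfolding SV_def by (simp add: distrib_left)
    then show "?dom (SV i)" by blast
    have "lane_source N v i U \<in> borel_measurable borel" "lane_source N v i V \<in> borel_measurable borel"
      by (rule lane_source_measurable[OF v_lipschitz i]; simp add: regular)+
    then show "SU i \<in> borel_measurable borel" "SV i \<in> borel_measurable borel"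
      unfolding SU_def[abs_def] SV_def[abs_def]
      by (intro borel_measurable_times Hm borel_measurable_fst_snd; simp)+
  qed
  define g1 where "g1 i P = excess i P * K k' k om P + F i P * K k k om' P - SU i P * K k k om P" for i P
  define g2 where "g2 i P = excess i P * K k k' om P - F i P * K k k om' P + SV i P * K k k om P" for i P
  have ig1: "integrable lborel (g1 i)" if "i \<in> {1..N}" for i
    unfolding g1_def[abs_def] using integrability[OF that]
    by (intro integrable_arith wi) auto
  have ig2: "integrable lborel (g2 i)" if "i \<in> {1..N}" for i
    unfolding g2_def[abs_def] using integrability[OF that]
    by (intro integrable_arith wi) auto
  have p1: "0 \<le> (LBINT P. g1 i P)" if i: "i \<in> {1..N}" for i
    unfolding lborel_Fubini(2)[OF ig1[OF i]]
  proof (rule Bochner_Integration.integral_nonneg)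
    fix q
    \<comment> \<open>With q frozen, \<open>V i q\<close> is the Kruzkov constant and k (fst q) a
      nonnegative factor.\<close>
    have "g1 i (p, q) = k (fst q) * kruzkov_integrand N v U i 1 (V i q) k k'
        (\<lambda>x. om (x - snd q)) (\<lambda>x. om' (x - snd q)) p" for p
      by (simp add: g1_def kruzkov_integrand_def K_def F_def SU_def H_def excess_def algebra_simps)
    moreover have "0 \<le> (LBINT p. kruzkov_integrand N v U i 1 (V i q) k k'
        (\<lambda>x. om (x - snd q)) (\<lambda>x. om' (x - snd q)) p)"
      using U i h e unfolding kruzkov_family_def k_def k'_def om_def om'_def by blast
    ultimately show "0 \<le> (LBINT p. g1 i (p, q))" using k0 by simp
  qed
  have p2: "0 \<le> (LBINT P. g2 i P)" if i: "i \<in> {1..N}" for i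
    unfolding lborel_Fubini(1)[OF ig2[OF i]]
  proof (rule Bochner_Integration.integral_nonneg)
    fix p
    \<comment> \<open>With p frozen, \<open>sg = - 1\<close> reproduces the same Heaviside factor,
      and the odd \<open>om'\<close> seen from the other variable reverses the sign of the flux
      kernel.\<close>
    have "g2 i (p, q) = k (fst p) * kruzkov_integrand N v V i (- 1) (U i p) k k'
        (\<lambda>x. om (x - snd p)) (\<lambda>x. om' (x - snd p)) q" for q
      by (simp add: g2_def kruzkov_integrand_def K_def F_def SV_def H_def excess_def
            even[of "snd p" "snd q"] algebra_simps)
    moreover have "0 \<le> (LBINT q. kruzkov_integrand N v V i (- 1) (U i p) k k'
        (\<lambda>x. om (x - snd p)) (\<lambda>x. om' (x - snd p)) q)"
      using V i h e unfolding kruzkov_family_def k_def k'_def om_def om'_def by blast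
    ultimately show "0 \<le> (LBINT q. g2 i (p, q))" using k0 by simp
  qed
  have "0 \<le> (\<Sum>i=1..N. (LBINT P. g1 i P) + (LBINT P. g2 i P))"
    using p1 p2 by (intro sum_nonneg) auto
  also have "\<dots> = (LBINT P. (\<Sum>i=1..N. g1 i P + g2 i P))"
    using ig1 ig2 by (subst Bochner_Integration.integral_sum) auto
  also have "\<dots> \<le> (LBINT P. (\<Sum>i=1..N. excess i P * K k' k om P + excess i P * K k k' om P))"
  proof (rule integral_mono)
    show "integrable lborel (\<lambda>P. \<Sum>i=1..N. g1 i P + g2 i P)" using ig1 ig2 by auto
    show "integrable lborel (\<lambda>P. \<Sum>i=1..N. excess i P * K k' k om P + excess i P * K k k' om P)"
      using integrability by (intro Bochner_Integration.integrable_sum Bochner_Integration.integrable_add wi) auto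
    fix P
    \<comment> \<open>The \<open>om'\<close> terms cancel lane by lane. The sources are dropped only
      after summation, since the contribution of a single lane has no fixed sign.\<close>
    have "(\<Sum>i=1..N. g1 i P + g2 i P) = (\<Sum>i=1..N. excess i P * K k' k om P + excess i P * K k k' om P)
       - (\<Sum>i=1..N. (SU i P - SV i P)) * K k k om P"
      unfolding sum_distrib_right sum_subtractf[symmetric]
      by (intro sum.cong refl) (simp add: g1_def g2_def algebra_simps)
    moreover have "0 \<le> (\<Sum>i=1..N. (SU i P - SV i P))"
      using source_sign[of "fst P" "snd P"] by (simp add: SU_def SV_def H_def right_diff_distrib)
    moreover have "0 \<le> K k k om P" unfolding K_def using k0 om0 by simp
    ultimately show "(\<Sum>i=1..N. g1 i P + g2 i P) \<le> (\<Sum>i=1..N. excess i P * K k' k om P + excess i P * K k k' om P)"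
      by simp
  qed
  also have "\<dots> = (LBINT P. (\<Sum>i=1..N. excess i P) *
     ((k' (t1 P) * k (t2 P) + k (t1 P) * k' (t2 P)) * om (x1 P - x2 P)))"
    unfolding sum_distrib_right
    by (intro Bochner_Integration.integral_cong sum.cong refl) (simp add: K_def algebra_simps)
  finally show ?thesis unfolding k_def k'_def om_def .
qed

end

section \<open>Merging the variables\<close>

text \<open>Serves the spatial modulus, where the times enter only through the weights A and
  B.\<close>

lemma integrable_kernel_space:
  fixes \<phi> :: "pt \<Rightarrow> real" and A B :: "real \<Rightarrow> real"
  assumes \<phi>: "integrable lborel \<phi>" "\<And>x. integrable lborel (\<lambda>y. \<phi> (x, y))"
    and A: "integrable lborel A" and B: "integrable lborel B"
  shows "integrable lborel (\<lambda>P. A (t1 P) * (B (t2 P) * \<phi> (x1 P, x2 P)))" (is ?I)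
    and "(LBINT P. A (t1 P) * (B (t2 P) * \<phi> (x1 P, x2 P)))
          = (LBINT t. A t) * ((LBINT s. B s) * (LBINT p. \<phi> p))" (is ?E)
proof -
  have m: "A \<in> borel_measurable borel" "B \<in> borel_measurable borel" "\<phi> \<in> borel_measurable borel"
    using assms by auto
  have "(\<lambda>P::pt \<times> pt. (x1 P, x2 P)) \<in> borel_measurable borel"
    by (auto intro!: borel_measurable_continuous_onI continuous_intros)
  from measurable_compose[OF this m(3)]
  have meas: "(\<lambda>P::pt \<times> pt. A (t1 P) * (B (t2 P) * \<phi> (x1 P, x2 P))) \<in> borel_measurable borel"
    by (intro borel_measurable_times borel_measurable_fst_snd(1)[THEN borel_measurable_fst_snd(1)]
          borel_measurable_fst_snd(1)[THEN borel_measurable_fst_snd(2)] m)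
  note t = integrable_tensor[OF B \<phi>(2)]
  note t' = integrable_tensor[OF integrable_abs[OF B] integrable_abs[OF \<phi>(2)]]
  show ?I
  proof (rule lborel_Fubini_integrable[OF meas], intro disjI1 conjI allI)
    fix p :: "pt"
    show "integrable lborel (\<lambda>q. A (fst (fst (p, q))) * (B (fst (snd (p, q))) * \<phi> (snd (fst (p, q)), snd (snd (p, q)))))"
      using integrable_mult_right[OF t(1), of "A (fst p)" "snd p"] by simp
  next
    have "(LBINT q. \<bar>A (fst (fst (p, q))) * (B (fst (snd (p, q))) * \<phi> (snd (fst (p, q)), snd (snd (p, q))))\<bar>)
       = (\<bar>A (fst p)\<bar> * (LBINT y. \<bar>\<phi> (snd p, y)\<bar>)) * (LBINT s. \<bar>B s\<bar>)" for p :: "pt"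
      using t'(2)[of "snd p"] by (simp add: abs_mult)
    moreover have "integrable lborel (\<lambda>p. \<bar>A (fst p)\<bar> * (LBINT y. \<bar>\<phi> (snd p, y)\<bar>))"
      using lborel_Fubini(3)[OF integrable_abs[OF \<phi>(1)]] by (intro integrable_tensor(1) integrable_abs A) auto
    ultimately show "integrable lborel (\<lambda>p. LBINT q. \<bar>A (fst (fst (p, q))) * (B (fst (snd (p, q))) * \<phi> (snd (fst (p, q)), snd (snd (p, q))))\<bar>)"
      by simp
  qed
  from lborel_Fubini(1)[OF this]
  have "(LBINT P. A (t1 P) * (B (t2 P) * \<phi> (x1 P, x2 P)))
      = (LBINT p. (A (fst p) * (LBINT y. \<phi> (snd p, y))) * (LBINT s. B s))"
    using t(2) by (simp add: mult_ac)
  also have "\<dots> = (LBINT t. A t) * (LBINT x. LBINT y. \<phi> (x, y)) * (LBINT s. B s)"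
    using integrable_tensor(2)[OF A lborel_Fubini(3)[OF \<phi>(1)]] by simp
  finally show ?E using lborel_Fubini(1)[OF \<phi>(1)] by simp
qed

text \<open>Four orders of the factors, matching the forms in which the integrability facts
  arise.\<close>

lemma abs_diff_weight:
  fixes a b w :: real
  assumes "w \<ge> 0"
  shows "\<bar>a - b\<bar> * w = \<bar>a * w - b * w\<bar>" (is ?A) "\<bar>a - b\<bar> * w = \<bar>w * a - w * b\<bar>" (is ?B)
    "\<bar>a - b\<bar> * w = \<bar>w * a - b * w\<bar>" (is ?C) "\<bar>a - b\<bar> * w = \<bar>a * w - w * b\<bar>" (is ?D)
proof -
  show 1: ?A
    unfolding left_diff_distrib[symmetric] abs_mult using assms by simp
  show ?B ?C ?D
    unfolding 1 by (simp_all only: mult.commute[of w])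
qed

text \<open>The substitution x = y + z turns the integral into an average of
  \<open>shift_dist f z\<close> with weight \<open>mollifier e z\<close>, which has mass 1 and
  vanishes for |z| >= e.\<close>

lemma L1_modulus_mollified:
  fixes f :: "real \<Rightarrow> real"
  assumes f: "integrable lborel f" and e: "e > 0"
    and modulus: "\<And>z. \<bar>z\<bar> < e \<Longrightarrow> shift_dist f z \<le> \<eta>"
  shows "integrable lborel (\<lambda>p. \<bar>f (snd p) - f (fst p)\<bar> * mollifier e (fst p - snd p))" (is ?I)
    and "(LBINT p. \<bar>f (snd p) - f (fst p)\<bar> * mollifier e (fst p - snd p)) \<le> \<eta>" (is ?E)
    and "integrable lborel (\<lambda>y. \<bar>f y - f x\<bar> * mollifier e (x - y))" (is ?A)
proof -
  define om where "om = mollifier e"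
  note omi = bump_function_integrable(1)[OF mollifier(4)[OF e], folded om_def]
  have om0: "om z \<ge> 0" for z unfolding om_def by (rule mollifier(1)[OF e])
  obtain B where B: "\<And>z. \<bar>om z\<bar> \<le> B"
    using bump_function_bounded[OF mollifier(4)[OF e]] unfolding om_def by blast
  have m: "f \<in> borel_measurable borel" "om \<in> borel_measurable borel" using f omi by auto
  have "(\<lambda>p::pt. fst p - snd p) \<in> borel_measurable borel" "(\<lambda>p::pt. fst p + snd p) \<in> borel_measurable borel"
    by (auto intro!: borel_measurable_continuous_onI continuous_intros)
  note md = measurable_compose[OF this(1) m(2)] and ma = measurable_compose[OF this(2) m(1)]
  have oms: "integrable lborel (\<lambda>x. om (x - y))" "(LBINT x. om (x - y)) = 1" for y
    using mollifier_shift(3,4)[OF e] by (simp_all add: om_def)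
  have fx: "integrable lborel (\<lambda>p. f (fst p) * om (fst p - snd p))"
    using m md f integrable_reflect[OF omi]
    by (intro lborel_Fubini_integrable disjI1 conjI allI borel_measurable_times borel_measurable_fst_snd)
       (auto simp: abs_mult om0)
  have fy: "integrable lborel (\<lambda>p. f (snd p) * om (fst p - snd p))"
    using m md f oms
    by (intro lborel_Fubini_integrable disjI2 conjI allI borel_measurable_times borel_measurable_fst_snd)
       (auto simp: abs_mult om0)
  define \<phi> where "\<phi> p = \<bar>f (snd p) - f (fst p)\<bar> * om (fst p - snd p)" for p
  have \<phi>m: "\<phi> \<in> borel_measurable borel"
    unfolding \<phi>_def[abs_def]
    by (intro borel_measurable_times borel_measurable_abs borel_measurable_diff borel_measurable_fst_snd m md)
  have "\<phi> = (\<lambda>p. \<bar>f (snd p) * om (fst p - snd p) - f (fst p) * om (fst p - snd p)\<bar>)"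
    unfolding \<phi>_def[abs_def] by (intro ext abs_diff_weight(1) om0)
  then have \<phi>i: "integrable lborel \<phi>" using fx fy by simp
  then show ?I unfolding \<phi>_def om_def .
  have slice: "integrable lborel (\<lambda>y. \<bar>f y - f x\<bar> * om (x - y))" for x
  proof -
    have "(\<lambda>y. \<bar>f y - f x\<bar> * om (x - y)) = (\<lambda>y. \<bar>om (x - y) * f y - f x * om (x - y)\<bar>)"
      by (intro ext abs_diff_weight(3) om0)
    moreover have "integrable lborel (\<lambda>y. om (x - y) * f y)"
      using integrable_reflect(1)[OF omi, of x] B by (intro integrable_bounded_mult[OF f]) auto
    ultimately show ?thesis using integrable_reflect(1)[OF omi, of x] by simp
  qed
  then show ?A unfolding om_def .
  have slice': "integrable lborel (\<lambda>x. \<bar>f y - f x\<bar> * om (x - y))" for y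
  proof -
    have "(\<lambda>x. \<bar>f y - f x\<bar> * om (x - y)) = (\<lambda>x. \<bar>f y * om (x - y) - om (x - y) * f x\<bar>)"
      by (intro ext abs_diff_weight(4) om0)
    moreover have "integrable lborel (\<lambda>x. om (x - y) * f x)"
      using oms(1)[of y] B by (intro integrable_bounded_mult[OF f]) auto
    ultimately show ?thesis using oms(1)[of y] by simp
  qed
  \<comment> \<open>This is \<open>\<phi>\<close> in the variables (y, z) with x = y + z. The
    substitution is made slice by slice, so integrability over the plane is derived anew from the
    slices.\<close>
  define \<psi> where "\<psi> p = \<bar>f (fst p) - f (fst p + snd p)\<bar> * om (snd p)" for p :: "pt"
  have \<psi>m: "\<psi> \<in> borel_measurable borel"
    unfolding \<psi>_def[abs_def]
    by (intro borel_measurable_times borel_measurable_abs borel_measurable_diff borel_measurable_fst_snd m ma)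
  have tr: "integrable lborel (\<lambda>z. \<psi> (y, z))" "(LBINT z. \<psi> (y, z)) = (LBINT x. \<phi> (x, y))" for y
    using integrable_translate[OF slice', of y y] by (simp_all add: \<psi>_def \<phi>_def add.commute)
  have \<psi>i: "integrable lborel \<psi>"
  proof (rule lborel_Fubini_integrable[OF \<psi>m], intro disjI1 conjI allI)
    show "integrable lborel (\<lambda>y. LBINT z. \<bar>\<psi> (y, z)\<bar>)"
      using lborel_Fubini(4)[OF \<phi>i] tr(2) om0 by (simp add: \<psi>_def abs_mult)
  qed (rule tr(1))
  have "(LBINT p. \<phi> p) = (LBINT y. LBINT x. \<phi> (x, y))" by (rule lborel_Fubini(2)[OF \<phi>i])
  also have "\<dots> = (LBINT p. \<psi> p)" using lborel_Fubini(1)[OF \<psi>i] tr(2) by simp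
  also have "\<dots> = (LBINT z. LBINT y. \<psi> (y, z))" by (rule lborel_Fubini(2)[OF \<psi>i])
  also have "\<dots> \<le> (LBINT z. \<eta> * om z)"
  proof (rule integral_mono[OF lborel_Fubini(4)[OF \<psi>i] integrable_mult_right[OF omi]])
    fix z
    show "(LBINT y. \<psi> (y, z)) \<le> \<eta> * om z"
    proof (cases "\<bar>z\<bar> < e")
      case True
      have "(LBINT y. \<psi> (y, z)) = (shift_dist f z) * om z"
        by (simp add: \<psi>_def abs_minus_commute)
      also have "\<dots> \<le> \<eta> * om z" using modulus[OF True] om0 by (intro mult_right_mono)
      finally show ?thesis .
    next
      case False
      then have "om z = 0" unfolding om_def by (intro mollifier(3)[OF e]) auto
      then show ?thesis by (simp add: \<psi>_def)
    qed
  qed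
  also have "\<dots> = \<eta>" using mollifier(5)[OF e] by (simp add: om_def)
  finally show ?E unfolding \<phi>_def om_def .
qed

text \<open>The mollifier is a probability density on |t - r| < h, where the time modulus is at most
  \<open>\<eta>\<close>.\<close>

lemma time_modulus_mollified:
  fixes f :: "pt \<Rightarrow> real"
  assumes f: "integrable lborel f" "\<And>t. integrable lborel (\<lambda>x. f (t, x))" and h: "h > 0"
    and modulus: "\<And>t. \<bar>t - r\<bar> < h \<Longrightarrow> slice_dist f t r \<le> \<eta>"
  shows "integrable lborel (\<lambda>p. \<bar>f p - f (r, snd p)\<bar> * mollifier h (fst p - r))" (is ?I)
    and "(LBINT p. \<bar>f p - f (r, snd p)\<bar> * mollifier h (fst p - r)) \<le> \<eta>" (is ?E)
proof -
  define k where "k t = mollifier h (t - r)" for t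
  have ki: "integrable lborel k" unfolding k_def by (rule mollifier_shift(3)[OF h])
  have k0: "k t \<ge> 0" for t unfolding k_def by (rule mollifier(1)[OF h])
  obtain B where B: "\<And>z. \<bar>k z\<bar> \<le> B"
    using bump_function_bounded[OF mollifier(4)[OF h]] unfolding k_def by blast
  have "k \<in> borel_measurable borel" using ki by auto
  from borel_measurable_fst_snd(1)[OF this]
  have "integrable lborel (\<lambda>p. k (fst p) * f p)"
    using B by (intro integrable_bounded_mult[OF f(1), of _ B]) auto
  moreover have "integrable lborel (\<lambda>p. k (fst p) * f (r, snd p))"
    by (rule integrable_tensor(1)[OF ki f(2)])
  moreover have "(\<lambda>p. \<bar>f p - f (r, snd p)\<bar> * k (fst p)) = (\<lambda>p. \<bar>k (fst p) * f p - k (fst p) * f (r, snd p)\<bar>)"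
    by (intro ext abs_diff_weight(2) k0)
  ultimately have I: "integrable lborel (\<lambda>p. \<bar>f p - f (r, snd p)\<bar> * k (fst p))" by simp
  then show ?I unfolding k_def .
  have "(LBINT p. \<bar>f p - f (r, snd p)\<bar> * k (fst p)) = (LBINT t. LBINT x. \<bar>f (t, x) - f (r, x)\<bar> * k t)"
    using lborel_Fubini(1)[OF I] by simp
  also have "\<dots> \<le> (LBINT t. \<eta> * k t)"
  proof (rule integral_mono)
    show "integrable lborel (\<lambda>t. LBINT x. \<bar>f (t, x) - f (r, x)\<bar> * k t)" using lborel_Fubini(3)[OF I] by simp
    show "integrable lborel (\<lambda>t. \<eta> * k t)" using ki by simp
    show "(LBINT x. \<bar>f (t, x) - f (r, x)\<bar> * k t) \<le> \<eta> * k t" for t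
    proof (cases "\<bar>t - r\<bar> < h")
      case True
      then show ?thesis using modulus[OF True] k0 by (simp add: mult_right_mono)
    next
      case False
      then have "k t = 0" unfolding k_def by (intro mollifier(3)[OF h]) auto
      then show ?thesis by simp
    qed
  qed
  also have "\<dots> = \<eta>" using mollifier_shift(4)[OF h] by (simp add: k_def)
  finally show ?E unfolding k_def .
qed

context kruzkov_pair
begin

definition total_excess :: "pt \<times> pt \<Rightarrow> real" where
  "total_excess P = (\<Sum>i=1..N. excess i P)"

definition doubled_excess :: "real \<Rightarrow> real \<Rightarrow> real \<Rightarrow> real" where
  "doubled_excess h e r = (LBINT P. total_excess P *
     (mollifier h (t1 P - r) * (mollifier h (t2 P - r) * mollifier e (x1 P - x2 P))))"

lemma total_excess_weighted:
  assumes "integrable lborel A" "\<And>t. \<bar>A t\<bar> \<le> a" "integrable lborel B" "\<And>t. \<bar>B t\<bar> \<le> b" "integrable lborel C"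
  shows "integrable lborel (\<lambda>P. total_excess P * kern A B C P)"
proof (rule integrable_weighted[OF _ _ _ _ assms])
  show "total_excess \<in> borel_measurable borel"
    unfolding total_excess_def[abs_def] by (intro borel_measurable_sum excess_borel)
  show "integrable lborel (\<lambda>p. \<Sum>i=1..N. \<bar>U i p\<bar>)" "integrable lborel (\<lambda>p. \<Sum>i=1..N. \<bar>V i p\<bar>)"
    by (intro Bochner_Integration.integrable_sum integrable_abs regular; simp)+
  show "\<bar>total_excess (p, q)\<bar> \<le> 1 * ((\<Sum>i=1..N. \<bar>U i p\<bar>) + (\<Sum>i=1..N. \<bar>V i q\<bar>))" for p q
    unfolding total_excess_def mult_1 sum.distrib[symmetric]
    by (rule order_trans[OF sum_abs]) (intro sum_mono, use excess_bound in simp)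
qed

lemma excess_weighted:
  assumes "integrable lborel A" "\<And>t. \<bar>A t\<bar> \<le> a" "integrable lborel B" "\<And>t. \<bar>B t\<bar> \<le> b" "integrable lborel C"
    and i: "i \<in> {1..N}"
  shows "integrable lborel (\<lambda>P. excess i P * kern A B C P)"
  by (rule integrable_weighted[OF excess_borel[OF i] excess_bound _ _ assms(1-5)])
     (use regular[OF i] in auto)

text \<open>\<open>doubled_inequality\<close> says that the \<open>r\<close>-derivative is nonpositive. It is integrated over
  \<open>[r1, r2]\<close> by Fubini, which avoids differentiating under the integral.\<close>

lemma doubled_excess_antimono:
  assumes h: "0 < h" "h < r1" "r1 \<le> r2" "r2 + h < T" and e: "0 < e"
  shows "doubled_excess h e r2 \<le> doubled_excess h e r1"
proof -
  let ?k = "mollifier h" and ?k' = "deriv (mollifier h)" and ?om = "mollifier e"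
  obtain B where B: "\<And>t. \<bar>?k t\<bar> \<le> B" "\<And>t. \<bar>?k' t\<bar> \<le> B"
    using bump_function_bounded[OF mollifier(4)[OF h(1)]] by blast
  have B0: "B \<ge> 0" using B(1)[of 0] by linarith
  note omi = bump_function_integrable(1)[OF mollifier(4)[OF e]]
  note km = bump_function_borel[OF mollifier(4)[OF h(1)]]
  define D where "D t s r = ?k' (t - r) * ?k (s - r) + ?k (t - r) * ?k' (s - r)" for t s r
  define F where "F R = (total_excess (fst R) * ?om (snd (fst (fst R)) - snd (snd (fst R))))
       * (D (fst (fst (fst R))) (fst (snd (fst R))) (snd R) * indicator {r1..r2} (snd R))"
    for R :: "(pt \<times> pt) \<times> real"
  \<comment> \<open>A majorant uniform in r: for r in [r1, r2], all times within h of r lie in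
    [0, T], so fixed indicators replace the moving mollifiers.\<close>
  define m where "m P = total_excess P * (indicator {0..T} (t1 P) * (indicator {0..T} (t2 P) * ?om (x1 P - x2 P)))"
    for P :: "pt \<times> pt"
  have iT: "integrable lborel (indicator {0..T} :: real \<Rightarrow> real)" "integrable lborel (indicator {r1..r2} :: real \<Rightarrow> real)"
    by (auto intro!: integrable_real_indicator simp: emeasure_lborel_Icc_eq)
  have im: "integrable lborel m"
    unfolding m_def[abs_def] by (rule total_excess_weighted[OF iT(1) _ iT(1) _ omi, of 1 1]) (auto simp: indicator_def)
  have kc: "(\<lambda>R::(pt \<times> pt) \<times> real. g (fst (fst (fst R)) - snd R)) \<in> borel_measurable borel"
    "(\<lambda>R::(pt \<times> pt) \<times> real. g (fst (snd (fst R)) - snd R)) \<in> borel_measurable borel"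
    if "g \<in> borel_measurable borel" for g :: "real \<Rightarrow> real"
    by (rule measurable_compose[OF _ that];
        auto intro!: borel_measurable_continuous_onI continuous_intros)+
  have em: "total_excess \<in> borel_measurable borel"
    unfolding total_excess_def[abs_def] by (intro borel_measurable_sum excess_borel)
  have omm: "?om \<in> borel_measurable borel" using omi by auto
  have Fm: "F \<in> borel_measurable borel"
    unfolding F_def[abs_def] D_def
    by (intro borel_measurable_times borel_measurable_add kc km
          borel_measurable_fst_snd(1)[OF em] borel_measurable_fst_snd(1)[OF borel_measurable_diff_kernel[OF omm]]
          borel_measurable_fst_snd(2)) auto
  have Di: "\<bar>D t s r\<bar> \<le> 2 * B * B * (indicator {0..T} t * indicator {0..T} s)" if "r \<in> {r1..r2}" for t s r
  proof (cases "\<bar>t - r\<bar> > h \<or> \<bar>s - r\<bar> > h")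
    case True
    then have "D t s r = 0" unfolding D_def using mollifier(3)[OF h(1)] mollifier_deriv(3)[OF h(1)] by auto
    then show ?thesis using B0 by simp
  next
    case False
    then have "t \<in> {0..T}" "s \<in> {0..T}" using that h by auto
    moreover have "\<bar>D t s r\<bar> \<le> B * B + B * B"
      unfolding D_def using B B0
      by (intro order_trans[OF abs_triangle_ineq] add_mono) (auto simp: abs_mult intro!: mult_mono)
    ultimately show ?thesis by simp
  qed
  have iF: "integrable lborel F"
  proof (rule Bochner_Integration.integrable_bound)
    show "integrable lborel (\<lambda>R. (2 * B * B * \<bar>m (fst R)\<bar>) * indicator {r1..r2} (snd R))"
      using im iT by (intro integrable_tensor(1)) auto
    show "F \<in> borel_measurable lborel" using Fm by simp
    show "AE R in lborel. norm (F R) \<le> norm ((2 * B * B * \<bar>m (fst R)\<bar>) * indicator {r1..r2} (snd R))"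
    proof (rule AE_I2)
      fix R :: "(pt \<times> pt) \<times> real"
      show "norm (F R) \<le> norm ((2 * B * B * \<bar>m (fst R)\<bar>) * indicator {r1..r2} (snd R))"
      proof (cases "snd R \<in> {r1..r2}")
        case True
        have "\<bar>F R\<bar> = \<bar>total_excess (fst R) * ?om (snd (fst (fst R)) - snd (snd (fst R)))\<bar> * \<bar>D (fst (fst (fst R))) (fst (snd (fst R))) (snd R)\<bar>"
          using True by (simp add: F_def abs_mult)
        also have "\<dots> \<le> \<bar>total_excess (fst R) * ?om (snd (fst (fst R)) - snd (snd (fst R)))\<bar>
            * (2 * B * B * (indicator {0..T} (fst (fst (fst R))) * indicator {0..T} (fst (snd (fst R)))))"
          by (intro mult_left_mono Di[OF True]) auto
        also have "\<dots> = 2 * B * B * \<bar>m (fst R)\<bar>" by (simp add: m_def abs_mult)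
        finally show ?thesis using True B0 by simp
      qed (simp add: F_def)
    qed
  qed
  have ki: "integrable lborel (\<lambda>t. ?k (t - r))" for r by (rule mollifier_shift(3)[OF h(1)])
  define W where "W r P = total_excess P * (?k (t1 P - r) * (?k (t2 P - r) * ?om (x1 P - x2 P)))" for r P
  have iW: "integrable lborel (W r)" for r
    unfolding W_def[abs_def] by (rule total_excess_weighted[OF ki _ ki _ omi]) (rule B(1))+
  have inner: "(LBINT r. F (P, r)) = W r1 P - W r2 P" for P
  proof -
    let ?t = "t1 P" and ?s = "t2 P"
    have d: "((\<lambda>r. ?k (t - r)) has_real_derivative - ?k' (t - r)) (at r)" for t r
      using DERIV_chain2[OF bump_function_deriv(1)[OF mollifier(4)[OF h(1)]] DERIV_diff[OF DERIV_const DERIV_ident]] by simp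
    have c: "isCont (\<lambda>r. ?k' (t - r)) r" "isCont (\<lambda>r. ?k (t - r)) r" for t r
      using bump_function_deriv(2,3)[OF mollifier(4)[OF h(1)]]
      by (auto intro: isCont_o2[of _ "\<lambda>r. t - r"])
    \<comment> \<open>\<open>D\<close> is the r-derivative of minus the product of the two time
      mollifiers.\<close>
    have FTC: "(LBINT r. D ?t ?s r * indicator {r1..r2} r)
       = - (?k (?t - r2) * ?k (?s - r2)) - - (?k (?t - r1) * ?k (?s - r1))"
    proof (rule integral_FTC_Icc_real[OF h(3)])
      fix r
      show "((\<lambda>r. - (?k (?t - r) * ?k (?s - r))) has_real_derivative D ?t ?s r) (at r)"
        using DERIV_minus[OF DERIV_mult[OF d[of ?t] d[of ?s]]] by (simp add: D_def mult.commute add.commute)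
      show "isCont (D ?t ?s) r" unfolding D_def[abs_def] by (intro continuous_add continuous_mult c)
    qed
    have "(LBINT r. F (P, r)) = (total_excess P * ?om (x1 P - x2 P))
        * (LBINT r. D ?t ?s r * indicator {r1..r2} r)"
      by (simp add: F_def)
    then show ?thesis unfolding FTC by (simp add: W_def algebra_simps)
  qed
  have "0 \<le> (LBINT r. LBINT P. F (P, r))"
  proof (rule Bochner_Integration.integral_nonneg)
    fix r
    show "0 \<le> (LBINT P. F (P, r))"
    proof (cases "r \<in> {r1..r2}")
      case True
      have "F (P, r) = (\<Sum>i=1..N. excess i P) * ((?k' (t1 P - r) * ?k (t2 P - r)
       + ?k (t1 P - r) * ?k' (t2 P - r)) * ?om (x1 P - x2 P))" for P
        using True by (simp add: F_def total_excess_def D_def mult_ac)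
      then show ?thesis using doubled_inequality[of h r e] True h e by simp
    qed (simp add: F_def)
  qed
  also have "\<dots> = (LBINT P. LBINT r. F (P, r))"
    using lborel_Fubini(1,2)[OF iF] by simp
  also have "\<dots> = doubled_excess h e r1 - doubled_excess h e r2"
    unfolding inner using iW unfolding doubled_excess_def W_def by simp
  finally show ?thesis by simp
qed

text \<open>The positive part is 1-Lipschitz, so three errors arise: U moved in time at x1, V moved
  in time at x2, and V moved in space from x2 to x1. The reference value is taken at x1, which is
  why the space shift falls on V alone.\<close>

lemma doubled_excess_close:
  assumes h: "0 < h" and e: "0 < e"
    and U_mod: "\<And>i t. i \<in> {1..N} \<Longrightarrow> \<bar>t - r\<bar> < h \<Longrightarrow> slice_dist (U i) t r \<le> \<eta>"
    and V_mod: "\<And>i t. i \<in> {1..N} \<Longrightarrow> \<bar>t - r\<bar> < h \<Longrightarrow> slice_dist (V i) t r \<le> \<eta>"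
    and V_space: "\<And>i z. i \<in> {1..N} \<Longrightarrow> \<bar>z\<bar> < e \<Longrightarrow> (LBINT x. \<bar>V i (r, x + z) - V i (r, x)\<bar>) \<le> \<eta>"
  shows "\<bar>doubled_excess h e r - (\<Sum>i=1..N. slice_excess (U i) (V i) r)\<bar> \<le> real N * (3 * \<eta>)"
proof -
  define k where "k t = mollifier h (t - r)" for t
  define om where "om = mollifier e"
  note ki = mollifier_shift(3)[OF h, of r, folded k_def] and k1 = mollifier_shift(4)[OF h, of r, folded k_def]
  note omi = bump_function_integrable(1)[OF mollifier(4)[OF e], folded om_def] and om1 = mollifier(5)[OF e, folded om_def]
  have k0: "k t \<ge> 0" and om0: "om t \<ge> 0" for t
    unfolding k_def om_def using mollifier(1) h e by blast+
  obtain B where "\<And>t. \<bar>mollifier h t\<bar> \<le> B"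
    using bump_function_bounded[OF mollifier(4)[OF h(1)]] by blast
  then have B: "\<And>t. \<bar>k t\<bar> \<le> B" unfolding k_def by blast
  define K where "K P = kern k k om P"
    for P :: "pt \<times> pt"
  have K0: "K P \<ge> 0" for P unfolding K_def using k0 om0 by simp
  have one: "integrable lborel (\<lambda>P. excess i P * K P)"
    "\<bar>(LBINT P. excess i P * K P) - (slice_excess (U i) (V i) r)\<bar> \<le> 3 * \<eta>"
    if i: "i \<in> {1..N}" for i
  proof -
    note R = regular[OF i]
    show iE: "integrable lborel (\<lambda>P. excess i P * K P)"
      unfolding K_def by (rule excess_weighted[OF ki B ki B omi i])
    define w where "w x = max 0 (U i (r, x) - V i (r, x))" for x
    have wi: "integrable lborel w" unfolding w_def[abs_def] using R by (intro integrable_max) auto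
    note tw = integrable_tensor[OF ki wi]
    have iw: "integrable lborel (\<lambda>P. w (x1 P) * K P)"
      and ew: "(LBINT P. w (x1 P) * K P) = (LBINT x. w x)"
      using integrable_kernel_fst[OF tw(1) ki omi] tw(2) k1 om1 by (simp_all add: K_def mult_ac)
    define d1 where "d1 P = \<bar>U i (fst P) - U i (r, x1 P)\<bar> * K P" for P
    define d2 where "d2 P = \<bar>V i (snd P) - V i (r, x2 P)\<bar> * K P" for P
    define d3 where "d3 P = \<bar>V i (r, x2 P) - V i (r, x1 P)\<bar> * K P" for P
    note t1 = time_modulus_mollified[OF R(3,5) h, of r \<eta>, OF U_mod[OF i], folded k_def]
    note t2 = time_modulus_mollified[OF R(4,6) h, of r \<eta>, OF V_mod[OF i], folded k_def]
    note t3 = L1_modulus_mollified[OF R(6) e, of r \<eta>, OF V_space[OF i], folded om_def]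
    have 1: "integrable lborel d1" "(LBINT P. d1 P) \<le> \<eta>"
      using integrable_kernel_fst[OF t1(1) ki omi] t1(2) k1 om1 by (simp_all add: d1_def[abs_def] K_def mult_ac)
    have 2: "integrable lborel d2" "(LBINT P. d2 P) \<le> \<eta>"
      using integrable_kernel_snd[OF t2(1) ki omi] t2(2) k1 om1 by (simp_all add: d2_def[abs_def] K_def mult_ac)
    have 3: "integrable lborel d3" "(LBINT P. d3 P) \<le> \<eta>"
      using integrable_kernel_space[OF t3(1) _ ki ki] t3(2,3) k1 by (simp_all add: d3_def[abs_def] K_def mult_ac)
    have "\<bar>(LBINT P. excess i P * K P) - (LBINT x. w x)\<bar>
        = \<bar>LBINT P. excess i P * K P - w (x1 P) * K P\<bar>"
      using iE iw ew by simp
    also have "\<dots> \<le> (LBINT P. \<bar>excess i P * K P - w (x1 P) * K P\<bar>)" by (rule integral_abs_bound)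
    also have "\<dots> \<le> (LBINT P. d1 P + d2 P + d3 P)"
    proof (rule integral_mono)
      show "integrable lborel (\<lambda>P. \<bar>excess i P * K P - w (x1 P) * K P\<bar>)" using iE iw by simp
      show "integrable lborel (\<lambda>P. d1 P + d2 P + d3 P)" using 1 2 3 by simp
      fix P
      have "\<bar>excess i P - w (x1 P)\<bar> \<le> \<bar>U i (fst P) - U i (r, x1 P)\<bar>
          + \<bar>V i (snd P) - V i (r, x2 P)\<bar> + \<bar>V i (r, x2 P) - V i (r, x1 P)\<bar>"
        unfolding excess_def w_def by linarith
      from mult_right_mono[OF this K0[of P]]
      show "\<bar>excess i P * K P - w (x1 P) * K P\<bar> \<le> d1 P + d2 P + d3 P"
        unfolding abs_diff_weight(1)[OF K0, of "excess i P", symmetric] d1_def d2_def d3_def distrib_right[symmetric] .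
    qed
    also have "\<dots> \<le> 3 * \<eta>" using 1 2 3 by simp
    finally show "\<bar>(LBINT P. excess i P * K P) - (slice_excess (U i) (V i) r)\<bar> \<le> 3 * \<eta>"
      unfolding w_def .
  qed
  have "doubled_excess h e r = (\<Sum>i=1..N. LBINT P. excess i P * K P)"
    unfolding doubled_excess_def total_excess_def K_def[symmetric] k_def[symmetric] om_def[symmetric] sum_distrib_right
    using one(1) by (subst Bochner_Integration.integral_sum) (auto simp: K_def)
  then have "\<bar>doubled_excess h e r - (\<Sum>i=1..N. slice_excess (U i) (V i) r)\<bar>
    = \<bar>\<Sum>i=1..N. (LBINT P. excess i P * K P) - (slice_excess (U i) (V i) r)\<bar>"
    by (simp add: sum_subtractf)
  also have "\<dots> \<le> (\<Sum>i=1..N. 3 * \<eta>)" by (rule order_trans[OF sum_abs sum_mono]) (rule one(2))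
  finally show ?thesis by simp
qed

abbreviation (input) "near r \<eta> i d \<equiv>
    (\<forall>t. \<bar>t - r\<bar> < d \<longrightarrow> slice_dist (U i) t r \<le> \<eta>) \<and>
    (\<forall>t. \<bar>t - r\<bar> < d \<longrightarrow> slice_dist (V i) t r \<le> \<eta>) \<and>
    (\<forall>z. \<bar>z\<bar> < d \<longrightarrow> (LBINT x. \<bar>V i (r, x + z) - V i (r, x)\<bar>) \<le> \<eta>)"

lemma moduli:
  assumes r: "0 < r" "r < T" and \<eta>: "\<eta> > 0"
  shows "\<exists>d>0. \<forall>i\<in>{1..N}. near r \<eta> i d"
proof -
  have time: "\<exists>d>0. \<forall>t. \<bar>t - r\<bar> < d \<longrightarrow> slice_dist f t r \<le> \<eta>"
    if lim: "((\<lambda>t. slice_dist f t r) \<longlongrightarrow> 0) (at r)" for f :: "pt \<Rightarrow> real"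
  proof -
    obtain d where d: "d > 0" "\<And>t. t \<noteq> r \<Longrightarrow> \<bar>t - r\<bar> < d \<Longrightarrow> \<bar>slice_dist f t r\<bar> < \<eta>"
      using LIM_D[OF lim \<eta>] by auto
    have "slice_dist f t r \<le> \<eta>" if "\<bar>t - r\<bar> < d" for t
      using d(2)[of t] that \<eta> by (cases "t = r") auto
    then show ?thesis using d(1) by blast
  qed
  have "\<forall>i\<in>{1..N}. \<exists>d>0. near r \<eta> i d"
  proof
    fix i assume i: "i \<in> {1..N}"
    have "((\<lambda>t. slice_dist (U i) t r) \<longlongrightarrow> 0) (at r)"
      "((\<lambda>t. slice_dist (V i) t r) \<longlongrightarrow> 0) (at r)"
      using U V i r unfolding kruzkov_family_def by blast+
    then obtain d1 d2 where d: "d1 > 0" "\<And>t. \<bar>t - r\<bar> < d1 \<Longrightarrow> slice_dist (U i) t r \<le> \<eta>"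
      "d2 > 0" "\<And>t. \<bar>t - r\<bar> < d2 \<Longrightarrow> slice_dist (V i) t r \<le> \<eta>"
      using time by meson
    obtain d3 where d3: "d3 > 0" "\<And>z. \<bar>z\<bar> < d3 \<Longrightarrow> (LBINT x. \<bar>V i (r, x + z) - V i (r, x)\<bar>) < \<eta>"
      using L1_translation_continuousD[OF regular(6)[OF i, of r] \<eta>] by blast
    show "\<exists>d>0. near r \<eta> i d"
      using d d3 by (intro exI[of _ "min d1 (min d2 d3)"]) (auto intro: less_imp_le)
  qed
  from bchoice[OF this] obtain d where d0: "\<forall>i\<in>{1..N}. d i > 0 \<and> near r \<eta> i (d i)"
    by blast
  note d = bspec[OF d0]
  \<comment> \<open>Smallest radius over the lanes; the inserted 1 keeps the set nonempty for N =
    0.\<close>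
  define m where "m = Min (insert 1 (d ` {1..N}))"
  have "m > 0" using d unfolding m_def by (subst Min_gr_iff) auto
  moreover have "m \<le> d i" if "i \<in> {1..N}" for i unfolding m_def using that by (intro Min_le) auto
  ultimately have m: "m > 0" "\<And>i. i \<in> {1..N} \<Longrightarrow> m \<le> d i" by blast+
  show ?thesis
  proof (intro exI[of _ m] conjI ballI allI impI m(1))
    fix i z assume i: "i \<in> {1..N}"
    show "slice_dist (U i) z r \<le> \<eta>" "slice_dist (V i) z r \<le> \<eta>"
      if "\<bar>z - r\<bar> < m"
      using d[OF i] order_less_le_trans[OF that m(2)[OF i]] by blast+
    show "(LBINT x. \<bar>V i (r, x + z) - V i (r, x)\<bar>) \<le> \<eta>" if "\<bar>z\<bar> < m"
      using d[OF i] order_less_le_trans[OF that m(2)[OF i]] by blast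
  qed
qed

text \<open>The doubled excess is nonincreasing in r, and for small h it is close to the undoubled
  excess at each of the two times.\<close>

lemma comparison:
  assumes r: "0 < r1" "r1 \<le> r2" "r2 < T"
  shows "(\<Sum>i=1..N. slice_excess (U i) (V i) r2)
       \<le> (\<Sum>i=1..N. slice_excess (U i) (V i) r1)"
proof (rule field_le_epsilon)
  fix \<epsilon> :: real assume \<epsilon>: "\<epsilon> > 0"
  \<comment> \<open>Each of the two times costs at most 3 N \<eta>, and 6 N \<eta> <=
    \<epsilon>.\<close>
  define \<eta> where "\<eta> = \<epsilon> / (6 * (real N + 1))"
  have \<eta>: "\<eta> > 0" using \<epsilon> by (simp add: \<eta>_def)
  let ?G = "\<lambda>r. \<Sum>i=1..N. slice_excess (U i) (V i) r"
  have close: "\<exists>d>0. \<forall>h. 0 < h \<longrightarrow> h \<le> d \<longrightarrow> \<bar>doubled_excess h h r - ?G r\<bar> \<le> real N * (3 * \<eta>)"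
    if r: "0 < r" "r < T" for r
  proof -
    obtain d where d: "d > 0"
      "\<And>i t. i \<in> {1..N} \<Longrightarrow> \<bar>t - r\<bar> < d \<Longrightarrow> slice_dist (U i) t r \<le> \<eta>"
      "\<And>i t. i \<in> {1..N} \<Longrightarrow> \<bar>t - r\<bar> < d \<Longrightarrow> slice_dist (V i) t r \<le> \<eta>"
      "\<And>i z. i \<in> {1..N} \<Longrightarrow> \<bar>z\<bar> < d \<Longrightarrow> (LBINT x. \<bar>V i (r, x + z) - V i (r, x)\<bar>) \<le> \<eta>"
      using moduli[OF r \<eta>] by blast
    show ?thesis
    proof (intro exI[of _ d] conjI allI impI d(1))
      fix h assume h: "0 < h" "h \<le> d"
      show "\<bar>doubled_excess h h r - ?G r\<bar> \<le> real N * (3 * \<eta>)"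
        by (rule doubled_excess_close[OF h(1) h(1)]) (use d h in force)+
    qed
  qed
  obtain d1 where d1: "d1 > 0" "\<And>h. 0 < h \<Longrightarrow> h \<le> d1 \<Longrightarrow> \<bar>doubled_excess h h r1 - ?G r1\<bar> \<le> real N * (3 * \<eta>)"
    using close[of r1] r by auto
  obtain d2 where d2: "d2 > 0" "\<And>h. 0 < h \<Longrightarrow> h \<le> d2 \<Longrightarrow> \<bar>doubled_excess h h r2 - ?G r2\<bar> \<le> real N * (3 * \<eta>)"
    using close[of r2] r by auto
  \<comment> \<open>One h is both the time and the space scale: below both moduli, and small enough
    that [r1 - h, r2 + h] stays inside (0, T).\<close>
  define h where "h = min (min d1 d2) (min (r1 / 2) ((T - r2) / 2))"
  have h: "0 < h" "h \<le> d1" "h \<le> d2" "h < r1" "r2 + h < T" using d1(1) d2(1) r by (auto simp: h_def min_def field_simps)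
  have "doubled_excess h h r2 \<le> doubled_excess h h r1"
    by (rule doubled_excess_antimono) (use h r in auto)
  moreover have "real N * (6 * \<eta>) \<le> \<epsilon>" using \<epsilon> by (simp add: \<eta>_def field_simps)
  ultimately show "?G r2 \<le> ?G r1 + \<epsilon>"
    using d1(2)[OF h(1,2)] d2(2)[OF h(1,3)] by linarith
qed

end

section \<open>Initial trace and contraction\<close>

text \<open>Since all averages of g vanish, g(y) equals the average of g(y) - g(x) over x near y,
  and the L1 norm of this average is at most the translation modulus of g.\<close>

lemma mollified_zero_imp_AE_zero:
  fixes g :: "real \<Rightarrow> real"
  assumes g: "integrable lborel g"
    and zero: "\<And>e y. 0 < e \<Longrightarrow> (LBINT x. g x * mollifier e (x - y)) = 0"
  shows "AE x in lborel. g x = 0"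
proof -
  have "(LBINT y. \<bar>g y\<bar>) \<le> 0 + \<eta>" if \<eta>: "\<eta> > 0" for \<eta>
  proof -
    obtain e where e: "e > 0" "\<And>z. \<bar>z\<bar> < e \<Longrightarrow> shift_dist g z \<le> \<eta>"
      using L1_translation_continuousD[OF g \<eta>] by (auto intro: less_imp_le)
    define om where "om y x = mollifier e (x - y)" for y x
    have om0: "om y x \<ge> 0" for y x unfolding om_def by (rule mollifier(1)[OF e(1)])
    note omi = mollifier_shift(3,4)[OF e(1), folded om_def]
    obtain B where B: "\<And>y x. \<bar>om y x\<bar> \<le> B"
      using bump_function_bounded[OF mollifier(4)[OF e(1)]] unfolding om_def by blast
    note mod = L1_modulus_mollified[OF g e]
    have "\<bar>g y\<bar> \<le> (LBINT x. \<bar>g y - g x\<bar> * om y x)" for y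
    proof -
      have ig: "integrable lborel (\<lambda>x. om y x * g x)"
        using omi(1)[of y] B by (intro integrable_bounded_mult[OF g]) auto
      have "g y = (LBINT x. om y x * g y - om y x * g x)"
        using ig omi[of y] zero[OF e(1), of y] by (simp add: mult.commute om_def)
      also have "\<bar>\<dots>\<bar> \<le> (LBINT x. \<bar>om y x * g y - om y x * g x\<bar>)" by (rule integral_abs_bound)
      also have "\<dots> = (LBINT x. \<bar>g y - g x\<bar> * om y x)"
        by (intro Bochner_Integration.integral_cong refl abs_diff_weight(2)[symmetric] om0)
      finally show ?thesis .
    qed
    then have "(LBINT y. \<bar>g y\<bar>) \<le> (LBINT y. LBINT x. \<bar>g y - g x\<bar> * om y x)"
      using lborel_Fubini(4)[OF mod(1)] g unfolding om_def by (intro integral_mono) auto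
    also have "\<dots> \<le> \<eta>" using lborel_Fubini(2)[OF mod(1)] mod(2) unfolding om_def by simp
    finally show ?thesis by simp
  qed
  then have "(LBINT y. \<bar>g y\<bar>) \<le> 0" by (rule field_le_epsilon)
  moreover have "(LBINT y. \<bar>g y\<bar>) \<ge> 0" by simp
  ultimately have "(LBINT y. \<bar>g y\<bar>) = 0" by simp
  then show ?thesis
    using integral_nonneg_eq_0_iff_AE[OF integrable_abs[OF g]] by simp
qed

context bounded_solution
begin

text \<open>The weak formulation (entropies \<open>\<plusminus>u\<close>) is tested with a mollifier centred at time 0, of height
  \<open>1 / h\<close>; multiplied by \<open>h\<close>, only the initial values survive as \<open>h\<close> tends to 0.\<close>

lemma initial_average:
  assumes i: "i \<in> {1..N}" and e: "0 < e"
  shows "(LBINT x. u i 0 x * mollifier e (x - y)) = (LBINT x. u0 i x * mollifier e (x - y))"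
proof -
  define b where "b x = mollifier e (x - y)" for x
  have b: "bump_function b" unfolding b_def by (rule mollifier_shift(1)[OF e])
  have b0: "b x \<ge> 0" for x unfolding b_def by (rule mollifier(1)[OF e])
  obtain B where B: "\<And>x. \<bar>b x\<bar> \<le> B" using bump_function_bounded[OF b] by blast
  have B0: "B \<ge> 0" using B[of 0] by linarith
  note ib = bump_function_integrable[OF b]
  define w where "w = u i 0"
  have wi: "integrable lborel w" unfolding w_def by (rule u_integrable[OF i]) simp
  have wb: "integrable lborel (\<lambda>x. w x * b x)"
    using integrable_bounded_mult[OF wi, of b B] ib(1) B by (simp add: mult.commute)
  define f where "f = flux v i"
  have flip: "\<exists>L. L-lipschitz_on {-r..r} f" for r
    unfolding f_def by (rule flux_lipschitz) (rule v_lipschitz[OF i])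
  obtain F where F: "F \<ge> 0" "\<And>x. lo \<le> x \<Longrightarrow> x \<le> hi \<Longrightarrow> \<bar>f x\<bar> \<le> F"
    using continuous_bounded_on_interval[OF lipschitz_isCont[OF flip]] by blast
  obtain S where S: "\<And>p. \<bar>lane_source N v i U p\<bar> \<le> S" using U_source_bounded[OF i] by blast
  define C where "C = F * (LBINT x. \<bar>deriv b x\<bar>) + S * (LBINT x. \<bar>b x\<bar>)"
  define c where "c = (LBINT x. \<bar>deriv (mollifier 1) x\<bar>)"
  define \<Delta> where "\<Delta> = (LBINT x. w x * b x) - (LBINT x. u0 i x * b x)"
  let ?I = "indicator ({0..} \<times> UNIV) :: pt \<Rightarrow> real"
  \<comment> \<open>This is the identity for a(0) \<Delta> multiplied by h: replacing the solution
    by its value at time 0 costs B \<eta> c, flux and source cost C h.\<close>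
  have estimate: "mollifier 1 0 * \<bar>\<Delta>\<bar> \<le> B * \<eta> * c + C * h"
    if h: "0 < h" "h < T" and mod: "\<And>t. 0 \<le> t \<Longrightarrow> t \<le> h \<Longrightarrow> (LBINT x. \<bar>U i (t, x) - w x\<bar>) \<le> \<eta>" for h \<eta>
  proof -
    define a where "a = mollifier h"
    have a: "bump_function a" unfolding a_def by (rule mollifier(4)[OF h(1)])
    have a0: "a t \<ge> 0" for t unfolding a_def by (rule mollifier(1)[OF h(1)])
    have supp: "a t = 0 \<and> deriv a t = 0" if "T < t" for t
      unfolding a_def using that h mollifier(3)[OF h(1), of t] mollifier_deriv(3)[OF h(1), of t] by auto
    note ia = bump_function_integrable[OF a]
    \<comment> \<open>X1 carries the time derivative, X2 the flux and the source; X3 is X1 with the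
      solution frozen at time 0, so that it factorises.\<close>
    define X1 where "X1 p = ?I p * (U i p * (deriv a (fst p) * b (snd p)))" for p
    define X2 where "X2 p = ?I p * (f (U i p) * (a (fst p) * deriv b (snd p)) - lane_source N v i U p * (a (fst p) * b (snd p)))" for p
    define X3 where "X3 p = (indicator {0..} (fst p) * deriv a (fst p)) * (w (snd p) * b (snd p))" for p
    have lin: "convex_on UNIV (\<lambda>x. sg * x)" "(\<lambda>x. sg * x) differentiable_on UNIV"
      "deriv (\<lambda>x. sg * x) = (\<lambda>x. sg)" "entropy_flux (\<lambda>x. sg * x) (flux v i) (\<lambda>x. sg * f x)" for sg :: real
    proof -
      show "convex_on UNIV (\<lambda>x. sg * x)" by (auto simp: convex_on_def algebra_simps)
      show "(\<lambda>x. sg * x) differentiable_on UNIV" by (intro derivative_intros)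
      have "((\<lambda>x. sg * x) has_real_derivative sg) (at x)" for x by (auto intro!: derivative_eq_intros)
      then show d: "deriv (\<lambda>x. sg * x) = (\<lambda>x. sg)" by (auto intro: DERIV_imp_deriv)
      show "entropy_flux (\<lambda>x. sg * x) (flux v i) (\<lambda>x. sg * f x)"
        unfolding entropy_flux_def d f_def[symmetric]
      proof (intro conjI allI impI)
        show "\<exists>L. L-lipschitz_on {-r..r} (\<lambda>x. sg * f x)" for r
          using flip[of r] lipschitz_on_cmult_real by blast
        show "((\<lambda>x. sg * f x) has_real_derivative sg * deriv f s) (at s)" if "f differentiable at s" for s
          using that by (intro DERIV_cmult) (metis DERIV_deriv_iff_real_differentiable)
      qed
    qed
    have lc: "isCont (deriv (\<lambda>x. sg * x)) x" for sg x :: real unfolding lin(3) by simp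
    have Z: "?I p * (sg * U i p * (deriv a (fst p) * b (snd p)) + sg * f (U i p) * (a (fst p) * deriv b (snd p))
        - deriv (\<lambda>x. sg * x) (U i p) * lane_source N v i U p * (a (fst p) * b (snd p))) = sg * (X1 p + X2 p)" for p sg
      unfolding lin(3) by (simp add: X1_def X2_def algebra_simps)
    have i12: "integrable lborel (\<lambda>p. X1 p + X2 p)"
      using entropy_inequality_plane(1)[OF i a b a0 b0 supp lin(1,2) lc lin(4), of 1] unfolding Z by simp
    have "0 \<le> sg * (LBINT p. X1 p + X2 p) + a 0 * (sg * (LBINT x. u0 i x * b x))" for sg
      using entropy_inequality_plane(2)[OF i a b a0 b0 supp lin(1,2) lc lin(4), of sg]
      unfolding Z mult.assoc[of sg "u0 i _"] by (simp only: integral_mult_right_zero)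
    \<comment> \<open>The linear entropies with slopes 1 and -1 give the two opposite
      inequalities.\<close>
    from this[of 1] this[of "- 1"]
    have eq: "(LBINT p. X1 p + X2 p) + a 0 * (LBINT x. u0 i x * b x) = 0" by simp
    have Im: "?I \<in> borel_measurable borel" by (intro borel_measurable_indicator borel_closed closed_Times) auto
    have "integrable lborel (\<lambda>p. (?I p * U i p) * (deriv a (fst p) * b (snd p)))"
      using U_borel[OF i] U_bound[of i] Im
      by (intro integrable_bounded_mult[OF integrable_tensor(1)[OF ia(2) ib(1)], of _ "max (- lo) hi"])
         (auto intro!: abs_indicator_mult_le)
    then have i1: "integrable lborel X1" unfolding X1_def[abs_def] by (simp add: mult.assoc)
    have i2: "integrable lborel X2" using Bochner_Integration.integrable_diff[OF i12 i1] by simp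
    have iia: "integrable lborel (\<lambda>t. indicator {0..} t * deriv a t)"
      using integrable_bounded_mult[OF ia(2), of "indicator {0..}" 1] by (auto simp: indicator_def)
    \<comment> \<open>The half-line integral of the derivative of a is -a(0), so X3 reproduces the
      initial term with \<open>w\<close> in place of the data.\<close>
    have i3: "integrable lborel X3" and e3: "(LBINT p. X3 p) = - a 0 * (LBINT x. w x * b x)"
      unfolding X3_def[abs_def] using integrable_tensor[OF iia wb] bump_function_integral_deriv(2)[OF a] by auto
    have 2: "\<bar>LBINT p. X2 p\<bar> \<le> C"
    proof -
      let ?w = "\<lambda>p::pt. F * (\<bar>a (fst p)\<bar> * \<bar>deriv b (snd p)\<bar>) + S * (\<bar>a (fst p)\<bar> * \<bar>b (snd p)\<bar>)"
      have t: "integrable lborel (\<lambda>p. \<bar>a (fst p)\<bar> * \<bar>deriv b (snd p)\<bar>)" "integrable lborel (\<lambda>p. \<bar>a (fst p)\<bar> * \<bar>b (snd p)\<bar>)"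
        by (intro integrable_tensor(1) integrable_abs ia ib)+
      have "\<bar>LBINT p. X2 p\<bar> \<le> (LBINT p. \<bar>X2 p\<bar>)" by (rule integral_abs_bound)
      also have "\<dots> \<le> (LBINT p. ?w p)"
      proof (rule integral_mono)
        show "integrable lborel (\<lambda>p. \<bar>X2 p\<bar>)" using i2 by simp
        show "integrable lborel ?w"
          using t by simp
        fix p
        have "\<bar>X2 p\<bar> \<le> \<bar>f (U i p) * (a (fst p) * deriv b (snd p)) - lane_source N v i U p * (a (fst p) * b (snd p))\<bar>"
          unfolding X2_def by (rule abs_indicator_mult_le) simp
        also have "\<dots> \<le> \<bar>f (U i p)\<bar> * (\<bar>a (fst p)\<bar> * \<bar>deriv b (snd p)\<bar>) + \<bar>lane_source N v i U p\<bar> * (\<bar>a (fst p)\<bar> * \<bar>b (snd p)\<bar>)"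
          unfolding abs_mult[symmetric] by (rule abs_triangle_ineq4)
        also have "\<dots> \<le> ?w p"
          using F(2) U_range S by (intro add_mono mult_right_mono) auto
        finally show "\<bar>X2 p\<bar> \<le> ?w p" .
      qed
      also have "\<dots> = F * ((LBINT t. \<bar>a t\<bar>) * (LBINT x. \<bar>deriv b x\<bar>)) + S * ((LBINT t. \<bar>a t\<bar>) * (LBINT x. \<bar>b x\<bar>))"
        using t integrable_tensor(2)[OF integrable_abs[OF ia(1)] integrable_abs[OF ib(2)]]
          integrable_tensor(2)[OF integrable_abs[OF ia(1)] integrable_abs[OF ib(1)]] by simp
      also have "(LBINT t. \<bar>a t\<bar>) = 1" using mollifier(5)[OF h(1)] a0 by (simp add: a_def)
      finally show ?thesis by (simp add: C_def)
    qed
    have 1: "\<bar>LBINT p. X1 p - X3 p\<bar> \<le> B * \<eta> * (LBINT t. \<bar>deriv a t\<bar>)"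
    proof -
      have i13: "integrable lborel (\<lambda>p. \<bar>X1 p - X3 p\<bar>)" using i1 i3 by simp
      have "\<bar>LBINT p. X1 p - X3 p\<bar> \<le> (LBINT p. \<bar>X1 p - X3 p\<bar>)" by (rule integral_abs_bound)
      also have "\<dots> = (LBINT t. LBINT x. \<bar>X1 (t, x) - X3 (t, x)\<bar>)" by (rule lborel_Fubini(1)[OF i13])
      also have "\<dots> \<le> (LBINT t. B * \<eta> * \<bar>deriv a t\<bar>)"
      proof (rule integral_mono)
        show "integrable lborel (\<lambda>t. LBINT x. \<bar>X1 (t, x) - X3 (t, x)\<bar>)" by (rule lborel_Fubini(3)[OF i13])
        show "integrable lborel (\<lambda>t. B * \<eta> * \<bar>deriv a t\<bar>)" using ia by simp
        have \<eta>0: "\<eta> \<ge> 0"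
          using mod[of 0] h by (meson Bochner_Integration.integral_nonneg abs_ge_zero less_imp_le order_refl order_trans)
        fix t
        show "(LBINT x. \<bar>X1 (t, x) - X3 (t, x)\<bar>) \<le> B * \<eta> * \<bar>deriv a t\<bar>"
        proof (cases "0 \<le> t \<and> t \<le> h")
          case True
          have iU: "integrable lborel (\<lambda>x. \<bar>U i (t, x) - w x\<bar>)" using U_slice_integrable[OF i] wi by simp
          have eq13: "\<bar>X1 (t, x) - X3 (t, x)\<bar> = \<bar>deriv a t\<bar> * (\<bar>b x\<bar> * \<bar>U i (t, x) - w x\<bar>)" for x
          proof -
            have "X1 (t, x) - X3 (t, x) = deriv a t * (b x * (U i (t, x) - w x))"
              using True by (simp add: X1_def X3_def algebra_simps)
            then show ?thesis by (simp add: abs_mult)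
          qed
          have ibU: "integrable lborel (\<lambda>x. \<bar>b x\<bar> * \<bar>U i (t, x) - w x\<bar>)"
            using integrable_bounded_mult[OF iU, of "\<lambda>x. \<bar>b x\<bar>" B] ib(1) B by auto
          have "(LBINT x. \<bar>X1 (t, x) - X3 (t, x)\<bar>) = \<bar>deriv a t\<bar> * (LBINT x. \<bar>b x\<bar> * \<bar>U i (t, x) - w x\<bar>)"
            unfolding eq13 by simp
          also have "\<dots> \<le> \<bar>deriv a t\<bar> * (LBINT x. B * \<bar>U i (t, x) - w x\<bar>)"
            using B iU ibU by (intro mult_left_mono integral_mono mult_right_mono) auto
          also have "\<dots> \<le> \<bar>deriv a t\<bar> * (B * \<eta>)"
            using mod[of t] True B0 by (intro mult_left_mono) (auto intro!: mult_left_mono)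
          finally show ?thesis by (simp add: mult_ac)
        next
          case False
          have "X1 (t, x) = 0 \<and> X3 (t, x) = 0" for x
          proof (cases "0 \<le> t")
            case True
            then have "deriv a t = 0" unfolding a_def using False by (intro mollifier_deriv(3)[OF h(1)]) auto
            then show ?thesis by (simp add: X1_def X3_def)
          qed (simp add: X1_def X3_def)
          then show ?thesis using B0 \<eta>0 by simp
        qed
      qed
      finally show ?thesis by simp
    qed
    \<comment> \<open>One power of h is regained from the substitution t / h, so the derivative has
      L1 norm c / h; multiplication by h then leaves only \<eta> as the small factor.\<close>
    have ca: "(LBINT t. \<bar>deriv a t\<bar>) = c / h"
    proof -
      have "(LBINT t. \<bar>deriv a t\<bar>) = (LBINT t. \<bar>deriv (mollifier 1) (t / h)\<bar>) / h ^ 2"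
        unfolding a_def mollifier_deriv(2)[OF h(1)] by (simp add: abs_mult)
      also have "(LBINT t. \<bar>deriv (mollifier 1) (t / h)\<bar>) = h * c"
        using lborel_integral_real_affine[of h "\<lambda>t. \<bar>deriv (mollifier 1) (t / h)\<bar>" 0] h(1) by (simp add: c_def)
      finally show ?thesis using h(1) by (simp add: power2_eq_square)
    qed
    have "a 0 * \<Delta> = (LBINT p. X1 p - X3 p) + (LBINT p. X2 p)"
      using eq i1 i2 i3 e3 by (simp add: \<Delta>_def algebra_simps)
    then have "\<bar>a 0 * \<Delta>\<bar> \<le> B * \<eta> * (c / h) + C" using 1 2 unfolding ca by linarith
    moreover have "\<bar>a 0 * \<Delta>\<bar> = mollifier 1 0 * \<bar>\<Delta>\<bar> / h"
      using mollifier(6,7)[OF h(1)] mollifier(7)[of 1] by (simp add: a_def abs_mult less_imp_le[OF h(1)] h(1))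
    ultimately have "mollifier 1 0 * \<bar>\<Delta>\<bar> / h * h \<le> (B * \<eta> * (c / h) + C) * h" using h(1) by (intro mult_right_mono) auto
    then show ?thesis using h(1) by (simp add: distrib_right)
  qed
  have c0: "c \<ge> 0" by (simp add: c_def)
  have C0: "C \<ge> 0" using F(1) S[of "(0, 0)"] by (simp add: C_def)
  have "mollifier 1 0 * \<bar>\<Delta>\<bar> \<le> 0 + \<epsilon>" if \<epsilon>: "\<epsilon> > 0" for \<epsilon>
  proof -
    \<comment> \<open>With h <= \<eta> the error B \<eta> c + C h is at most (B c + C) \<eta> <=
      \<epsilon>; the extra 1 keeps the denominator positive.\<close>
    define \<eta> where "\<eta> = \<epsilon> / (B * c + C + 1)"
    have \<eta>: "\<eta> > 0" using \<epsilon> B0 c0 C0 by (simp add: \<eta>_def add_nonneg_pos)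
    have "((\<lambda>s. L1_dist (u i s) (u i 0)) \<longlongrightarrow> 0) (at 0 within {0..})"
      by (rule u_L1_continuous[OF i]) simp
    from tendstoD[OF this \<eta>] obtain d where d: "d > 0"
      "\<And>s. s \<in> {0..} \<Longrightarrow> s \<noteq> 0 \<Longrightarrow> \<bar>s\<bar> < d \<Longrightarrow> L1_dist (u i s) (u i 0) < \<eta>"
      unfolding eventually_at by (auto simp: dist_real_def)
    define h where "h = min (d / 2) (min (T / 2) \<eta>)"
    have h: "0 < h" "h < T" "h < d" "h \<le> \<eta>" using d(1) T \<eta> by (auto simp: h_def min_def)
    have "(LBINT x. \<bar>U i (t, x) - w x\<bar>) \<le> \<eta>" if t: "0 \<le> t" "t \<le> h" for t
    proof -
      have tT: "t \<in> {0..T}" using t h by auto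
      have "(LBINT x. \<bar>U i (t, x) - w x\<bar>) = (L1_dist (u i t) (u i 0))"
        using U_AE[OF i tT] U_slice_borel[OF i] u_integrable[OF i, of t] u_integrable[OF i, of 0] t unfolding w_def
        by (intro integral_cong_AE) (auto elim!: eventually_mono)
      also have "\<dots> \<le> \<eta>" using d(2)[of t] t h \<eta> by (cases "t = 0") auto
      finally show ?thesis .
    qed
    from estimate[OF h(1,2) this] have "mollifier 1 0 * \<bar>\<Delta>\<bar> \<le> B * \<eta> * c + C * h" .
    also have "\<dots> \<le> B * \<eta> * c + C * \<eta>" using h(4) C0 by (intro add_left_mono mult_left_mono)
    also have "\<dots> = (B * c + C) * \<eta>" by (simp add: algebra_simps)
    also have "\<dots> \<le> (B * c + C + 1) * \<eta>" using \<eta> by (intro mult_right_mono) auto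
    also have "\<dots> = \<epsilon>" using B0 c0 C0 by (simp add: \<eta>_def add_nonneg_pos less_imp_neq[symmetric])
    finally show ?thesis by simp
  qed
  then have "mollifier 1 0 * \<bar>\<Delta>\<bar> \<le> 0" by (rule field_le_epsilon)
  then have "\<Delta> = 0" using mollifier(7)[of 1] by (simp add: mult_le_0_iff)
  then show ?thesis by (simp add: \<Delta>_def w_def b_def)
qed

text \<open>The value at time 0 and the data have equal averages against every translated mollifier,
  so their integrable difference vanishes a.e.\<close>

lemma initial_trace:
  assumes i: "i \<in> {1..N}"
  shows "AE x in lborel. u i 0 x = u0 i x"
proof -
  have int: "integrable lborel (u i 0)" "integrable lborel (u0 i)"
    using u_integrable[OF i, of 0] u0[OF i] by (auto simp: L1_Linf_def)
  have "AE x in lborel. u i 0 x - u0 i x = 0"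
  proof (rule mollified_zero_imp_AE_zero)
    show "integrable lborel (\<lambda>x. u i 0 x - u0 i x)" using int by simp
    fix e y :: real assume e: "0 < e"
    obtain B where B: "\<And>x. \<bar>mollifier e x\<bar> \<le> B" using bump_function_bounded[OF mollifier(4)[OF e]] by blast
    have "integrable lborel (\<lambda>x. g x * mollifier e (x - y))" if "integrable lborel g" for g :: "real \<Rightarrow> real"
      using integrable_bounded_mult[OF that, of "\<lambda>x. mollifier e (x - y)" B] mollifier_shift(3)[OF e, of y] B
      by (simp add: mult.commute)
    then show "(LBINT x. (u i 0 x - u0 i x) * mollifier e (x - y)) = 0"
      using int initial_average[OF i e, of y] by (simp add: left_diff_distrib)
  qed
  then show ?thesis by simp
qed

end

section \<open>Comparison down to time 0, positivity and contraction\<close>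

lemma continuous_into_L1_zero: "continuous_into_L1 (\<lambda>t x. 0)"
  by (simp add: continuous_into_L1_def set_borel_measurable_def case_prod_beta)

text \<open>L1 continuity passes to the excess because the positive part is 1-Lipschitz.\<close>

lemma excess_tendsto_initial:
  assumes "continuous_into_L1 u" "continuous_into_L1 w"
  shows "((\<lambda>t. L1_excess (u t) (w t)) \<longlongrightarrow> (L1_excess (u 0) (w 0))) (at_right 0)"
proof (rule LIM_zero_cancel, rule Lim_null_comparison)
  have u: "integrable lborel (u t)" and w: "integrable lborel (w t)" if "t \<ge> 0" for t
    using assms that unfolding continuous_into_L1_def by blast+
  have "((\<lambda>t. L1_dist (u t) (u 0)) \<longlongrightarrow> 0) (at 0 within {0..})"
    "((\<lambda>t. L1_dist (w t) (w 0)) \<longlongrightarrow> 0) (at 0 within {0..})"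
    using assms unfolding continuous_into_L1_def by auto
  note this[THEN tendsto_within_subset, OF Ioi_le_Ico]
  from tendsto_add[OF this]
  show "((\<lambda>t. (L1_dist (u t) (u 0)) + (L1_dist (w t) (w 0))) \<longlongrightarrow> 0) (at_right 0)" by simp
  show "\<forall>\<^sub>F t in at_right 0. norm ((L1_excess (u t) (w t)) - (L1_excess (u 0) (w 0)))
      \<le> (L1_dist (u t) (u 0)) + (L1_dist (w t) (w 0))"
    using eventually_at_right_less[of 0]
  proof eventually_elim
    case (elim t)
    note int = u[of t] u[of 0] w[of t] w[of 0]
    have im: "integrable lborel (\<lambda>x. max 0 (u t x - w t x))" "integrable lborel (\<lambda>x. max 0 (u 0 x - w 0 x))"
      using int elim by (auto intro!: integrable_max)
    have "\<bar>(L1_excess (u t) (w t)) - (L1_excess (u 0) (w 0))\<bar>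
       = \<bar>LBINT x. max 0 (u t x - w t x) - max 0 (u 0 x - w 0 x)\<bar>" using im by simp
    also have "\<dots> \<le> (LBINT x. \<bar>max 0 (u t x - w t x) - max 0 (u 0 x - w 0 x)\<bar>)" by (rule integral_abs_bound)
    also have "\<dots> \<le> (LBINT x. \<bar>u t x - u 0 x\<bar> + \<bar>w t x - w 0 x\<bar>)"
      using im int elim by (intro integral_mono) auto
    also have "\<dots> = (L1_dist (u t) (u 0)) + (L1_dist (w t) (w 0))" using int elim by simp
    finally show ?case by simp
  qed
qed

text \<open>\<open>comparison\<close> starts at a positive time. On each slice the families agree
  a.e. with the solutions, whose L1 continuity allows the starting time to tend to 0.\<close>

lemma (in kruzkov_pair) comparison_initial:
  assumes cont: "\<And>i. i \<in> {1..N} \<Longrightarrow> continuous_into_L1 (u i)" "\<And>i. i \<in> {1..N} \<Longrightarrow> continuous_into_L1 (w i)"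
    and AE_U: "\<And>i t. i \<in> {1..N} \<Longrightarrow> t \<in> {0..T} \<Longrightarrow> AE x in lborel. U i (t, x) = u i t x"
    and AE_V: "\<And>i t. i \<in> {1..N} \<Longrightarrow> t \<in> {0..T} \<Longrightarrow> AE x in lborel. V i (t, x) = w i t x"
    and t: "0 < t" "t < T"
  shows "(\<Sum>i=1..N. L1_excess (u i t) (w i t)) \<le> (\<Sum>i=1..N. L1_excess (u i 0) (w i 0))"
proof -
  have int: "integrable lborel (u i t)" "integrable lborel (w i t)" if "i \<in> {1..N}" "t \<ge> 0" for i t
    using cont that unfolding continuous_into_L1_def by blast+
  have eq: "(L1_excess (u i t) (w i t)) = (slice_excess (U i) (V i) t)"
    if i: "i \<in> {1..N}" and t: "t \<in> {0..T}" for i t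
  proof (rule integral_cong_AE)
    show "AE x in lborel. max 0 (u i t x - w i t x) = max 0 (U i (t, x) - V i (t, x))"
      using AE_U[OF i t] AE_V[OF i t] by eventually_elim simp
    show "(\<lambda>x. max 0 (u i t x - w i t x)) \<in> borel_measurable lborel"
      "(\<lambda>x. max 0 (U i (t, x) - V i (t, x))) \<in> borel_measurable lborel"
      using int[OF i, of t] regular(5,6)[OF i, of t] t
      by (intro borel_measurable_max borel_measurable_diff borel_measurable_const borel_measurable_integrable; simp)+
  qed
  have lim: "((\<lambda>s. \<Sum>i=1..N. L1_excess (u i s) (w i s)) \<longlongrightarrow> (\<Sum>i=1..N. L1_excess (u i 0) (w i 0))) (at_right 0)"
    by (intro tendsto_sum excess_tendsto_initial cont)
  have "eventually (\<lambda>s. s \<in> {0<..<t}) (at_right 0)" using t by (intro eventually_at_right_real)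
  then have "eventually (\<lambda>s. (\<Sum>i=1..N. L1_excess (u i t) (w i t)) \<le> (\<Sum>i=1..N. L1_excess (u i s) (w i s))) (at_right 0)"
  proof eventually_elim
    case (elim s)
    have sums: "(\<Sum>i=1..N. L1_excess (u i r) (w i r))
        = (\<Sum>i=1..N. slice_excess (U i) (V i) r)" if "r \<in> {0..T}" for r
      using that by (intro sum.cong refl eq) auto
    show ?case using comparison[of s t] sums[of s] sums[of t] elim t by simp
  qed
  from tendsto_lowerbound[OF lim this] show ?thesis by simp
qed

lemma entropy_solution_bounded:
  assumes "entropy_solution N v u0 u"
  shows "\<exists>M\<ge>0. \<forall>i\<in>{1..N}. \<forall>t\<in>{0..T}. AE x in lborel. \<bar>u i t x\<bar> \<le> M"
proof -
  have "\<forall>i\<in>{1..N}. \<exists>M. \<forall>t\<in>{0..T}. AE x in lborel. \<bar>u i t x\<bar> \<le> M"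
    using assms unfolding entropy_solution_def weak_solution_def locally_bounded_in_time_def by blast
  from bchoice[OF this] obtain M where M: "\<forall>i\<in>{1..N}. \<forall>t\<in>{0..T}. AE x in lborel. \<bar>u i t x\<bar> \<le> M i" by blast
  \<comment> \<open>Inserting 0 gives m >= 0 and covers N = 0.\<close>
  define m where "m = Max (insert 0 (M ` {1..N}))"
  have m: "M i \<le> m" if "i \<in> {1..N}" for i unfolding m_def using that by (intro Max_ge) auto
  have "m \<ge> 0" unfolding m_def by (intro Max_ge) auto
  moreover have "AE x in lborel. \<bar>u i t x\<bar> \<le> m" if i: "i \<in> {1..N}" and t: "t \<in> {0..T}" for i t
  proof -
    have "AE x in lborel. \<bar>u i t x\<bar> \<le> M i" using M i t by blast
    then show ?thesis by eventually_elim (use m[OF i] in linarith)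
  qed
  ultimately show ?thesis by blast
qed

text \<open>With the zero state as first member of the pair, the excess is the negative part of u,
  which vanishes at time 0. The sum of its integrals over the lanes stays 0, hence so does each
  summand.\<close>

lemma entropy_solution_nonneg:
  assumes v_lipschitz: "\<And>i. i \<in> {1..N} \<Longrightarrow> \<exists>L. L-lipschitz_on UNIV (v i)"
    and u0: "\<And>i. i \<in> {1..N} \<Longrightarrow> L1_Linf (u0 i)"
    and density: "\<And>i. i \<in> {1..N} \<Longrightarrow> AE x in lborel. 0 \<le> u0 i x"
    and u: "entropy_solution N v u0 u"
    and i: "i \<in> {1..N}" and t: "0 \<le> t"
  shows "AE x in lborel. 0 \<le> u i t x"
proof -
  define T where "T = t + 1"
  obtain M where M: "M \<ge> 0" "\<And>i t. i \<in> {1..N} \<Longrightarrow> t \<in> {0..T} \<Longrightarrow> AE x in lborel. \<bar>u i t x\<bar> \<le> M"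
    using entropy_solution_bounded[OF u] by blast
  interpret S: bounded_solution N v u0 u T "- M" M
  proof
    show "AE x in lborel. - M \<le> u i t x \<and> u i t x \<le> M" if "i \<in> {1..N}" "t \<in> {0..T}" for i t
      using M(2)[OF that] by eventually_elim auto
  qed (use assms M(1) t in \<open>auto simp: T_def\<close>)
  have trace: "AE x in lborel. 0 \<le> u i 0 x" if "i \<in> {1..N}" for i
    using S.initial_trace[OF that] density[OF that] by eventually_elim simp
  show ?thesis
  proof (cases "t = 0")
    case True then show ?thesis using trace[OF i] by simp
  next
    case False
    interpret K: kruzkov_pair N v T "\<lambda>i p. 0" S.U
    proof
      show "0 \<le> (heaviside (0 - S.U i q) - heaviside (0 - S.U (i + 1) q)) *
         (lane_change N v i 0 0 - lane_change N v i (S.U i q) (S.U (i + 1) q))"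
        if "i \<in> {1..<N}" for i and p q :: "pt"
      proof -
        have "lane_change N v i 0 0 = 0" by (simp add: lane_change_def)
        then show ?thesis using lane_change_comparison_zero[of "S.U i q" "S.U (i + 1) q" N v i] by simp
      qed
    qed (use v_lipschitz kruzkov_family_zero S.kruzkov_family_U in auto)
    have int: "integrable lborel (\<lambda>x. max 0 (0 - u j t x))" if "j \<in> {1..N}" for j
      using S.u_integrable[OF that t] by (intro integrable_max) auto
    have "(\<Sum>i=1..N. LBINT x. max 0 (0 - u i t x)) \<le> (\<Sum>i=1..N. LBINT x. max 0 (0 - u i 0 x))"
      by (rule K.comparison_initial[where u = "\<lambda>i t x. 0" and w = u])
         (use continuous_into_L1_zero S.continuous S.U_AE False t in \<open>auto simp: T_def\<close>)
    also have "\<dots> = (\<Sum>i=1..N. 0)"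
    proof (intro sum.cong refl)
      fix j assume j: "j \<in> {1..N}"
      have "(LBINT x. max 0 (0 - u j 0 x)) = (LBINT x::real. 0)"
        using trace[OF j] S.u_integrable[OF j, of 0]
        by (intro integral_cong_AE) (auto elim!: eventually_mono)
      then show "(LBINT x. max 0 (0 - u j 0 x)) = 0" by simp
    qed
    finally have "(\<Sum>i=1..N. LBINT x. max 0 (0 - u i t x)) \<le> 0" by simp
    moreover have nn: "(LBINT x. max 0 (0 - u j t x)) \<ge> 0" for j by simp
    ultimately have "(LBINT x. max 0 (0 - u i t x)) = 0"
      using sum_nonneg_eq_0_iff[of "{1..N}" "\<lambda>j. LBINT x. max 0 (0 - u j t x)"] i
        sum_nonneg[of "{1..N}" "\<lambda>j. LBINT x. max 0 (0 - u j t x)"] by force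
    then have "AE x in lborel. max 0 (0 - u i t x) = 0"
      using integral_nonneg_eq_0_iff_AE[OF int[OF i]] by simp
    then show ?thesis by eventually_elim auto
  qed
qed

theorem theorem3p3:
  fixes N :: nat
    and v :: "nat \<Rightarrow> real \<Rightarrow> real"
    and u0 ubar0 :: "nat \<Rightarrow> real \<Rightarrow> real"
    and u ubar :: "nat \<Rightarrow> real \<Rightarrow> real \<Rightarrow> real"
  assumes v_lipschitz: "\<And>i. i \<in> {1..N} \<Longrightarrow> \<exists>L. L-lipschitz_on UNIV (v i)"
    and v_decreasing: "\<And>i. i \<in> {1..N} \<Longrightarrow> antimono_on {0..} (v i)"
    and u0: "\<And>i. i \<in> {1..N} \<Longrightarrow> L1_Linf (u0 i)"
    and ubar0: "\<And>i. i \<in> {1..N} \<Longrightarrow> L1_Linf (ubar0 i)"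
    and u0_density: "\<And>i. i \<in> {1..N} \<Longrightarrow> AE x in lborel. 0 \<le> u0 i x"
    and ubar0_density: "\<And>i. i \<in> {1..N} \<Longrightarrow> AE x in lborel. 0 \<le> ubar0 i x"
    and u: "entropy_solution N v u0 u"
    and ubar: "entropy_solution N v ubar0 ubar"
    and t: "0 < t"
  shows "(\<Sum>i=1..N. LINT x|lborel. \<bar>u i t x - ubar i t x\<bar>)
         \<le> (\<Sum>i=1..N. LINT x|lborel. \<bar>u0 i x - ubar0 i x\<bar>)"
proof -
  \<comment> \<open>Any horizon beyond t serves.\<close>
  define T where "T = t + 1"
  have bounded: "\<exists>M\<ge>0. \<forall>i\<in>{1..N}. \<forall>s\<in>{0..T}. AE x in lborel. 0 \<le> w i s x \<and> w i s x \<le> M"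
    if w0: "\<And>i. i \<in> {1..N} \<Longrightarrow> L1_Linf (w0 i)" "\<And>i. i \<in> {1..N} \<Longrightarrow> AE x in lborel. 0 \<le> w0 i x"
      and w: "entropy_solution N v w0 w" for w0 w
  proof -
    obtain M where M: "M \<ge> 0" "\<And>i s. i \<in> {1..N} \<Longrightarrow> s \<in> {0..T} \<Longrightarrow> AE x in lborel. \<bar>w i s x\<bar> \<le> M"
      using entropy_solution_bounded[OF w] by blast
    have "AE x in lborel. 0 \<le> w i s x \<and> w i s x \<le> M" if i: "i \<in> {1..N}" and s: "s \<in> {0..T}" for i s
    proof -
      have "AE x in lborel. 0 \<le> w i s x"
        by (rule entropy_solution_nonneg[of N v w0 w i s, OF v_lipschitz w0 w i]) (use s in auto)
      then show ?thesis using M(2)[OF i s] by eventually_elim auto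
    qed
    then show ?thesis using M(1) by blast
  qed
  obtain M where M: "M \<ge> 0" "\<And>i s. i \<in> {1..N} \<Longrightarrow> s \<in> {0..T} \<Longrightarrow> AE x in lborel. 0 \<le> u i s x \<and> u i s x \<le> M"
    using bounded[OF u0 u0_density u] by blast
  obtain M' where M': "M' \<ge> 0" "\<And>i s. i \<in> {1..N} \<Longrightarrow> s \<in> {0..T} \<Longrightarrow> AE x in lborel. 0 \<le> ubar i s x \<and> ubar i s x \<le> M'"
    using bounded[OF ubar0 ubar0_density ubar] by blast
  \<comment> \<open>With lower bound 0 the truncations are nonnegative at every point and not only
    a.e., as the exchange inequality between arbitrary points requires.\<close>
  interpret S: bounded_solution N v u0 u T 0 M
    by unfold_locales (use v_lipschitz u0 u t M in \<open>auto simp: T_def\<close>)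
  interpret S': bounded_solution N v ubar0 ubar T 0 M'
    by unfold_locales (use v_lipschitz ubar0 ubar t M' in \<open>auto simp: T_def\<close>)
  interpret K: kruzkov_pair N v T S.U S'.U
    by unfold_locales (use v_lipschitz S.kruzkov_family_U S'.kruzkov_family_U
      lane_change_comparison[OF v_decreasing _ S.U_range(1) S'.U_range(1) S.U_range(1) S'.U_range(1)] in auto)
  interpret K': kruzkov_pair N v T S'.U S.U
    by unfold_locales (use v_lipschitz S.kruzkov_family_U S'.kruzkov_family_U
      lane_change_comparison[OF v_decreasing _ S'.U_range(1) S.U_range(1) S'.U_range(1) S.U_range(1)] in auto)
  have split: "L1_dist g k = (L1_excess g k) + (L1_excess k g)"
    if "integrable lborel g" "integrable lborel k" for g k :: "real \<Rightarrow> real"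
  proof -
    have "\<bar>g x - k x\<bar> = max 0 (g x - k x) + max 0 (k x - g x)" for x by linarith
    moreover have "integrable lborel (\<lambda>x. max 0 (g x - k x))" "integrable lborel (\<lambda>x. max 0 (k x - g x))"
      using that by (auto intro!: integrable_max)
    ultimately show ?thesis by simp
  qed
  have tT: "t < T" by (simp add: T_def)
  have "(\<Sum>i=1..N. L1_dist (u i t) (ubar i t))
     = (\<Sum>i=1..N. L1_excess (u i t) (ubar i t)) + (\<Sum>i=1..N. L1_excess (ubar i t) (u i t))"
    unfolding sum.distrib[symmetric] using S.u_integrable S'.u_integrable t
    by (intro sum.cong refl split) auto
  also have "\<dots> \<le> (\<Sum>i=1..N. L1_excess (u i 0) (ubar i 0)) + (\<Sum>i=1..N. L1_excess (ubar i 0) (u i 0))"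
    by (intro add_mono K.comparison_initial K'.comparison_initial S.continuous S'.continuous S.U_AE S'.U_AE t tT)
  also have "\<dots> = (\<Sum>i=1..N. L1_dist (u i 0) (ubar i 0))"
    unfolding sum.distrib[symmetric] using S.u_integrable S'.u_integrable
    by (intro sum.cong refl split[symmetric]) auto
  \<comment> \<open>So far the bound involves the solutions at time 0; the initial trace replaces
    them by the given data.\<close>
  also have "\<dots> = (\<Sum>i=1..N. L1_dist (u0 i) (ubar0 i))"
  proof (intro sum.cong refl integral_cong_AE)
    fix i assume i: "i \<in> {1..N}"
    show "AE x in lborel. \<bar>u i 0 x - ubar i 0 x\<bar> = \<bar>u0 i x - ubar0 i x\<bar>"
      using S.initial_trace[OF i] S'.initial_trace[OF i] by eventually_elim simp
    show "(\<lambda>x. \<bar>u i 0 x - ubar i 0 x\<bar>) \<in> borel_measurable lborel"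
      using S.u_integrable[OF i, of 0] S'.u_integrable[OF i, of 0] by auto
    show "(\<lambda>x. \<bar>u0 i x - ubar0 i x\<bar>) \<in> borel_measurable lborel"
      using u0[OF i] ubar0[OF i] unfolding L1_Linf_def by auto
  qed
  finally show ?thesis .
qed

end
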